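(* Let $\alpha\in(0,1)$, let $\Omega$ be a bounded domain of $\mathbb{R}^2$ with sufficiently smooth boundary $\partial\Omega$, and let $H(u)=u^3e^{u^2}$. Then there is $\delta>0$, independent of $\mathscr{T}$, such that for every $I=[0,\mathscr{T}]$ with $\mathscr{T}\in(0,\infty)$ and every $u_0\in D^1(\Omega)$ with $\|u_0\|_{D^1(\Omega)}\le\delta$, there exists a unique mild solution in $C(I\to L^{\Xi}(\Omega))$ of the problem $$\partial_t^\alpha u-\partial_t^\alpha\Delta u-\Delta u=H(u)\ \text{ in }\Omega\times(0,\infty),\qquad u=0\ \text{ on }\partial\Omega\times(0,\infty),\qquad u(\cdot,0)=u_0\ \text{ in }\Omega.$$
   Context: $\partial_t^\alpha$ is the Caputo time derivative of order $\alpha$. $L^\Xi(\Omega)$ is the Orlicz space with Young function $\Xi(z)=e^{z^2}-1$: the measurable functions $w$ on $\Omega$ with $\int_\Omega\Xi(|w(x)|/\kappa)\,dx<\infty$ for some $\kappa>0$, with the Luxemburg norm $\|w\|_{L^\Xi(\Omega)}=\inf\{\kappa>0:\int_\Omega\Xi(|w(x)|/\kappa)\,dx\le1\}$. Let $0<\theta_1\le\theta_2\le\dots$ be the eigenvalues of $-\Delta$ on $\Omega$ with homogeneous Dirichlet condition, and $\{\phi_k\}_{k\in\mathbb{N}}$ corresponding eigenfunctions forming a complete orthonormal system of $L^2(\Omega)$; $\langle w,v\rangle=\int_\Omega wv\,dz$. $D^1(\Omega)=\{w\in L^2(\Omega): \|w\|_{D^1(\Omega)}^2=\sum_{k}\theta_k\langle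 w,\phi_k\rangle^2<\infty\}$. For a Banach space $X$ and a compact interval $I$, $C(I\to X)$ is the space of continuous functions $w:I\to X$ with the sup norm. The Mittag-Leffler functions are $E_{\alpha,\zeta}(z)=\sum_{k=0}^\infty z^k/\Gamma(\alpha k+\zeta)$ and $E_\alpha=E_{\alpha,1}$. Define $$\mathscr{S}(t)w=\sum_{k=1}^\infty E_\alpha\Big(\frac{-\theta_kt^\alpha}{1+\theta_k}\Big)\langle w,\phi_k\rangle\phi_k,\qquad \mathscr{R}(t)w=\sum_{k=1}^\infty\frac{t^{\alpha-1}}{1+\theta_k}E_{\alpha,\alpha}\Big(\frac{-\theta_kt^\alpha}{1+\theta_k}\Big)\langle w,\phi_k\rangle\phi_k .$$ A mild solution on $I=[0,\mathscr{T}]$ is a function $u$ satisfying, for $t\in I$, $$u(t)=\mathscr{S}(t)u_0+\int_0^t\mathscr{R}(t-\tau)H(u(\tau))\,d\tau .$$ *)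

theory Defs
  imports "HOL-Analysis.Analysis"
begin

text \<open>
  Elements of function spaces are represented by functions on the whole plane of which only the
  values on \<Omega> matter; equality in these spaces is equality almost everywhere on \<Omega>.
  Eigenvalues and eigenfunctions are numbered from 0 instead of 1.
\<close>

section \<open>Domains\<close>

text \<open>
  For finite-dimensional arguments this is \<open>C\<^sup>k\<close> on the whole space: all directional derivatives
  of order at most \<open>k\<close> exist and are continuous.
\<close>

primrec Ck :: "nat \<Rightarrow> ('a::real_normed_vector \<Rightarrow> real) \<Rightarrow> bool" where
  "Ck 0 f \<longleftrightarrow> continuous_on UNIV f"
| "Ck (Suc k) f \<longleftrightarrow> (\<forall>x. f differentiable (at x)) \<and> (\<forall>v. Ck k (\<lambda>x. frechet_derivative f (at x) v))"

text \<open>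
  Near each boundary point, \<Omega> is the region strictly above the graph of a \<open>C\<^sup>k\<close> function with
  respect to some orthonormal frame \<open>e1\<close>, \<open>e2\<close>.
\<close>

definition Ck_boundary :: "nat \<Rightarrow> (real^2) set \<Rightarrow> bool" where
  "Ck_boundary k \<Omega> \<longleftrightarrow>
     (\<forall>p \<in> frontier \<Omega>. \<exists>r>0. \<exists>e1 e2 :: real^2. \<exists>\<gamma> :: real \<Rightarrow> real.
        norm e1 = 1 \<and> norm e2 = 1 \<and> e1 \<bullet> e2 = 0 \<and> Ck k \<gamma> \<and>
        \<Omega> \<inter> ball p r = {x \<in> ball p r. \<gamma> (x \<bullet> e1) < x \<bullet> e2})"

definition bounded_domain :: "(real^2) set \<Rightarrow> bool" where
  "bounded_domain \<Omega> \<longleftrightarrow> open \<Omega> \<and> connected \<Omega> \<and> \<Omega> \<noteq> {} \<and> bounded \<Omega>"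


section \<open>Square integrable functions\<close>

definition L2 :: "(real^2) set \<Rightarrow> (real^2 \<Rightarrow> real) set" where
  "L2 \<Omega> = {w. w \<in> borel_measurable (lebesgue_on \<Omega>) \<and> integrable (lebesgue_on \<Omega>) (\<lambda>x. (w x)\<^sup>2)}"

definition L2_inner :: "(real^2) set \<Rightarrow> (real^2 \<Rightarrow> real) \<Rightarrow> (real^2 \<Rightarrow> real) \<Rightarrow> real" where
  "L2_inner \<Omega> w v = (LINT x|lebesgue_on \<Omega>. w x * v x)"

definition L2_norm :: "(real^2) set \<Rightarrow> (real^2 \<Rightarrow> real) \<Rightarrow> real" where
  "L2_norm \<Omega> w = sqrt (L2_inner \<Omega> w w)"

definition L2_sums :: "(real^2) set \<Rightarrow> (nat \<Rightarrow> real^2 \<Rightarrow> real) \<Rightarrow> (real^2 \<Rightarrow> real) \<Rightarrow> bool" where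
  "L2_sums \<Omega> f v \<longleftrightarrow> v \<in> L2 \<Omega> \<and> (\<lambda>n. L2_norm \<Omega> (\<lambda>x. (\<Sum>k<n. f k x) - v x)) \<longlonglongrightarrow> 0"

text \<open>Some representative of the sum in \<open>L\<^sup>2\<close>; meaningful only for convergent series.\<close>

definition L2_suminf :: "(real^2) set \<Rightarrow> (nat \<Rightarrow> real^2 \<Rightarrow> real) \<Rightarrow> real^2 \<Rightarrow> real" where
  "L2_suminf \<Omega> f = (SOME v. L2_sums \<Omega> f v)"

text \<open>
  Bochner integral over the set \<open>A\<close> of an \<open>L\<^sup>2\<close>-valued function \<open>F\<close> of time. The approximating
  simple functions are \<open>\<Sum>j<m n. indicator (B n j) \<tau> * c n j x\<close>. Integrability of the distances
  includes their measurability, so that \<open>F\<close> is strongly measurable.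
\<close>

definition has_L2_integral ::
    "(real^2) set \<Rightarrow> (real \<Rightarrow> real^2 \<Rightarrow> real) \<Rightarrow> (real^2 \<Rightarrow> real) \<Rightarrow> real set \<Rightarrow> bool" where
  "has_L2_integral \<Omega> F J A \<longleftrightarrow>
     (AE \<tau> in lebesgue_on A. F \<tau> \<in> L2 \<Omega>) \<and> J \<in> L2 \<Omega> \<and>
     (\<exists>(m :: nat \<Rightarrow> nat) (B :: nat \<Rightarrow> nat \<Rightarrow> real set) (c :: nat \<Rightarrow> nat \<Rightarrow> real^2 \<Rightarrow> real).
        (\<forall>n. \<forall>j<m n. B n j \<in> lmeasurable \<and> B n j \<subseteq> A \<and> c n j \<in> L2 \<Omega>) \<and>
        (\<forall>n. integrable (lebesgue_on A)
               (\<lambda>\<tau>. L2_norm \<Omega> (\<lambda>x. F \<tau> x - (\<Sum>j<m n. indicator (B n j) \<tau> * c n j x)))) \<and>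
        (\<lambda>n. LINT \<tau>|lebesgue_on A.
               L2_norm \<Omega> (\<lambda>x. F \<tau> x - (\<Sum>j<m n. indicator (B n j) \<tau> * c n j x))) \<longlonglongrightarrow> 0 \<and>
        (\<lambda>n. L2_norm \<Omega> (\<lambda>x. (\<Sum>j<m n. measure lebesgue (B n j) * c n j x) - J x)) \<longlonglongrightarrow> 0)"


section \<open>The Dirichlet Laplacian\<close>

definition partial_deriv :: "2 \<Rightarrow> (real^2 \<Rightarrow> real) \<Rightarrow> real^2 \<Rightarrow> real" where
  "partial_deriv i f x = frechet_derivative f (at x) (axis i 1)"

definition test_function :: "(real^2) set \<Rightarrow> (real^2 \<Rightarrow> real) \<Rightarrow> bool" where
  "test_function \<Omega> \<psi> \<longleftrightarrow> (\<forall>k. Ck k \<psi>) \<and> (\<exists>K. compact K \<and> K \<subseteq> \<Omega> \<and> (\<forall>x. x \<notin> K \<longrightarrow> \<psi> x = 0))"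

definition weak_gradient :: "(real^2) set \<Rightarrow> (real^2 \<Rightarrow> real) \<Rightarrow> (2 \<Rightarrow> real^2 \<Rightarrow> real) \<Rightarrow> bool" where
  "weak_gradient \<Omega> w g \<longleftrightarrow>
     (\<forall>i. g i \<in> L2 \<Omega> \<and>
        (\<forall>\<psi>. test_function \<Omega> \<psi> \<longrightarrow> L2_inner \<Omega> w (partial_deriv i \<psi>) = - L2_inner \<Omega> (g i) \<psi>))"

text \<open>The closure of the test functions in the Sobolev space \<open>H\<^sup>1\<close>.\<close>

definition H1_0 :: "(real^2) set \<Rightarrow> (real^2 \<Rightarrow> real) set" where
  "H1_0 \<Omega> = {w \<in> L2 \<Omega>. \<exists>g. weak_gradient \<Omega> w g \<and>
     (\<exists>\<psi> :: nat \<Rightarrow> real^2 \<Rightarrow> real. (\<forall>n. test_function \<Omega> (\<psi> n)) \<and>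
        (\<lambda>n. L2_norm \<Omega> (\<lambda>x. \<psi> n x - w x)) \<longlonglongrightarrow> 0 \<and>
        (\<forall>i. (\<lambda>n. L2_norm \<Omega> (\<lambda>x. partial_deriv i (\<psi> n) x - g i x)) \<longlonglongrightarrow> 0))}"

text \<open>Nontrivial weak solutions of \<open>-\<Delta>\<phi> = \<mu> \<phi>\<close> in \<Omega> with \<open>\<phi> = 0\<close> on the boundary.\<close>

definition Dirichlet_eigenfunction :: "(real^2) set \<Rightarrow> real \<Rightarrow> (real^2 \<Rightarrow> real) \<Rightarrow> bool" where
  "Dirichlet_eigenfunction \<Omega> \<mu> \<phi> \<longleftrightarrow>
     \<phi> \<in> H1_0 \<Omega> \<and> \<not> (AE x in lebesgue_on \<Omega>. \<phi> x = 0) \<and>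
     (\<exists>g. weak_gradient \<Omega> \<phi> g \<and>
        (\<forall>\<psi>. test_function \<Omega> \<psi> \<longrightarrow>
           (\<Sum>i\<in>UNIV. L2_inner \<Omega> (g i) (partial_deriv i \<psi>)) = \<mu> * L2_inner \<Omega> \<phi> \<psi>))"

definition complete_orthonormal :: "(real^2) set \<Rightarrow> (nat \<Rightarrow> real^2 \<Rightarrow> real) \<Rightarrow> bool" where
  "complete_orthonormal \<Omega> \<phi> \<longleftrightarrow>
     (\<forall>k. \<phi> k \<in> L2 \<Omega>) \<and>
     (\<forall>j k. L2_inner \<Omega> (\<phi> j) (\<phi> k) = (if j = k then 1 else 0)) \<and>
     (\<forall>w \<in> L2 \<Omega>. L2_sums \<Omega> (\<lambda>k x. L2_inner \<Omega> w (\<phi> k) * \<phi> k x) w)"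

text \<open>Completeness forces \<theta> to list every eigenvalue, repeated according to multiplicity.\<close>

definition Dirichlet_eigensystem ::
    "(real^2) set \<Rightarrow> (nat \<Rightarrow> real) \<Rightarrow> (nat \<Rightarrow> real^2 \<Rightarrow> real) \<Rightarrow> bool" where
  "Dirichlet_eigensystem \<Omega> \<theta> \<phi> \<longleftrightarrow>
     (\<forall>k. 0 < \<theta> k) \<and> mono \<theta> \<and>
     (\<forall>k. Dirichlet_eigenfunction \<Omega> (\<theta> k) (\<phi> k)) \<and>
     complete_orthonormal \<Omega> \<phi>"

definition D1 :: "(real^2) set \<Rightarrow> (nat \<Rightarrow> real) \<Rightarrow> (nat \<Rightarrow> real^2 \<Rightarrow> real) \<Rightarrow> (real^2 \<Rightarrow> real) set" where
  "D1 \<Omega> \<theta> \<phi> = {w \<in> L2 \<Omega>. summable (\<lambda>k. \<theta> k * (L2_inner \<Omega> w (\<phi> k))\<^sup>2)}"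

definition D1_norm ::
    "(real^2) set \<Rightarrow> (nat \<Rightarrow> real) \<Rightarrow> (nat \<Rightarrow> real^2 \<Rightarrow> real) \<Rightarrow> (real^2 \<Rightarrow> real) \<Rightarrow> real" where
  "D1_norm \<Omega> \<theta> \<phi> w = sqrt (\<Sum>k. \<theta> k * (L2_inner \<Omega> w (\<phi> k))\<^sup>2)"


section \<open>The Orlicz space\<close>

definition Xi :: "real \<Rightarrow> real" where
  "Xi z = exp (z\<^sup>2) - 1"

definition LXi :: "(real^2) set \<Rightarrow> (real^2 \<Rightarrow> real) set" where
  "LXi \<Omega> = {w. w \<in> borel_measurable (lebesgue_on \<Omega>) \<and>
     (\<exists>\<kappa>>0. (\<integral>\<^sup>+x. ennreal (Xi (\<bar>w x\<bar> / \<kappa>)) \<partial>lebesgue_on \<Omega>) < \<infinity>)}"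

definition LXi_norm :: "(real^2) set \<Rightarrow> (real^2 \<Rightarrow> real) \<Rightarrow> real" where
  "LXi_norm \<Omega> w = Inf {\<kappa>. 0 < \<kappa> \<and> (\<integral>\<^sup>+x. ennreal (Xi (\<bar>w x\<bar> / \<kappa>)) \<partial>lebesgue_on \<Omega>) \<le> 1}"

definition C_LXi :: "real set \<Rightarrow> (real^2) set \<Rightarrow> (real \<Rightarrow> real^2 \<Rightarrow> real) set" where
  "C_LXi I \<Omega> = {u. (\<forall>t\<in>I. u t \<in> LXi \<Omega>) \<and>
     (\<forall>t\<in>I. ((\<lambda>s. LXi_norm \<Omega> (\<lambda>x. u s x - u t x)) \<longlongrightarrow> 0) (at t within I))}"


section \<open>Mild solutions\<close>

definition mittag_leffler :: "real \<Rightarrow> real \<Rightarrow> real \<Rightarrow> real" where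
  "mittag_leffler \<alpha> \<zeta> z = (\<Sum>k. z ^ k / Gamma (\<alpha> * real k + \<zeta>))"

definition S_op :: "(real^2) set \<Rightarrow> (nat \<Rightarrow> real) \<Rightarrow> (nat \<Rightarrow> real^2 \<Rightarrow> real) \<Rightarrow> real \<Rightarrow> real \<Rightarrow>
    (real^2 \<Rightarrow> real) \<Rightarrow> real^2 \<Rightarrow> real" where
  "S_op \<Omega> \<theta> \<phi> \<alpha> t w = L2_suminf \<Omega> (\<lambda>k x.
     mittag_leffler \<alpha> 1 (- \<theta> k * t powr \<alpha> / (1 + \<theta> k)) * L2_inner \<Omega> w (\<phi> k) * \<phi> k x)"

definition R_op :: "(real^2) set \<Rightarrow> (nat \<Rightarrow> real) \<Rightarrow> (nat \<Rightarrow> real^2 \<Rightarrow> real) \<Rightarrow> real \<Rightarrow> real \<Rightarrow>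
    (real^2 \<Rightarrow> real) \<Rightarrow> real^2 \<Rightarrow> real" where
  "R_op \<Omega> \<theta> \<phi> \<alpha> t w = L2_suminf \<Omega> (\<lambda>k x.
     t powr (\<alpha> - 1) / (1 + \<theta> k) * mittag_leffler \<alpha> \<alpha> (- \<theta> k * t powr \<alpha> / (1 + \<theta> k))
       * L2_inner \<Omega> w (\<phi> k) * \<phi> k x)"

text \<open>
  \<open>H \<circ> u \<tau>\<close> is the function \<open>H(u(\<tau>))\<close> on \<Omega>. It must be square integrable for almost every
  \<open>\<tau>\<close>, since otherwise \<open>R_op\<close> is not meaningful.
\<close>

definition mild_solution :: "(real^2) set \<Rightarrow> (nat \<Rightarrow> real) \<Rightarrow> (nat \<Rightarrow> real^2 \<Rightarrow> real) \<Rightarrow> real \<Rightarrow>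
    (real \<Rightarrow> real) \<Rightarrow> (real^2 \<Rightarrow> real) \<Rightarrow> real \<Rightarrow> (real \<Rightarrow> real^2 \<Rightarrow> real) \<Rightarrow> bool" where
  "mild_solution \<Omega> \<theta> \<phi> \<alpha> H u0 T u \<longleftrightarrow>
     (AE \<tau> in lebesgue_on {0..T}. H \<circ> u \<tau> \<in> L2 \<Omega>) \<and>
     (\<forall>t\<in>{0..T}. \<exists>J. has_L2_integral \<Omega> (\<lambda>\<tau>. R_op \<Omega> \<theta> \<phi> \<alpha> (t - \<tau>) (H \<circ> u \<tau>)) J {0..t} \<and>
        (AE x in lebesgue_on \<Omega>. u t x = S_op \<Omega> \<theta> \<phi> \<alpha> t u0 x + J x))"

end

theory Submission
  imports Defs
begin

text \<open>
  In the coordinates \<open>sqrt (\<theta> k) * \<langle>w, \<phi> k\<rangle>\<close> the space \<open>D1\<close> is \<open>\<ell>\<^sup>2\<close>, and the Trudinger inequality embeds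
  it continuously into \<open>L\<^sup>\<Xi>\<close>. The latter is obtained without rearrangement: the Sobolev inequality of
  \<open>W\<^sup>1\<^sup>,\<^sup>1\<close> into \<open>L\<^sup>2\<close> in the plane, applied to truncations between consecutive levels, makes the
  measures of the level sets of a function of unit energy decay like \<open>exp (- c * s\<^sup>2)\<close>. On a small ball
  of \<open>L\<^sup>\<Xi>\<close> the map \<open>w \<mapsto> H w\<close> is Lipschitz into \<open>L\<^sup>2\<close>, with a constant quadratic in the radius.
  The eigenvalues \<open>\<theta> k / (1 + \<theta> k)\<close> lie between \<open>lam \<theta> 0 > 0\<close> and 1. The kernels
  \<open>t powr (\<alpha> - 1) * E\<^sub>\<alpha>\<^sub>,\<^sub>\<alpha> (- l * t powr \<alpha>)\<close> are positive and decrease in \<open>l\<close>, by a first-zero argument for the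
  Volterra equation and the resolvent identity, so that they are all dominated by the kernel of
  \<open>lam \<theta> 0\<close>, whose integral over every \<open>[0, T]\<close> is at most \<open>1 / lam \<theta> 0\<close>. Hence the Duhamel
  operator is bounded from \<open>L\<^sup>2\<close> to \<open>D1\<close> uniformly in \<open>T\<close>, and for small data the Banach fixed
  point theorem applies. A competing solution agrees with the fixed point as long as it is small in
  \<open>L\<^sup>\<Xi>\<close>, and by continuity agreement up to a time propagates beyond it.
\<close>

section \<open>Square summable sequences\<close>

text \<open>Functions on \<Omega> are raw functions compared almost everywhere, so they form no
  Banach space type. Bochner integration and the Banach fixed point theorem are therefore carried
  out in the type \<open>ell2\<close>, and only the end points of the argument are translated back.
  Two coordinate systems occur: plain L^2 coordinates for the values of the nonlinearity, and energy
  coordinates, weighted by \<open>sqrt (\<theta> k)\<close>, for the solution. Passing from the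
  first to the second costs the factor \<open>sqrt (\<theta> k)\<close>, which the factor
  \<open>1 / (1 + \<theta> k)\<close> of the solution operator pays for. The obstacle in uniqueness
  is that a competitor is only known to be continuous into L^\<Xi>, without any bound on its size,
  while the Lipschitz bound for H is available for small functions only. Smallness has to be
  produced from the initial value and carried forward in time. All smallness is collected in two
  numbers: the radius \<open>M\<close> in L^\<Xi>, at which the exponentials of H are integrable
  with room to spare, and a contraction factor 1/4 for the composition of H with the Duhamel
  operator.\<close>

typedef ell2 = "{x :: nat \<Rightarrow> real. summable (\<lambda>k. (x k)\<^sup>2)}"
  morphisms coord Abs_ell2
  by (rule exI[of _ "\<lambda>_. 0"]) simp

lemma summable_coord_sq: "summable (\<lambda>k. (coord x k)\<^sup>2)"
  using coord[of x] by simp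

lemma coord_Abs: "summable (\<lambda>k. (f k)\<^sup>2) \<Longrightarrow> coord (Abs_ell2 f) k = f k"
  by (simp add: Abs_ell2_inverse)

lemma ell2_eqI: "(\<And>k. coord x k = coord y k) \<Longrightarrow> x = y"
  by (metis coord_inject ext)

lemma abs_mult_le_sum_sq: "\<bar>a * b\<bar> \<le> a\<^sup>2 + (b::real)\<^sup>2"
proof -
  have "2 * \<bar>a\<bar> * \<bar>b\<bar> \<le> a\<^sup>2 + b\<^sup>2"
    using sum_squares_bound[of "\<bar>a\<bar>" "\<bar>b\<bar>"] by simp
  moreover have "0 \<le> \<bar>a\<bar> * \<bar>b\<bar>" by simp
  ultimately show ?thesis unfolding abs_mult by linarith
qed

lemma summable_mult_sq:
  fixes f g :: "nat \<Rightarrow> real"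
  assumes "summable (\<lambda>k. (f k)\<^sup>2)" "summable (\<lambda>k. (g k)\<^sup>2)"
  shows "summable (\<lambda>k. f k * g k)"
proof (rule summable_comparison_test'[where N=0])
  show "summable (\<lambda>k. (f k)\<^sup>2 + (g k)\<^sup>2)" using assms by (rule summable_add)
  show "norm (f k * g k) \<le> (f k)\<^sup>2 + (g k)\<^sup>2" for k
    using abs_mult_le_sum_sq by simp
qed

lemma summable_add_sq:
  fixes f g :: "nat \<Rightarrow> real"
  assumes "summable (\<lambda>k. (f k)\<^sup>2)" "summable (\<lambda>k. (g k)\<^sup>2)"
  shows "summable (\<lambda>k. (f k + g k)\<^sup>2)"
  using summable_add[OF summable_add[OF assms] summable_mult[OF summable_mult_sq[OF assms], of 2]]
  by (simp add: power2_sum algebra_simps)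

lemma summable_scale_sq:
  fixes f :: "nat \<Rightarrow> real"
  assumes "summable (\<lambda>k. (f k)\<^sup>2)" 
  shows "summable (\<lambda>k. (c * f k)\<^sup>2)"
  using summable_mult[OF assms, of "c\<^sup>2"] by (simp add: power_mult_distrib)

instantiation ell2 :: real_inner
begin

definition "zero_ell2 = Abs_ell2 (\<lambda>_. 0)"
definition "plus_ell2 x y = Abs_ell2 (\<lambda>k. coord x k + coord y k)"
definition "scaleR_ell2 c x = Abs_ell2 (\<lambda>k. c * coord x k)"
definition "uminus_ell2 (x::ell2) = (-1) *\<^sub>R x"
definition "minus_ell2 (x::ell2) y = x + - y"
definition "inner_ell2 x y = (\<Sum>k. coord x k * coord y k)"
definition "norm_ell2 (x::ell2) = sqrt (x \<bullet> x)"
definition "dist_ell2 (x::ell2) y = norm (x - y)"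
definition "sgn_ell2 (x::ell2) = inverse (norm x) *\<^sub>R x"
definition "uniformity_ell2 = (INF e\<in>{0 <..}. principal {(x::ell2, y). dist x y < e})"
definition "open_ell2 (U :: ell2 set) = (\<forall>x\<in>U. \<forall>\<^sub>F (x', y) in uniformity. x' = x \<longrightarrow> y \<in> U)"

lemma coord_zero [simp]: "coord 0 k = 0"
  by (simp add: zero_ell2_def coord_Abs)

lemma coord_plus [simp]: "coord (x + y) k = coord x k + coord y k"
  unfolding plus_ell2_def by (intro coord_Abs summable_add_sq summable_coord_sq)

lemma coord_scaleR [simp]: "coord (c *\<^sub>R x) k = c * coord x k"
  unfolding scaleR_ell2_def by (intro coord_Abs summable_scale_sq summable_coord_sq)

lemma coord_uminus [simp]: "coord (- x) k = - coord x k"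
  by (simp add: uminus_ell2_def)

lemma coord_minus [simp]: "coord (x - y) k = coord x k - coord y k"
  by (simp add: minus_ell2_def)

instance
proof
  fix x y z :: ell2 and r s :: real
  show "x + y + z = x + (y + z)" "x + y = y + x" "0 + x = x" "- x + x = 0" "x - y = x + - y"
    by (auto intro!: ell2_eqI)
  show "r *\<^sub>R (x + y) = r *\<^sub>R x + r *\<^sub>R y" "(r + s) *\<^sub>R x = r *\<^sub>R x + s *\<^sub>R x"
    "r *\<^sub>R s *\<^sub>R x = (r * s) *\<^sub>R x" "1 *\<^sub>R x = x"
    by (auto intro!: ell2_eqI simp: algebra_simps)
  show "dist x y = norm (x - y)" by (rule dist_ell2_def)
  show "sgn x = inverse (norm x) *\<^sub>R x" by (simp only: sgn_ell2_def)
  show "uniformity = (INF e\<in>{0 <..}. principal {(x::ell2, y). dist x y < e})"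
    by (rule uniformity_ell2_def)
  show "open U \<longleftrightarrow> (\<forall>x\<in>U. \<forall>\<^sub>F (x', y) in uniformity. x' = x \<longrightarrow> y \<in> U)" for U :: "ell2 set"
    by (rule open_ell2_def)
  have *: "summable (\<lambda>k. coord x k * coord y k)" for x y
    by (intro summable_mult_sq summable_coord_sq)
  show "x \<bullet> y = y \<bullet> x" by (simp add: inner_ell2_def mult.commute)
  show "(x + y) \<bullet> z = x \<bullet> z + y \<bullet> z"
    using suminf_add[OF * *, of x z y z] by (simp add: inner_ell2_def algebra_simps)
  show "(r *\<^sub>R x) \<bullet> y = r * (x \<bullet> y)"
    using suminf_mult[OF *, of r x y] by (simp add: inner_ell2_def algebra_simps)
  show "0 \<le> x \<bullet> x" unfolding inner_ell2_def by (intro suminf_nonneg *) simp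
  show "(x \<bullet> x = 0) = (x = 0)"
  proof
    assume "x \<bullet> x = 0"
    then have "\<forall>k. coord x k * coord x k = 0"
      unfolding inner_ell2_def by (subst (asm) suminf_eq_zero_iff) (auto intro: *)
    then show "x = 0" by (auto intro!: ell2_eqI)
  qed (simp add: inner_ell2_def)
  show "norm x = sqrt (x \<bullet> x)" by (rule norm_ell2_def)
qed

end

lemma norm_ell2_sq: "(norm (x::ell2))\<^sup>2 = (\<Sum>k. (coord x k)\<^sup>2)"
  unfolding power2_norm_eq_inner inner_ell2_def by (simp add: power2_eq_square)

lemma partial_sum_le_norm_ell2: "(\<Sum>k<n. (coord x k)\<^sup>2) \<le> (norm x)\<^sup>2"
  unfolding norm_ell2_sq by (intro sum_le_suminf summable_coord_sq) auto

lemma abs_coord_le: "\<bar>coord x k\<bar> \<le> norm x"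
proof -
  have "(coord x k)\<^sup>2 \<le> (\<Sum>j<Suc k. (coord x j)\<^sup>2)" by (simp add: sum_nonneg)
  also note partial_sum_le_norm_ell2
  finally have "(coord x k)\<^sup>2 \<le> (norm x)\<^sup>2" .
  then show ?thesis by (simp flip: abs_le_square_iff)
qed

lemma norm_ell2_leI:
  assumes "0 \<le> c" "\<And>n. (\<Sum>k<n. (coord x k)\<^sup>2) \<le> c\<^sup>2"
  shows "norm x \<le> c"
proof -
  have "(norm x)\<^sup>2 \<le> c\<^sup>2"
    unfolding norm_ell2_sq by (intro suminf_le_const summable_coord_sq assms)
  then show ?thesis using assms(1) power2_le_imp_le by blast
qed

lemma norm_ell2_mono:
  assumes "\<And>k. \<bar>coord x k\<bar> \<le> c * \<bar>coord y k\<bar>" "0 \<le> c"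
  shows "norm x \<le> c * norm y"
proof (rule norm_ell2_leI)
  fix n
  have "(\<Sum>k<n. (coord x k)\<^sup>2) \<le> (\<Sum>k<n. c\<^sup>2 * (coord y k)\<^sup>2)"
    using assms by (intro sum_mono) (metis abs_ge_zero abs_mult abs_of_nonneg power2_abs power_mono power_mult_distrib)
  also have "\<dots> \<le> c\<^sup>2 * (norm y)\<^sup>2"
    unfolding sum_distrib_left[symmetric] by (intro mult_left_mono partial_sum_le_norm_ell2) auto
  finally show "(\<Sum>k<n. (coord x k)\<^sup>2) \<le> (c * norm y)\<^sup>2" by (simp add: power_mult_distrib)
qed (use assms in auto)

lemma bounded_linear_coord: "bounded_linear (\<lambda>x. coord x k)"
  by (rule bounded_linear_intro[of _ 1]) (auto simp: abs_coord_le)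

instance ell2 :: complete_space
proof
  fix X :: "nat \<Rightarrow> ell2"
  assume X: "Cauchy X"
  have "\<exists>l. (\<lambda>i. coord (X i) k) \<longlonglongrightarrow> l" for k
    using bounded_linear.Cauchy[OF bounded_linear_coord X] Cauchy_convergent
    by (auto simp: convergent_def)
  then obtain l where l: "\<And>k. (\<lambda>i. coord (X i) k) \<longlonglongrightarrow> l k" by metis
  \<comment> \<open>Partial sums are finite, so the limit in j may be taken term by term; the bound
    does not depend on n and hence survives for the whole series.\<close>
  have *: "\<exists>N. \<forall>i\<ge>N. \<forall>n. (\<Sum>k<n. (coord (X i) k - l k)\<^sup>2) \<le> e\<^sup>2" if "e > 0" for e
  proof -
    obtain N where N: "\<And>i j. i \<ge> N \<Longrightarrow> j \<ge> N \<Longrightarrow> norm (X i - X j) < e"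
      using X \<open>e > 0\<close> unfolding Cauchy_def dist_norm by blast
    have "(\<Sum>k<n. (coord (X i) k - l k)\<^sup>2) \<le> e\<^sup>2" if "i \<ge> N" for i n
    proof (rule LIMSEQ_le_const2)
      show "(\<lambda>j. \<Sum>k<n. (coord (X i) k - coord (X j) k)\<^sup>2) \<longlonglongrightarrow> (\<Sum>k<n. (coord (X i) k - l k)\<^sup>2)"
        by (intro tendsto_intros l)
      have "(\<Sum>k<n. (coord (X i) k - coord (X j) k)\<^sup>2) \<le> e\<^sup>2" if "j \<ge> N" for j
      proof -
        have "(\<Sum>k<n. (coord (X i - X j) k)\<^sup>2) \<le> (norm (X i - X j))\<^sup>2"
          by (rule partial_sum_le_norm_ell2)
        also have "\<dots> \<le> e\<^sup>2"
          using N[OF \<open>i \<ge> N\<close> that] by (intro power_mono) auto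
        finally show ?thesis by simp
      qed
      then show "\<exists>M. \<forall>j\<ge>M. (\<Sum>k<n. (coord (X i) k - coord (X j) k)\<^sup>2) \<le> e\<^sup>2" by blast
    qed
    then show ?thesis by blast
  qed
  obtain N where N: "\<And>n. (\<Sum>k<n. (coord (X N) k - l k)\<^sup>2) \<le> 1"
    using *[of 1] by auto
  have "summable (\<lambda>k. (coord (X N) k - l k)\<^sup>2)"
    by (rule summableI_nonneg_bounded[of _ 1]) (use N in auto)
  from summable_add_sq[OF summable_coord_sq[of "X N"] summable_scale_sq[OF this, of "-1"]]
  have L: "coord (Abs_ell2 l) k = l k" for k
    by (intro coord_Abs) simp
  have "X \<longlonglongrightarrow> Abs_ell2 l"
  proof (rule LIMSEQ_I)
    fix r :: real assume "r > 0"
    then obtain N where N: "\<And>i n. i \<ge> N \<Longrightarrow> (\<Sum>k<n. (coord (X i) k - l k)\<^sup>2) \<le> (r/2)\<^sup>2"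
      using *[of "r/2"] by auto
    have "norm (X i - Abs_ell2 l) \<le> r/2" if "i \<ge> N" for i
      using N[OF that] \<open>r > 0\<close> by (intro norm_ell2_leI) (auto simp: L)
    then show "\<exists>no. \<forall>n\<ge>no. norm (X n - Abs_ell2 l) < r"
      using \<open>r > 0\<close> by (metis field_sum_of_halves less_add_same_cancel1 order_le_less_trans half_gt_zero)
  qed
  then show "convergent X" by (auto simp: convergent_def)
qed

instance ell2 :: banach ..

definition ell2_trunc :: "nat \<Rightarrow> ell2 \<Rightarrow> ell2" where
  "ell2_trunc n x = Abs_ell2 (\<lambda>k. if k < n then coord x k else 0)"

lemma coord_trunc [simp]: "coord (ell2_trunc n x) k = (if k < n then coord x k else 0)"
  unfolding ell2_trunc_def
  by (rule coord_Abs) (rule summable_finite[of "{..<n}"], auto)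

lemma norm_diff_trunc_sq:
  "(norm (x - ell2_trunc n x))\<^sup>2 = (norm x)\<^sup>2 - (\<Sum>k<n. (coord x k)\<^sup>2)"
proof -
  have "(norm (x - ell2_trunc n x))\<^sup>2 = (\<Sum>k. (coord x k)\<^sup>2 - (if k < n then (coord x k)\<^sup>2 else 0))"
    unfolding norm_ell2_sq by (intro suminf_cong) auto
  also have "\<dots> = (\<Sum>k. (coord x k)\<^sup>2) - (\<Sum>k. if k < n then (coord x k)\<^sup>2 else 0)"
    by (intro suminf_diff[symmetric] summable_coord_sq summable_finite[of "{..<n}"]) auto
  also have "(\<Sum>k. if k < n then (coord x k)\<^sup>2 else 0) = (\<Sum>k<n. (coord x k)\<^sup>2)"
    by (subst suminf_finite[of "{..<n}"]) auto
  finally show ?thesis by (simp add: norm_ell2_sq)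
qed

lemma ell2_trunc_tendsto: "(\<lambda>n. ell2_trunc n x) \<longlonglongrightarrow> x"
proof -
  have "(\<lambda>n. sqrt ((norm x)\<^sup>2 - (\<Sum>k<n. (coord x k)\<^sup>2))) \<longlonglongrightarrow> sqrt ((norm x)\<^sup>2 - (norm x)\<^sup>2)"
    by (intro tendsto_intros) (unfold norm_ell2_sq, rule summable_LIMSEQ[OF summable_coord_sq])
  then have "(\<lambda>n. norm (x - ell2_trunc n x)) \<longlonglongrightarrow> 0"
    by (simp flip: norm_diff_trunc_sq)
  then have "(\<lambda>n. norm (ell2_trunc n x - x)) \<longlonglongrightarrow> 0" by (simp add: norm_minus_commute)
  then show ?thesis using LIM_zero_iff tendsto_norm_zero_iff by blast
qed

definition ell2_unit :: "nat \<Rightarrow> ell2" where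
  "ell2_unit n = Abs_ell2 (\<lambda>k. if k = n then 1 else 0)"

lemma coord_unit [simp]: "coord (ell2_unit n) k = (if k = n then 1 else 0)"
  unfolding ell2_unit_def by (rule coord_Abs) (rule summable_finite[of "{n}"], auto)

lemma coord_sum: "coord (sum f A) k = (\<Sum>i\<in>A. coord (f i) k)"
  by (induction A rule: infinite_finite_induct) auto

lemma ell2_trunc_eq_sum: "ell2_trunc n x = (\<Sum>k<n. coord x k *\<^sub>R ell2_unit k)"
proof (rule ell2_eqI)
  fix j
  have "(\<Sum>k<n. coord x k * (if j = k then 1 else 0)) = (\<Sum>k<n. if j = k then coord x k else 0)"
    by (intro sum.cong) auto
  then show "coord (ell2_trunc n x) j = coord (\<Sum>k<n. coord x k *\<^sub>R ell2_unit k) j"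
    by (simp add: coord_sum)
qed

text \<open>The common majorant \<open>y\<close> makes the tails of all \<open>f t\<close> uniformly
  small, so the truncations, which involve finitely many continuous coordinates, converge
  uniformly.\<close>

lemma continuous_on_ell2I:
  assumes "\<And>k. continuous_on S (\<lambda>t. coord (f t) k)"
    and dom: "\<And>t k. t \<in> S \<Longrightarrow> \<bar>coord (f t) k\<bar> \<le> \<bar>coord y k\<bar>"
  shows "continuous_on S f"
proof (rule uniform_limit_theorem[where F=sequentially])
  show "\<forall>\<^sub>F n in sequentially. continuous_on S (\<lambda>t. ell2_trunc n (f t))"
    unfolding ell2_trunc_eq_sum by (intro always_eventually allI continuous_intros assms)
  show "uniform_limit S (\<lambda>n t. ell2_trunc n (f t)) f sequentially"
  proof (rule uniform_limitI)
    fix e :: real assume "e > 0"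
    have "\<forall>\<^sub>F n in sequentially. dist (ell2_trunc n y) y < e"
      using ell2_trunc_tendsto[of y] \<open>e > 0\<close> by (simp add: tendsto_iff)
    then show "\<forall>\<^sub>F n in sequentially. \<forall>t\<in>S. dist (ell2_trunc n (f t)) (f t) < e"
    proof eventually_elim
      case (elim n)
      have "norm (ell2_trunc n (f t) - f t) \<le> 1 * norm (ell2_trunc n y - y)" if "t \<in> S" for t
        by (rule norm_ell2_mono) (use dom[OF that] in auto)
      then show ?case using elim by (force simp: dist_norm)
    qed
  qed
qed auto

text \<open>Bochner integrability is formulated for second countable Banach spaces. Balls with
  rational radii around finitely supported rational sequences form a countable basis.\<close>

instance ell2 :: second_countable_topology
proof
  define D where "D = (\<lambda>l. Abs_ell2 (\<lambda>k. if k < length l then real_of_rat (l ! k) else 0)) ` (UNIV :: rat list set)"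
  have cD: "coord (Abs_ell2 (\<lambda>k. if k < length l then real_of_rat (l ! k) else 0)) k = 
      (if k < length l then real_of_rat (l ! k) else 0)" for l k
    by (rule coord_Abs) (rule summable_finite[of "{..<length l}"], auto)
  have dense: "\<exists>d\<in>D. dist d x < e" if "e > 0" for e x
  proof -
    obtain n where n: "norm (ell2_trunc n x - x) < e / 2"
      using ell2_trunc_tendsto[of x] half_gt_zero[OF \<open>e > 0\<close>] 
      unfolding LIMSEQ_iff by blast
    \<comment> \<open>An error below \<open>h\<close> in each of n coordinates costs at most
      \<open>n * h\<close> in norm, which stays below e/2; the summand 1 covers n = 0.\<close>
    define h where "h = e / (2 * (real n + 1))"
    have "h > 0" using \<open>e > 0\<close> by (simp add: h_def)
    have "\<exists>q. \<bar>real_of_rat q - coord x k\<bar> < h" for k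
      using of_rat_dense[of "coord x k - h" "coord x k + h"] \<open>h > 0\<close> 
      by (metis abs_diff_less_iff add_strict_increasing diff_less_eq less_add_same_cancel1 order_less_trans)
    then obtain q where q: "\<And>k. \<bar>real_of_rat (q k) - coord x k\<bar> < h" by metis
    define d where "d = Abs_ell2 (\<lambda>k. if k < length (map q [0..<n]) then real_of_rat (map q [0..<n] ! k) else 0)"
    have "d \<in> D" unfolding D_def d_def by blast
    have d: "coord d k = (if k < n then real_of_rat (q k) else 0)" for k
      unfolding d_def cD by auto
    have "norm (d - ell2_trunc n x) \<le> real n * h"
    proof (rule norm_ell2_leI)
      fix m
      have "(\<Sum>k<m. (coord (d - ell2_trunc n x) k)\<^sup>2) \<le> (\<Sum>k<m. (if k < n then h\<^sup>2 else 0))"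
      proof (rule sum_mono)
        fix k show "(coord (d - ell2_trunc n x) k)\<^sup>2 \<le> (if k < n then h\<^sup>2 else 0)"
          using power_mono[OF less_imp_le[OF q[of k]] abs_ge_zero, of 2] by (simp add: d)
      qed
      also have "\<dots> \<le> (\<Sum>k\<in>{..<m} \<inter> {..<n}. h\<^sup>2)"
        by (subst sum.inter_restrict) auto
      also have "\<dots> \<le> (\<Sum>k<n. h\<^sup>2)" by (intro sum_mono2) auto
      also have "\<dots> = real n * h\<^sup>2" by simp
      also have "\<dots> \<le> (real n * real n) * h\<^sup>2"
        by (intro mult_right_mono) (auto simp flip: of_nat_mult)
      finally show "(\<Sum>k<m. (coord (d - ell2_trunc n x) k)\<^sup>2) \<le> (real n * h)\<^sup>2"
        by (simp add: power2_eq_square algebra_simps)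
    qed (use \<open>h > 0\<close> in auto)
    also have "real n * h < e / 2"
      using \<open>e > 0\<close> by (simp add: h_def field_simps)
    finally have "norm (d - x) < e"
      using n norm_triangle_ineq[of "d - ell2_trunc n x" "ell2_trunc n x - x"] by simp
    then show ?thesis using \<open>d \<in> D\<close> by (auto simp: dist_norm)
  qed
  define B where "B = (\<lambda>(d, q). ball d (real_of_rat q)) ` (D \<times> UNIV)"
  have "countable B" unfolding B_def D_def by (intro countable_image countable_SIGMA) auto
  moreover have "topological_basis B"
  proof (rule topological_basisI)
    show "\<And>b. b \<in> B \<Longrightarrow> open b" unfolding B_def by auto
    fix O' :: "ell2 set" and x assume "open O'" "x \<in> O'"
    then obtain e where e: "e > 0" "ball x e \<subseteq> O'" using open_contains_ball by blast
    \<comment> \<open>With the centre \<open>d\<close> within e/3 of x, a radius above e/3 keeps x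
      in the ball, and a radius below e/2 keeps the ball inside \<open>ball x e\<close>.\<close>
    obtain q where q: "e/3 < real_of_rat q" "real_of_rat q < e/2"
      using of_rat_dense[of "e/3" "e/2"] e(1) by auto
    obtain d where d: "d \<in> D" "dist d x < e/3" using dense[of "e/3" x] e(1) by auto
    have "ball d (real_of_rat q) \<subseteq> ball x e"
    proof
      fix y assume "y \<in> ball d (real_of_rat q)"
      then show "y \<in> ball x e" using d(2) q dist_triangle[of x y d] e(1) by (auto simp: dist_commute)
    qed
    moreover have "x \<in> ball d (real_of_rat q)" using d q by auto
    ultimately show "\<exists>B'\<in>B. x \<in> B' \<and> B' \<subseteq> O'" using e(2) d(1) unfolding B_def by auto
  qed
  ultimately show "\<exists>B::ell2 set set. countable B \<and> open = generate_topology B"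
    using topological_basis_imp_subbasis by blast
qed

lemma borel_measurable_ell2I:
  assumes "\<And>k. (\<lambda>t. coord (f t) k) \<in> borel_measurable M"
  shows "f \<in> borel_measurable M"
proof (rule borel_measurable_LIMSEQ_metric)
  show "(\<lambda>t. ell2_trunc n (f t)) \<in> borel_measurable M" for n
    unfolding ell2_trunc_eq_sum
    by (intro borel_measurable_sum borel_measurable_scaleR assms) simp
  show "(\<lambda>n. ell2_trunc n (f t)) \<longlonglongrightarrow> f t" for t
    by (rule ell2_trunc_tendsto)
qed

section \<open>Diagonal operators on \<open>ell2\<close>\<close>

definition diag :: "(nat \<Rightarrow> real) \<Rightarrow> ell2 \<Rightarrow> ell2" where
  "diag m x = Abs_ell2 (\<lambda>k. m k * coord x k)"

lemma summable_diag:
  assumes "\<And>k. \<bar>m k\<bar> \<le> (B::real)" "summable (\<lambda>k. (f k)\<^sup>2)"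
  shows "summable (\<lambda>k. (m k * f k)\<^sup>2)"
proof (rule summable_comparison_test'[where N=0])
  show "summable (\<lambda>k. B\<^sup>2 * (f k)\<^sup>2)" by (intro summable_mult assms)
  have "(m k)\<^sup>2 \<le> B\<^sup>2" for k
    using assms(1)[of k] by (metis abs_ge_zero abs_le_square_iff abs_of_nonneg order_trans)
  then show "norm ((m k * f k)\<^sup>2) \<le> B\<^sup>2 * (f k)\<^sup>2" for k
    by (simp add: power_mult_distrib mult_right_mono)
qed

text \<open>\<open>Abs_ell2\<close> is unspecified on sequences that are not square summable, so a
  bound on the multipliers accompanies the rules for \<open>diag\<close>.\<close>

lemma coord_diag:
  assumes "\<And>k. \<bar>m k\<bar> \<le> (B::real)"
  shows "coord (diag m x) k = m k * coord x k"
  unfolding diag_def by (intro coord_Abs summable_diag[OF assms] summable_coord_sq)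

lemma norm_diag_le:
  assumes "\<And>k. \<bar>m k\<bar> \<le> (B::real)"
  shows "norm (diag m x) \<le> B * norm x"
proof (rule norm_ell2_mono)
  have "0 \<le> \<bar>m 0\<bar>" by simp
  then show "0 \<le> B" using assms[of 0] by linarith
  show "\<bar>coord (diag m x) k\<bar> \<le> B * \<bar>coord x k\<bar>" for k
    unfolding coord_diag[OF assms] abs_mult by (intro mult_right_mono assms) auto
qed

lemma bounded_linear_diag:
  assumes "\<And>k. \<bar>m k\<bar> \<le> (B::real)"
  shows "bounded_linear (diag m)"
proof (rule bounded_linear_intro[of _ B])
  show "diag m (x + y) = diag m x + diag m y" for x y
    by (rule ell2_eqI) (simp add: coord_diag[OF assms] algebra_simps)
  show "diag m (r *\<^sub>R x) = r *\<^sub>R diag m x" for r x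
    by (rule ell2_eqI) (simp add: coord_diag[OF assms] algebra_simps)
  show "norm (diag m x) \<le> norm x * B" for x
    using norm_diag_le[OF assms] by (simp add: mult.commute)
qed

section \<open>Mittag-Leffler functions\<close>

text \<open>The kernel of the Riemann-Liouville fractional integral of order \<beta>.\<close>

definition frac_ker :: "real \<Rightarrow> real \<Rightarrow> real" where
  "frac_ker \<beta> t = t powr (\<beta> - 1) / Gamma \<beta>"

lemma frac_ker_nonneg: "\<beta> > 0 \<Longrightarrow> 0 \<le> frac_ker \<beta> t"
  by (simp add: frac_ker_def Gamma_real_pos less_imp_le)

lemma frac_ker_pos: "\<beta> > 0 \<Longrightarrow> t > 0 \<Longrightarrow> 0 < frac_ker \<beta> t"
  by (simp add: frac_ker_def Gamma_real_pos)

lemma borel_measurable_frac_ker [measurable]: "frac_ker \<beta> \<in> borel_measurable borel"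
  unfolding frac_ker_def by measurable

text \<open>On [R, \<infinity>) the factor t^(s-1) of the Gamma integrand is at least R^(s-1). Since
  R is free, this gives growth faster than every exponential, as needed for the Mittag-Leffler
  series.\<close>

lemma Gamma_ge_powr:
  fixes s R :: real
  assumes "s \<ge> 1" "R > 0"
  shows "R powr (s - 1) * exp (- R) \<le> Gamma s"
proof -
  have 1: "((\<lambda>t. t powr (s - 1) / exp t) has_integral Gamma s) {0..}"
    using Gamma_integral_real[of s] assms by simp
  have "((\<lambda>t. R powr (s - 1) * exp (- 1 * t)) has_integral R powr (s - 1) * (exp (- 1 * R) / 1)) {R..}"
    by (intro has_integral_mult_right has_integral_exp_minus_to_infinity) simp
  then have 2: "((\<lambda>t. if t \<in> {R..} then R powr (s - 1) * exp (- 1 * t) else 0) has_integral R powr (s - 1) * (exp (- 1 * R) / 1)) {0..}"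
    using assms by (subst has_integral_restrict) auto
  have "R powr (s - 1) * (exp (- 1 * R) / 1) \<le> Gamma s"
  proof (rule has_integral_le[OF 2 1])
    fix t :: real assume "t \<in> {0..}"
    show "(if t \<in> {R..} then R powr (s - 1) * exp (- 1 * t) else 0) \<le> t powr (s - 1) / exp t"
    proof (cases "t \<ge> R")
      case True
      then have "R powr (s - 1) \<le> t powr (s - 1)" using assms by (intro powr_mono2) auto
      then show ?thesis using True by (auto simp: exp_minus field_simps)
    qed simp
  qed
  then show ?thesis by simp
qed

lemma summable_frac_ker:
  assumes "\<alpha> > 0" "\<zeta> > 0" "t > 0"
  shows "summable (\<lambda>k. \<bar>c\<bar> ^ k * frac_ker (\<alpha> * real k + \<zeta>) t)"
proof -
  \<comment> \<open>R is chosen so that raising k by 1 multiplies the lower bound for Gamma,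
    relative to the power of t, by \<open>2 * \<bar>c\<bar> + 1\<close>; the series is then
    dominated by a geometric one with ratio \<open>q\<close> below 1.\<close>
  define R where "R = t * (2 * \<bar>c\<bar> + 1) powr (1 / \<alpha>)"
  have R: "R > 0" "(R / t) powr \<alpha> = 2 * \<bar>c\<bar> + 1"
    using assms by (auto simp: R_def powr_powr)
  define q where "q = \<bar>c\<bar> / (2 * \<bar>c\<bar> + 1)"
  have q: "0 \<le> q" "q < 1" by (auto simp: q_def field_simps)
  \<comment> \<open>From this index on the argument of Gamma is at least 1, as
    \<open>Gamma_ge_powr\<close> requires.\<close>
  obtain N where N: "real N * \<alpha> \<ge> 1" using assms(1) reals_Archimedean3 by (metis less_imp_le)

  show ?thesis
  proof (rule summable_comparison_test')
    show "summable (\<lambda>k. exp R * (R / t) powr (1 - \<zeta>) * q ^ k)"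
      using q by (intro summable_mult summable_geometric) auto
    fix k assume "k \<ge> N"
    define s where "s = \<alpha> * real k + \<zeta>"
    have "real N * \<alpha> \<le> real k * \<alpha>" using \<open>k \<ge> N\<close> assms by (intro mult_right_mono) auto
    then have s: "s \<ge> 1" using N assms unfolding s_def mult.commute[of \<alpha>] by linarith
    have G: "R powr (s - 1) * exp (- R) \<le> Gamma s" by (rule Gamma_ge_powr[OF s R(1)])
    have "frac_ker s t \<le> t powr (s - 1) / (R powr (s - 1) * exp (- R))"
      unfolding frac_ker_def using G R s by (intro divide_left_mono mult_pos_pos) (auto simp: Gamma_real_pos)
    also have "\<dots> = exp R * (t / R) powr (s - 1)"
      using assms R by (simp add: exp_minus powr_divide field_simps)
    also have "(t / R) powr (s - 1) = (R / t) powr (1 - s)"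
      using assms R by (simp add: powr_divide powr_diff field_simps)
    also have "1 - s = (1 - \<zeta>) + \<alpha> * (- real k)" by (simp add: s_def)
    also have "(R / t) powr ((1 - \<zeta>) + \<alpha> * (- real k)) = (R / t) powr (1 - \<zeta>) * (2 * \<bar>c\<bar> + 1) powr (- real k)"
      unfolding powr_add powr_powr[symmetric] R(2) ..
    also have "(2 * \<bar>c\<bar> + 1) powr (- real k) = inverse ((2 * \<bar>c\<bar> + 1) ^ k)"
      by (subst powr_minus, subst powr_realpow) auto
    finally have "\<bar>c\<bar> ^ k * frac_ker s t \<le> \<bar>c\<bar> ^ k * (exp R * ((R / t) powr (1 - \<zeta>) * inverse ((2 * \<bar>c\<bar> + 1) ^ k)))"
      by (intro mult_left_mono) auto
    also have "\<dots> = exp R * (R / t) powr (1 - \<zeta>) * q ^ k"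
      by (simp add: q_def power_divide field_simps)
    finally show "norm (\<bar>c\<bar> ^ k * frac_ker (\<alpha> * real k + \<zeta>) t) \<le> exp R * (R / t) powr (1 - \<zeta>) * q ^ k"
      using frac_ker_nonneg[of s t] s by (simp add: s_def)
  qed
qed

text \<open>The semigroup law of fractional integration: the Beta integral after rescaling (0, 1) to
  (0, t). The open interval keeps both kernels away from the argument 0.\<close>

lemma frac_ker_conv:
  assumes "\<beta> > 0" "\<gamma> > 0" "t > 0"
  shows "has_bochner_integral lborel (\<lambda>s. indicator {0<..<t} s * (frac_ker \<beta> (t - s) * frac_ker \<gamma> s))
           (frac_ker (\<beta> + \<gamma>) t)"
proof -
  define f where "f = (\<lambda>s. indicator {0<..<1} s * (s powr (\<gamma> - 1) * (1 - s) powr (\<beta> - 1)) :: real)"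
  have m [measurable]: "f \<in> borel_measurable borel" unfolding f_def by measurable
  have "((\<lambda>s. s powr (\<gamma> - 1) * (1 - s) powr (\<beta> - 1)) has_integral Beta \<gamma> \<beta>) {0<..<1}"
    using has_integral_Beta_real[OF assms(2,1)] by (simp add: has_integral_Icc_iff_Ioo)
  then have "((\<lambda>s. if s \<in> {0<..<1} then s powr (\<gamma> - 1) * (1 - s) powr (\<beta> - 1) else 0) has_integral Beta \<gamma> \<beta>) UNIV"
    by (simp only: has_integral_restrict_UNIV)
  also have "(\<lambda>s. if s \<in> {0<..<1} then s powr (\<gamma> - 1) * (1 - s) powr (\<beta> - 1) else 0) = f"
    by (auto simp: f_def indicator_def)
  finally have hi: "(f has_integral Beta \<gamma> \<beta>) UNIV" .
  have f0: "0 \<le> f x" for x unfolding f_def by (simp add: indicator_def)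
  have B0: "Beta \<gamma> \<beta> \<ge> 0" using has_integral_nonneg[OF hi] f0 by blast
  have "(\<integral>\<^sup>+x. ennreal (f x) \<partial>lborel) = ennreal (Beta \<gamma> \<beta>)"
    using nn_integral_has_integral_lborel[OF m f0 hi] .
  then have hf: "has_bochner_integral lborel f (Beta \<gamma> \<beta>)"
    using f0 B0 by (intro has_bochner_integral_nn_integral) auto
  have "has_bochner_integral lborel (\<lambda>s. f (0 + (1/t) * s)) (Beta \<gamma> \<beta> /\<^sub>R \<bar>1/t\<bar>)"
    using lborel_has_bochner_integral_real_affine_iff[of "1/t" f "Beta \<gamma> \<beta>" 0] hf assms by simp
  then have "has_bochner_integral lborel (\<lambda>s. (t powr (\<beta> + \<gamma> - 2) / (Gamma \<beta> * Gamma \<gamma>)) * f (0 + (1/t) * s))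
     ((t powr (\<beta> + \<gamma> - 2) / (Gamma \<beta> * Gamma \<gamma>)) * (Beta \<gamma> \<beta> /\<^sub>R \<bar>1/t\<bar>))"
    by (intro has_bochner_integral_mult_right) auto
  also have "(\<lambda>s. (t powr (\<beta> + \<gamma> - 2) / (Gamma \<beta> * Gamma \<gamma>)) * f (0 + (1/t) * s)) = 
       (\<lambda>s. indicator {0<..<t} s * (frac_ker \<beta> (t - s) * frac_ker \<gamma> s))"
  proof
    fix s
    show "(t powr (\<beta> + \<gamma> - 2) / (Gamma \<beta> * Gamma \<gamma>)) * f (0 + (1/t) * s) = 
       indicator {0<..<t} s * (frac_ker \<beta> (t - s) * frac_ker \<gamma> s)"
    proof (cases "0 < s \<and> s < t")
      case True
      have a: "(1 - s / t) powr (\<beta> - 1) = (t - s) powr (\<beta> - 1) / t powr (\<beta> - 1)"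
        using True assms by (subst powr_divide[symmetric]) (auto simp: field_simps)
      have b: "(s / t) powr (\<gamma> - 1) = s powr (\<gamma> - 1) / t powr (\<gamma> - 1)"
        using True assms by (subst powr_divide) auto
      have c: "t powr (\<beta> + \<gamma> - 2) = t powr (\<beta> - 1) * t powr (\<gamma> - 1)"
        by (simp add: powr_add[symmetric])
      show ?thesis using True assms
        by (simp add: f_def a b c frac_ker_def indicator_def)
    next
      case False
      then show ?thesis using assms by (auto simp: f_def indicator_def field_simps)
    qed
  qed
  also have "(t powr (\<beta> + \<gamma> - 2) / (Gamma \<beta> * Gamma \<gamma>)) * (Beta \<gamma> \<beta> /\<^sub>R \<bar>1/t\<bar>) = frac_ker (\<beta> + \<gamma>) t"
  proof -
    have "t powr (\<beta> + \<gamma> - 1) = t powr (\<beta> + \<gamma> - 2 + 1)" by simp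
    also have "\<dots> = t powr (\<beta> + \<gamma> - 2) * t" by (subst powr_add) (use assms in simp)
    finally have a: "t powr (\<beta> + \<gamma> - 1) = t powr (\<beta> + \<gamma> - 2) * t" .
    have "Gamma \<beta> > 0" "Gamma \<gamma> > 0" using assms by (auto simp: Gamma_real_pos)
    then have "Gamma \<beta> \<noteq> 0" "Gamma \<gamma> \<noteq> 0" by auto
    then show ?thesis using assms by (simp add: frac_ker_def a Beta_def add.commute field_simps)
  qed
  finally show ?thesis .
qed

text \<open>For \<zeta> = \<alpha> this is the resolvent kernel of the fractional integral of order
  \<alpha>, multiplied by l. Other values of \<zeta> cover its fractional integrals, among them the
  Mittag-Leffler function itself at \<zeta> = 1.\<close>

definition ml_ker :: "real \<Rightarrow> real \<Rightarrow> real \<Rightarrow> real \<Rightarrow> real" where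
  "ml_ker \<alpha> l \<zeta> t = t powr (\<zeta> - 1) * mittag_leffler \<alpha> \<zeta> (- l * t powr \<alpha>)"

context
  fixes \<alpha> :: real
  assumes alpha: "0 < \<alpha>"
begin

lemma summable_ml_ker:
  assumes "\<zeta> > 0" "t > 0"
  shows "summable (\<lambda>k. (- l) ^ k * frac_ker (\<alpha> * real k + \<zeta>) t)"
proof (rule summable_norm_cancel)
  have "norm ((- l) ^ k * frac_ker (\<alpha> * real k + \<zeta>) t) = \<bar>l\<bar> ^ k * frac_ker (\<alpha> * real k + \<zeta>) t" for k
  proof -
    have "frac_ker (\<alpha> * real k + \<zeta>) t \<ge> 0" using assms alpha by (intro frac_ker_nonneg add_nonneg_pos) auto
    then show ?thesis by (simp add: abs_mult power_abs)
  qed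
  then show "summable (\<lambda>k. norm ((- l) ^ k * frac_ker (\<alpha> * real k + \<zeta>) t))"
    using summable_frac_ker[OF alpha assms, of l] by simp
qed

lemma mult_mittag_leffler_term:
  assumes "t > 0"
  shows "(- l) ^ k * frac_ker (\<alpha> * real k + \<zeta>) t =
    t powr (\<zeta> - 1) * ((- l * t powr \<alpha>) ^ k / Gamma (\<alpha> * real k + \<zeta>))"
proof -
  have "t powr (\<alpha> * real k + \<zeta> - 1) = t powr (\<alpha> * real k) * t powr (\<zeta> - 1)"
    by (simp add: powr_add[symmetric] algebra_simps)
  also have "t powr (\<alpha> * real k) = (t powr \<alpha>) ^ k"
    using assms by (simp add: powr_powr[symmetric] powr_realpow)
  finally show ?thesis unfolding frac_ker_def power_mult_distrib by simp
qed

text \<open>Each term of the Mittag-Leffler series, multiplied by the outer power of t, is a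
  fractional kernel. Identities for \<open>ml_ker\<close> thus reduce to termwise use of the
  semigroup law.\<close>

lemma ml_ker_eq:
  assumes "t > 0" "\<zeta> > 0"
  shows "ml_ker \<alpha> l \<zeta> t = (\<Sum>k. (- l) ^ k * frac_ker (\<alpha> * real k + \<zeta>) t)"
proof -
  have *: "t powr (\<zeta> - 1) \<noteq> 0" using assms by simp
  have "summable (\<lambda>k. t powr (\<zeta> - 1) * ((- l * t powr \<alpha>) ^ k / Gamma (\<alpha> * real k + \<zeta>)))"
    using summable_ml_ker[OF assms(2,1), of l] by (simp only: mult_mittag_leffler_term[OF assms(1)])
  then have "summable (\<lambda>k. (- l * t powr \<alpha>) ^ k / Gamma (\<alpha> * real k + \<zeta>))"
    using * by (simp only: summable_cmult_iff) simp
  from suminf_mult[OF this, of "t powr (\<zeta> - 1)"] show ?thesis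
    by (simp only: ml_ker_def mittag_leffler_def mult_mittag_leffler_term[OF assms(1)])
qed

lemma isCont_mittag_leffler:
  assumes "\<zeta> > 0"
  shows "isCont (mittag_leffler \<alpha> \<zeta>) x"
proof -
  define K where "K = \<bar>x\<bar> + 1"
  \<comment> \<open>At t = 1 and l = -K the kernel series is the power series at the point K, which
    lies beyond x.\<close>
  have "summable (\<lambda>k. (- (- K)) ^ k * frac_ker (\<alpha> * real k + \<zeta>) 1)" by (rule summable_ml_ker) (use assms in auto)
  then have "summable (\<lambda>k. (1 / Gamma (\<alpha> * real k + \<zeta>)) * K ^ k)"
    by (simp add: frac_ker_def)
  then have "isCont (\<lambda>x. \<Sum>k. (1 / Gamma (\<alpha> * real k + \<zeta>)) * x ^ k) x"
    by (rule isCont_powser) (simp add: K_def)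
  moreover have "mittag_leffler \<alpha> \<zeta> = (\<lambda>x. \<Sum>k. (1 / Gamma (\<alpha> * real k + \<zeta>)) * x ^ k)"
    by (simp add: mittag_leffler_def fun_eq_iff)
  ultimately show ?thesis by simp
qed

lemma continuous_on_mittag_leffler:
  "\<zeta> > 0 \<Longrightarrow> continuous_on S f \<Longrightarrow> continuous_on S (\<lambda>x. mittag_leffler \<alpha> \<zeta> (f x))"
  using continuous_on_compose2[of UNIV "mittag_leffler \<alpha> \<zeta>" S f] isCont_mittag_leffler
  by (simp add: continuous_at_imp_continuous_on)

lemma continuous_on_ml_ker: "\<zeta> > 0 \<Longrightarrow> continuous_on {0<..} (ml_ker \<alpha> l \<zeta>)"
  unfolding ml_ker_def by (intro continuous_intros continuous_on_mittag_leffler) (use alpha in auto)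

lemma borel_measurable_ml_ker: 
  assumes "\<zeta> > 0" shows "ml_ker \<alpha> l \<zeta> \<in> borel_measurable borel"
proof -
  have [measurable]: "mittag_leffler \<alpha> \<zeta> \<in> borel_measurable borel"
    using isCont_mittag_leffler[OF assms] by (intro borel_measurable_continuous_onI continuous_at_imp_continuous_on) auto
  show ?thesis unfolding ml_ker_def by measurable
qed

lemma mittag_leffler_0: "mittag_leffler \<alpha> \<zeta> 0 = 1 / Gamma \<zeta>"
  unfolding mittag_leffler_def by (subst suminf_finite[of "{0}"]) auto

text \<open>Splitting off the term k = 0 and reindexing raises \<zeta> by \<alpha>. Together with
  \<open>ml_ker_conv\<close> at \<beta> = \<alpha> this is the Volterra equation of the
  kernel.\<close>

lemma ml_ker_shift:
  assumes "t > 0" "\<zeta> > 0"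
  shows "ml_ker \<alpha> l \<zeta> t = frac_ker \<zeta> t - l * ml_ker \<alpha> l (\<zeta> + \<alpha>) t"
proof -
  have "ml_ker \<alpha> l \<zeta> t = frac_ker \<zeta> t + (\<Sum>k. (- l) ^ Suc k * frac_ker (\<alpha> * real (Suc k) + \<zeta>) t)"
    unfolding ml_ker_eq[OF assms] by (subst suminf_split_head[OF summable_ml_ker[OF assms(2,1)]]) simp
  also have "(\<lambda>k. (- l) ^ Suc k * frac_ker (\<alpha> * real (Suc k) + \<zeta>) t) = (\<lambda>k. (- l) * ((- l) ^ k * frac_ker (\<alpha> * real k + (\<zeta> + \<alpha>)) t))"
    by (simp add: algebra_simps fun_eq_iff)
  also have "(\<Sum>k. (- l) * ((- l) ^ k * frac_ker (\<alpha> * real k + (\<zeta> + \<alpha>)) t)) = (- l) * ml_ker \<alpha> l (\<zeta> + \<alpha>) t"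
    using assms alpha by (subst suminf_mult) (auto intro!: summable_ml_ker simp: ml_ker_eq)
  finally show ?thesis by simp
qed

text \<open>Termwise semigroup law. Sum and integral may be interchanged because the integrals of
  the absolute values form the same series with |l| in place of -l, which converges.\<close>

lemma ml_ker_conv:
  assumes "\<beta> > 0" "\<zeta> > 0" "t > 0"
  shows "has_bochner_integral lborel (\<lambda>s. indicator {0<..<t} s * (frac_ker \<beta> (t - s) * ml_ker \<alpha> l \<zeta> s))
           (ml_ker \<alpha> l (\<zeta> + \<beta>) t)"
proof -
  define f where "f k s = (- l) ^ k * (indicator {0<..<t} s * (frac_ker \<beta> (t - s) * frac_ker (\<alpha> * real k + \<zeta>) s))" for k s
  have pos: "\<alpha> * real k + \<zeta> > 0" for k using alpha assms by (simp add: add_nonneg_pos)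
  have f: "has_bochner_integral lborel (f k) ((- l) ^ k * frac_ker (\<beta> + (\<alpha> * real k + \<zeta>)) t)" for k
    unfolding f_def by (intro has_bochner_integral_mult_right frac_ker_conv assms pos)
  have fn: "norm (f k s) = \<bar>l\<bar> ^ k * (indicator {0<..<t} s * (frac_ker \<beta> (t - s) * frac_ker (\<alpha> * real k + \<zeta>) s))" for k s
    using frac_ker_nonneg[OF assms(1)] frac_ker_nonneg[OF pos] by (simp add: f_def abs_mult power_abs)
  have intn: "(\<integral>s. norm (f k s) \<partial>lborel) = \<bar>l\<bar> ^ k * frac_ker (\<alpha> * real k + (\<zeta> + \<beta>)) t" for k
  proof -
    have "\<beta> + (\<alpha> * real k + \<zeta>) = \<alpha> * real k + (\<zeta> + \<beta>)" by simp
    then show ?thesis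
      unfolding fn using frac_ker_conv[OF assms(1) pos assms(3), of k] 
      by (simp only: has_bochner_integral_integral_eq integral_mult_right_zero)
  qed
  have sum: "indicator {0<..<t} s * (frac_ker \<beta> (t - s) * ml_ker \<alpha> l \<zeta> s) = (\<Sum>k. f k s)" 
    and summ: "summable (\<lambda>k. norm (f k s))" for s
  proof -
    have "summable (\<lambda>k. norm (f k s)) \<and> indicator {0<..<t} s * (frac_ker \<beta> (t - s) * ml_ker \<alpha> l \<zeta> s) = (\<Sum>k. f k s)"
    proof (cases "0 < s \<and> s < t")
      case True
      have "summable (\<lambda>k. frac_ker \<beta> (t - s) * (\<bar>l\<bar> ^ k * frac_ker (\<alpha> * real k + \<zeta>) s))"
        using True assms alpha by (intro summable_mult summable_frac_ker) auto
      moreover have "(\<Sum>k. frac_ker \<beta> (t - s) * ((-l) ^ k * frac_ker (\<alpha> * real k + \<zeta>) s)) = frac_ker \<beta> (t - s) * ml_ker \<alpha> l \<zeta> s"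
        using True assms alpha by (subst suminf_mult) (auto intro!: summable_ml_ker simp: ml_ker_eq)
      ultimately show ?thesis using True unfolding fn unfolding f_def by (simp add: mult_ac)
    qed (simp add: f_def)
    then show "summable (\<lambda>k. norm (f k s))" 
      "indicator {0<..<t} s * (frac_ker \<beta> (t - s) * ml_ker \<alpha> l \<zeta> s) = (\<Sum>k. f k s)" by auto
  qed
  have s2: "summable (\<lambda>k. \<integral>s. norm (f k s) \<partial>lborel)"
    unfolding intn using assms alpha by (intro summable_frac_ker) auto
  have i: "integrable lborel (f k)" for k using f by (rule integrable.intros)
  have "integrable lborel (\<lambda>s. \<Sum>k. f k s)" 
    by (rule integrable_suminf) (use i s2 summ in auto)
  moreover have "(\<integral>s. (\<Sum>k. f k s) \<partial>lborel) = (\<Sum>k. \<integral>s. f k s \<partial>lborel)"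
    by (rule integral_suminf) (use i s2 summ in auto)
  moreover have "(\<Sum>k. \<integral>s. f k s \<partial>lborel) = ml_ker \<alpha> l (\<zeta> + \<beta>) t"
  proof -
    have "\<beta> + (\<alpha> * real k + \<zeta>) = \<alpha> * real k + (\<zeta> + \<beta>)" for k by simp
    then show ?thesis using assms by (simp only: ml_ker_eq has_bochner_integral_integral_eq[OF f] add_pos_pos)
  qed
  ultimately show ?thesis unfolding sum by (simp add: has_bochner_integral_iff)
qed

lemma continuous_on_mittag_leffler_powr:
  "\<zeta> > 0 \<Longrightarrow> continuous_on {0..} (\<lambda>t. mittag_leffler \<alpha> \<zeta> (- l * t powr \<alpha>))"
  by (intro continuous_on_mittag_leffler continuous_intros continuous_on_powr') (use alpha in auto)

section \<open>Positivity and monotonicity of the kernels\<close>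

lemma ml_ker_le_frac_ker:
  assumes "\<zeta> > 0" "l \<ge> 0" "t > 0" "ml_ker \<alpha> l (\<zeta> + \<alpha>) t \<ge> 0"
  shows "ml_ker \<alpha> l \<zeta> t \<le> frac_ker \<zeta> t"
  using assms by (simp add: ml_ker_shift[OF assms(3,1)])

lemma ml_ker_conv_nonneg:
  assumes "\<beta> > 0" "\<zeta> > 0" "t > 0" "\<And>s. 0 < s \<Longrightarrow> 0 \<le> ml_ker \<alpha> l \<zeta> s"
  shows "0 \<le> ml_ker \<alpha> l (\<zeta> + \<beta>) t"
proof -
  have "0 \<le> (\<integral>s. indicator {0<..<t} s * (frac_ker \<beta> (t - s) * ml_ker \<alpha> l \<zeta> s) \<partial>lborel)"
    by (intro Bochner_Integration.integral_nonneg) (auto simp: indicator_def frac_ker_nonneg assms)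
  then show ?thesis
    using has_bochner_integral_integral_eq[OF ml_ker_conv[OF assms(1-3), of l]] by simp
qed

text \<open>The quotient (u - s) / (t - s) increases with s and the exponent \<alpha> - 1 is not
  positive, so the ratio of the two kernels is largest as s tends to 0. This compares convolutions
  at two different times.\<close>

lemma frac_ker_ratio:
  assumes "\<alpha> \<le> 1" "0 < s" "s < t" "t \<le> u"
  shows "frac_ker \<alpha> (u - s) \<le> frac_ker \<alpha> u / frac_ker \<alpha> t * frac_ker \<alpha> (t - s)"
proof -
  have "t - s > 0" "u - s > 0" "t > 0" "u > 0" using assms by auto
  have "s * t \<le> s * u" using assms by (intro mult_left_mono) auto
  then have "u * (t - s) \<le> t * (u - s)" by (simp add: algebra_simps)
  then have "(t * (u - s)) powr (\<alpha> - 1) \<le> (u * (t - s)) powr (\<alpha> - 1)"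
    using assms by (intro powr_mono2') auto
  then have "t powr (\<alpha> - 1) * (u - s) powr (\<alpha> - 1) \<le> u powr (\<alpha> - 1) * (t - s) powr (\<alpha> - 1)"
    using assms by (simp add: powr_mult)
  then show ?thesis
    using assms alpha Gamma_real_pos[of \<alpha>] by (simp add: frac_ker_def field_simps)
qed

text \<open>
  A nonpositive value is impossible: the logarithmic convexity of the fractional kernel makes the
  value at the first zero at least a positive multiple of the value shortly before it.
\<close>

lemma ml_ker_pos:
  assumes "\<alpha> \<le> 1" "l > 0" "t > 0"
  shows "0 < ml_ker \<alpha> l \<alpha> t"
proof (rule ccontr)
  define K where "K = ml_ker \<alpha> l \<alpha>"
  \<comment> \<open>Dividing by the singular power leaves a function with the sign of K that is
    continuous down to 0 and positive there; hence a first point of nonpositivity exists and is not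
    0.\<close>
  define \<phi> where "\<phi> t = mittag_leffler \<alpha> \<alpha> (- l * t powr \<alpha>)" for t
  have K\<phi>: "K t = t powr (\<alpha> - 1) * \<phi> t" for t by (simp add: K_def \<phi>_def ml_ker_def)
  assume "\<not> 0 < ml_ker \<alpha> l \<alpha> t"
  then have "\<not> 0 < t powr (\<alpha> - 1) * \<phi> t" by (simp add: K\<phi>[symmetric] K_def)
  then have "\<phi> t \<le> 0" using \<open>t > 0\<close> by (simp add: zero_less_mult_iff not_less)
  define Z where "Z = {0..} \<inter> \<phi> -` {..0}"
  have "closed Z" unfolding Z_def \<phi>_def
    by (intro continuous_closed_preimage continuous_on_mittag_leffler_powr alpha) auto
  moreover have "t \<in> Z" using \<open>\<phi> t \<le> 0\<close> \<open>t > 0\<close> by (simp add: Z_def)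
  moreover have bdd: "bdd_below Z" by (auto simp: Z_def bdd_below_def)
  ultimately have "Inf Z \<in> Z" using closed_contains_Inf by blast
  define t0 where "t0 = Inf Z"
  have t0: "t0 \<ge> 0" "\<phi> t0 \<le> 0" using \<open>Inf Z \<in> Z\<close> by (auto simp: Z_def t0_def)
  moreover have "\<phi> 0 > 0" using alpha Gamma_real_pos[of \<alpha>] by (simp add: \<phi>_def mittag_leffler_0)
  ultimately have "t0 > 0" by (cases "t0 = 0") auto
  have before: "\<phi> s > 0" if "0 \<le> s" "s < t0" for s
    using cInf_lower[OF _ bdd, of s] that unfolding t0_def[symmetric] by (force simp: Z_def not_le[symmetric])
  have Kpos: "K s > 0" if "0 < s" "s < t0" for s
    using before[of s] that by (simp add: K\<phi>)
  have Kt0: "K t0 \<le> 0" using t0 by (simp add: K\<phi> mult_nonneg_nonpos)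
  have contK: "continuous_on {0<..} K" unfolding K_def by (rule continuous_on_ml_ker[OF alpha])
  \<comment> \<open>\<open>frac_ker (\<alpha> + 1) h\<close> is the integral of
    \<open>frac_ker \<alpha>\<close> over (0, h). A final time interval of length at most h
    therefore contributes at most half of the supremum of K to the convolution.\<close>
  obtain h where h: "h > 0" "l * frac_ker (\<alpha> + 1) h < 1 / 2"
  proof -
    have *: "((\<lambda>h::real. h powr \<alpha>) \<longlongrightarrow> 0) (at_right 0)"
      using tendsto_powr2[OF tendsto_ident_at tendsto_const[of \<alpha>], of 0 "{0<..}"] alpha 
      by (auto simp: eventually_at_filter)
    have "Gamma (\<alpha> + 1) > 0" using alpha by (intro Gamma_real_pos) simp
    with * have "((\<lambda>h. l * frac_ker (\<alpha> + 1) h) \<longlongrightarrow> l * (0 / Gamma (\<alpha> + 1))) (at_right 0)"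
      unfolding frac_ker_def add_diff_cancel_right'
      by (intro tendsto_intros *) simp
    then have "\<forall>\<^sub>F h in at_right 0. l * frac_ker (\<alpha> + 1) h < 1 / 2"
      by (rule order_tendstoD) simp
    then have "\<forall>\<^sub>F h in at_right 0. l * frac_ker (\<alpha> + 1) h < 1 / 2 \<and> h > 0"
      by (auto simp: eventually_at_filter elim: eventually_mono)
    then show ?thesis using that eventually_happens'[of "at_right (0::real)"] by auto
  qed
  define a where "a = max (t0 / 2) (t0 - h)"
  have a: "0 < a" "a < t0" "t0 / 2 \<le> a" "t0 - a \<le> h" using \<open>t0 > 0\<close> h by (auto simp: a_def)
  have "continuous_on {a..t0} K" using contK by (rule continuous_on_subset) (use a in auto)
  then obtain t1 where t1: "t1 \<in> {a..t0}" "\<And>s. s \<in> {a..t0} \<Longrightarrow> K s \<le> K t1"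
    using continuous_attains_sup[of "{a..t0}" K] a by auto
  have "K t1 > 0" using t1(2)[of a] Kpos[of a] a by auto
  then have "t1 < t0" "t1 > 0" using t1(1) Kt0 a by (cases "t1 = t0"; force)+
  define r where "r = frac_ker \<alpha> t0 / frac_ker \<alpha> t1"
  \<comment> \<open>The ratio is (t0 / t1)^(\<alpha>-1), the exponent is at least -1, and t1 >= t0 /
    2.\<close>
  have r: "r \<ge> 1 / 2"
  proof -
    have "(t0 / t1) powr (\<alpha> - 1) \<ge> (t0 / t1) powr (- 1)"
      using \<open>t1 < t0\<close> \<open>t1 > 0\<close> alpha by (intro powr_mono) auto
    also have "(t0 / t1) powr (- 1) = t1 / t0" using \<open>t1 < t0\<close> \<open>t1 > 0\<close> by (simp add: powr_minus)
    also have "(t0 / t1) powr (\<alpha> - 1) = r"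
      using \<open>t1 < t0\<close> \<open>t1 > 0\<close> less_imp_neq[OF Gamma_real_pos[OF alpha]] by (simp add: r_def frac_ker_def powr_divide)
    finally have "t1 \<le> r * t0" using \<open>t0 > 0\<close> by (simp add: field_simps)
    then have "1 / 2 * t0 \<le> r * t0" using a t1(1) unfolding atLeastAtMost_iff by linarith
    then show ?thesis using \<open>t0 > 0\<close> by (rule mult_right_le_imp_le)
  qed
  have i0: "has_bochner_integral lborel (\<lambda>s. indicator {0<..<u} s * (frac_ker \<alpha> (u - s) * K s)) ((frac_ker \<alpha> u - K u) / l)"
    if "u > 0" for u
    using ml_ker_conv[OF alpha alpha that, of l] ml_ker_shift[OF that alpha, of l] assms by (simp add: K_def)
  define d where "d = t0 - t1"
  have d: "0 < d" "d \<le> h" using \<open>t1 < t0\<close> t1(1) a by (auto simp: d_def)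
  \<comment> \<open>Since \<open>frac_ker 1\<close> is 1 on positive arguments, this is the plain
    integral of the fractional kernel, translated below to (t1, t0).\<close>
  have "has_bochner_integral lborel (\<lambda>s. indicator {0<..<d} s * (frac_ker \<alpha> (d - s) * frac_ker 1 s)) (frac_ker (\<alpha> + 1) d)"
    by (intro frac_ker_conv alpha d) simp
  then have "has_bochner_integral lborel (\<lambda>s. indicator {0<..<d} (- t1 + 1 * s) * (frac_ker \<alpha> (d - (- t1 + 1 * s)) * frac_ker 1 (- t1 + 1 * s)))
       (frac_ker (\<alpha> + 1) d /\<^sub>R \<bar>1\<bar>)"
    by (subst (asm) lborel_has_bochner_integral_real_affine_iff[of 1 _ _ "- t1"]) simp_all
  also have "(\<lambda>s. indicator {0<..<d} (- t1 + 1 * s) * (frac_ker \<alpha> (d - (- t1 + 1 * s)) * frac_ker 1 (- t1 + 1 * s))) = 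
      (\<lambda>s. indicator {t1<..<t0} s * frac_ker \<alpha> (t0 - s))"
    by (auto simp: fun_eq_iff indicator_def d_def frac_ker_def)
  finally have i1: "has_bochner_integral lborel (\<lambda>s. indicator {t1<..<t0} s * frac_ker \<alpha> (t0 - s)) (frac_ker (\<alpha> + 1) d)"
    by simp
  have i2: "has_bochner_integral lborel (\<lambda>s. r * (indicator {0<..<t1} s * (frac_ker \<alpha> (t1 - s) * K s))
       + K t1 * (indicator {t1<..<t0} s * frac_ker \<alpha> (t0 - s))) (r * ((frac_ker \<alpha> t1 - K t1) / l) + K t1 * frac_ker (\<alpha> + 1) d)"
    by (intro has_bochner_integral_add has_bochner_integral_mult_right i0 i1 \<open>t1 > 0\<close>)
  have "(frac_ker \<alpha> t0 - K t0) / l \<le> r * ((frac_ker \<alpha> t1 - K t1) / l) + K t1 * frac_ker (\<alpha> + 1) d"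
    unfolding has_bochner_integral_integral_eq[OF i0[OF \<open>t0 > 0\<close>], symmetric] has_bochner_integral_integral_eq[OF i2, symmetric]
  proof (rule integral_mono_AE)
    show "integrable lborel (\<lambda>s. indicator {0<..<t0} s * (frac_ker \<alpha> (t0 - s) * K s))"
      using i0[OF \<open>t0 > 0\<close>] by (rule integrable.intros)
    show "integrable lborel (\<lambda>s. r * (indicator {0<..<t1} s * (frac_ker \<alpha> (t1 - s) * K s))
       + K t1 * (indicator {t1<..<t0} s * frac_ker \<alpha> (t0 - s)))"
      using i2 by (rule integrable.intros)
    have "indicator {0<..<t0} s * (frac_ker \<alpha> (t0 - s) * K s) \<le> r * (indicator {0<..<t1} s * (frac_ker \<alpha> (t1 - s) * K s))
       + K t1 * (indicator {t1<..<t0} s * frac_ker \<alpha> (t0 - s))" if "s \<noteq> t1" for s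
    proof -
      consider "0 < s \<and> s < t1" | "t1 < s \<and> s < t0" | "s \<le> 0 \<or> t0 \<le> s" using \<open>s \<noteq> t1\<close> by linarith
      then show ?thesis
      proof cases
        case 1
        have "frac_ker \<alpha> (t0 - s) * K s \<le> (r * frac_ker \<alpha> (t1 - s)) * K s"
          using frac_ker_ratio[of s t1 t0] Kpos[of s] 1 assms \<open>t1 < t0\<close> unfolding r_def
          by (intro mult_right_mono) auto
        then show ?thesis using 1 \<open>t1 < t0\<close> by (simp add: indicator_def)
      next
        case 2
        have "frac_ker \<alpha> (t0 - s) * K s \<le> frac_ker \<alpha> (t0 - s) * K t1"
          using 2 t1 by (intro mult_left_mono frac_ker_nonneg alpha) auto
        then show ?thesis using 2 \<open>t1 > 0\<close> by (simp add: indicator_def mult.commute)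
      next
        case 3
        then show ?thesis using \<open>t1 < t0\<close> \<open>t1 > 0\<close> by (auto simp: indicator_def)
      qed
    qed
    then show "AE s in lborel. indicator {0<..<t0} s * (frac_ker \<alpha> (t0 - s) * K s) \<le> r * (indicator {0<..<t1} s * (frac_ker \<alpha> (t1 - s) * K s))
       + K t1 * (indicator {t1<..<t0} s * frac_ker \<alpha> (t0 - s))"
      using AE_lborel_singleton[of t1] by (auto elim: eventually_mono)
  qed
  then have "frac_ker \<alpha> t0 - K t0 \<le> (r * ((frac_ker \<alpha> t1 - K t1) / l) + K t1 * frac_ker (\<alpha> + 1) d) * l"
    by (simp only: pos_divide_le_eq[OF assms(2)])
  also have "\<dots> = r * (frac_ker \<alpha> t1 - K t1) + K t1 * (l * frac_ker (\<alpha> + 1) d)"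
    using assms(2) by (simp add: field_simps)
  finally have "frac_ker \<alpha> t0 - K t0 \<le> r * (frac_ker \<alpha> t1 - K t1) + K t1 * (l * frac_ker (\<alpha> + 1) d)" .
  \<comment> \<open>With this choice of r the inhomogeneous terms of the Volterra equations at t0
    and t1 cancel. What remains is K t1 times a positive number bounded above by K t0 <= 0.\<close>
  moreover have "r * frac_ker \<alpha> t1 = frac_ker \<alpha> t0"
    using frac_ker_pos[OF alpha \<open>t1 > 0\<close>] by (simp add: r_def)
  ultimately have "K t1 * (r - l * frac_ker (\<alpha> + 1) d) \<le> 0"
    using Kt0 by (simp add: algebra_simps)
  moreover have "frac_ker (\<alpha> + 1) d \<le> frac_ker (\<alpha> + 1) h"
    using d alpha Gamma_real_pos[of "\<alpha> + 1"] by (auto simp: frac_ker_def intro!: divide_right_mono powr_mono2)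
  then have "l * frac_ker (\<alpha> + 1) d \<le> l * frac_ker (\<alpha> + 1) h" using assms by (intro mult_left_mono) auto
  then have "r - l * frac_ker (\<alpha> + 1) d > 0" using r h by linarith
  ultimately show False using \<open>K t1 > 0\<close> by (simp add: mult_le_0_iff)
qed

text \<open>With K_l for the kernel of parameter l, the resolvent identity reads K_l = K_m + (m - l)
  (K_l conv K_m), and the convolution of positive kernels is nonnegative. It is derived by expanding
  K_l in its series.\<close>

lemma ml_ker_antimono:
  assumes "\<alpha> \<le> 1" "0 < l" "l \<le> m" "t > 0"
  shows "ml_ker \<alpha> m \<alpha> t \<le> ml_ker \<alpha> l \<alpha> t"
proof -
  define a where "a j = frac_ker (\<alpha> * real j + \<alpha>) t" for j
  define c where "c j = ml_ker \<alpha> m (\<alpha> * real j + \<alpha> + \<alpha>) t" for j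
  have pos: "\<alpha> * real j + \<alpha> > 0" for j using alpha by (simp add: add_nonneg_pos)
  have m: "m > 0" using assms by simp
  have c: "has_bochner_integral lborel (\<lambda>s. indicator {0<..<t} s * (frac_ker (\<alpha> * real j + \<alpha>) (t - s) * ml_ker \<alpha> m \<alpha> s)) (c j)" for j
    using ml_ker_conv[OF pos[of j] alpha assms(4), of m] by (simp add: c_def add.commute)
  have c0: "c j \<ge> 0" for j
    using ml_ker_conv_nonneg[OF pos[of j] alpha assms(4), of m] ml_ker_pos[OF assms(1) m] 
    by (simp add: c_def less_imp_le add.commute)
  have ac: "ml_ker \<alpha> m (\<alpha> * real j + \<alpha>) t = a j - m * c j" for j
    using ml_ker_shift[OF assms(4) pos[of j], of m] by (simp add: a_def c_def)
  \<comment> \<open>This domination by the coefficients of the convergent kernel series makes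
    \<open>l ^ j * c j\<close> summable.\<close>
  have c_le: "c j \<le> a (Suc j)" for j
  proof -
    have "c j = ml_ker \<alpha> m (\<alpha> * real (Suc j) + \<alpha>) t" by (simp add: c_def algebra_simps)
    also have "\<dots> = a (Suc j) - m * c (Suc j)" by (rule ac)
    finally show ?thesis using m c0[of "Suc j"] by simp
  qed
  have a_sum: "summable (\<lambda>j. \<bar>x\<bar> ^ j * a j)" for x unfolding a_def by (intro summable_frac_ker alpha assms)
  have cs: "summable (\<lambda>j. l ^ j * c j)"
  proof (rule summable_comparison_test')
    have "summable (\<lambda>j. inverse l * (\<bar>l\<bar> ^ Suc j * a (Suc j)))"
      using a_sum[of l] by (intro summable_mult) (subst summable_Suc_iff)
    then show "summable (\<lambda>j. l ^ j * a (Suc j))" using assms by (simp add: mult.assoc[symmetric])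
    show "norm (l ^ j * c j) \<le> l ^ j * a (Suc j)" if "j \<ge> 0" for j
      using c0[of j] c_le[of j] assms by (simp add: mult_left_mono)
  qed
  \<comment> \<open>The j-th term integrates to \<open>(- l) ^ j * c j\<close>, and the terms sum to
    the integrand of K_l conv K_m. The interchange needs \<open>cs\<close> only.\<close>
  define f where "f j s = (- l) ^ j * (indicator {0<..<t} s * (frac_ker (\<alpha> * real j + \<alpha>) (t - s) * ml_ker \<alpha> m \<alpha> s))" for j s
  have f: "has_bochner_integral lborel (f j) ((- l) ^ j * c j)" for j
    unfolding f_def by (intro has_bochner_integral_mult_right c)
  have fn: "norm (f j s) = l ^ j * (indicator {0<..<t} s * (frac_ker (\<alpha> * real j + \<alpha>) (t - s) * ml_ker \<alpha> m \<alpha> s))" for j s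
    using frac_ker_nonneg[OF pos[of j]] ml_ker_pos[OF assms(1) m, of s] assms
    by (auto simp add: f_def abs_mult power_abs indicator_def)
  have intn: "(\<integral>s. norm (f j s) \<partial>lborel) = l ^ j * c j" for j
    unfolding fn using c[of j] by (simp add: has_bochner_integral_integral_eq)
  have fsum: "summable (\<lambda>j. norm (f j s)) \<and> (\<Sum>j. f j s) = indicator {0<..<t} s * (ml_ker \<alpha> l \<alpha> (t - s) * ml_ker \<alpha> m \<alpha> s)" for s
  proof (cases "0 < s \<and> s < t")
    case True
    have "summable (\<lambda>j. (\<bar>l\<bar> ^ j * frac_ker (\<alpha> * real j + \<alpha>) (t - s)) * ml_ker \<alpha> m \<alpha> s)"
      using True by (intro summable_mult2 summable_frac_ker alpha) auto
    moreover have "(\<Sum>j. ((- l) ^ j * frac_ker (\<alpha> * real j + \<alpha>) (t - s)) * ml_ker \<alpha> m \<alpha> s) = ml_ker \<alpha> l \<alpha> (t - s) * ml_ker \<alpha> m \<alpha> s"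
      using True alpha by (subst suminf_mult2[symmetric]) (auto intro!: summable_ml_ker simp: ml_ker_eq)
    ultimately show ?thesis using True assms unfolding fn unfolding f_def by (simp add: mult_ac)
  qed (simp add: f_def)
  have s2: "summable (\<lambda>k. \<integral>s. norm (f k s) \<partial>lborel)" unfolding intn by (rule cs)
  have i: "integrable lborel (f k)" for k using f by (rule integrable.intros)
  have "(\<integral>s. (\<Sum>k. f k s) \<partial>lborel) = (\<Sum>k. \<integral>s. f k s \<partial>lborel)"
    by (rule integral_suminf) (use i s2 fsum in auto)
  also have "\<dots> = (\<Sum>j. (- l) ^ j * c j)" by (simp add: has_bochner_integral_integral_eq[OF f])
  finally have eq: "(\<Sum>j. (- l) ^ j * c j) = (\<integral>s. (\<Sum>k. f k s) \<partial>lborel)" ..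
  have "0 \<le> (\<integral>s. (\<Sum>k. f k s) \<partial>lborel)"
    using fsum ml_ker_pos[OF assms(1) m] ml_ker_pos[OF assms(1,2)]
    by (intro Bochner_Integration.integral_nonneg) (simp add: indicator_def less_imp_le)
  then have S: "0 \<le> (\<Sum>j. (- l) ^ j * c j)" by (simp only: eq)
  have cs': "summable (\<lambda>j. (- l) ^ j * c j)"
    by (rule summable_norm_cancel) (use cs c0 assms in \<open>simp add: abs_mult power_abs\<close>)
  \<comment> \<open>The recursion \<open>a (Suc j) = c j + m * c (Suc j)\<close>, weighted by powers
    of -l. With S the sum of \<open>(- l) ^ j * c j\<close>, summation turns the series of K_l into
    a 0 - l S + m (S - c 0), and a 0 - m c 0 is K_m.\<close>
  have ac': "(- l) ^ Suc j * a (Suc j) = (- l) * ((- l) ^ j * c j) + m * ((- l) ^ Suc j * c (Suc j))" for j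
  proof -
    have "\<alpha> * real (Suc j) + \<alpha> = \<alpha> * real j + \<alpha> + \<alpha>" by (simp add: algebra_simps)
    then have "a (Suc j) = c j + m * c (Suc j)" using ac[of "Suc j"] unfolding c_def by (metis diff_add_cancel)
    then show ?thesis by (simp only:) (simp add: algebra_simps)
  qed
  have "ml_ker \<alpha> l \<alpha> t = (\<Sum>j. (- l) ^ j * a j)"
    unfolding a_def by (rule ml_ker_eq[OF assms(4) alpha])
  also have "\<dots> = a 0 + (\<Sum>j. (- l) ^ Suc j * a (Suc j))"
    using suminf_split_head[OF summable_ml_ker[OF alpha assms(4), of l]] unfolding a_def by simp
  also have "(\<Sum>j. (- l) ^ Suc j * a (Suc j)) = (\<Sum>j. (- l) * ((- l) ^ j * c j)) + (\<Sum>j. m * ((- l) ^ Suc j * c (Suc j)))"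
    unfolding ac' by (intro suminf_add[symmetric] summable_mult cs' summable_Suc_iff[THEN iffD2, of "\<lambda>j. (- l) ^ j * c j"])
  also have "\<dots> = (- l) * (\<Sum>j. (- l) ^ j * c j) + m * (\<Sum>j. (- l) ^ Suc j * c (Suc j))"
    by (intro arg_cong2[where f="(+)"] suminf_mult cs' summable_Suc_iff[THEN iffD2, of "\<lambda>j. (- l) ^ j * c j"])
  also have "(\<Sum>j. (- l) ^ Suc j * c (Suc j)) = (\<Sum>j. (- l) ^ j * c j) - c 0"
    using suminf_split_head[OF cs'] by simp
  finally have "ml_ker \<alpha> l \<alpha> t = ml_ker \<alpha> m \<alpha> t + (m - l) * (\<Sum>j. (- l) ^ j * c j)"
    using ac[of 0] by (simp add: algebra_simps)
  then show ?thesis using S assms by simp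
qed

lemma ml_ker_1: "t > 0 \<Longrightarrow> ml_ker \<alpha> l 1 t = mittag_leffler \<alpha> 1 (- l * t powr \<alpha>)"
  by (simp add: ml_ker_def)

text \<open>Integration over (0, t) is convolution with the constant kernel
  \<open>frac_ker 1\<close>, and \<open>ml_ker_shift\<close> at \<zeta> = 1 evaluates the
  result.\<close>

lemma ml_ker_integral:
  assumes "l > 0" "t > 0"
  shows "has_bochner_integral lborel (\<lambda>s. indicator {0<..<t} s * ml_ker \<alpha> l \<alpha> s)
           ((1 - mittag_leffler \<alpha> 1 (- l * t powr \<alpha>)) / l)"
proof -
  have "ml_ker \<alpha> l (\<alpha> + 1) t = (1 - mittag_leffler \<alpha> 1 (- l * t powr \<alpha>)) / l"
    using ml_ker_shift[OF assms(2), of 1 l] ml_ker_1[OF assms(2), of l] assms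
    by (simp add: frac_ker_def field_simps)
  moreover have "(\<lambda>s. indicator {0<..<t} s * (frac_ker 1 (t - s) * ml_ker \<alpha> l \<alpha> s)) = (\<lambda>s. indicator {0<..<t} s * ml_ker \<alpha> l \<alpha> s)"
    by (auto simp: frac_ker_def indicator_def fun_eq_iff)
  ultimately show ?thesis using ml_ker_conv[OF _ alpha assms(2), of 1 l] by simp
qed

text \<open>For t > 0 the function is the fractional integral of order 1 - \<alpha> of the positive
  kernel, hence nonnegative; this is where \<alpha> < 1 enters. The upper bound is
  \<open>ml_ker_shift\<close> at \<zeta> = 1, the subtracted term being nonnegative.\<close>

lemma mittag_leffler_bounds:
  assumes "\<alpha> < 1" "l > 0" "t \<ge> 0"
  shows "0 \<le> mittag_leffler \<alpha> 1 (- l * t powr \<alpha>)" "mittag_leffler \<alpha> 1 (- l * t powr \<alpha>) \<le> 1"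
proof -
  have K: "0 \<le> ml_ker \<alpha> l \<alpha> s" if "s > 0" for s using ml_ker_pos[of l s] assms that by simp
  have "0 \<le> mittag_leffler \<alpha> 1 (- l * t powr \<alpha>) \<and> mittag_leffler \<alpha> 1 (- l * t powr \<alpha>) \<le> 1"
  proof (cases "t = 0")
    case True then show ?thesis by (simp add: mittag_leffler_0)
  next
    case False
    then have t: "t > 0" using assms by simp
    have "0 \<le> ml_ker \<alpha> l (\<alpha> + (1 - \<alpha>)) t"
      by (rule ml_ker_conv_nonneg) (use assms t alpha K in auto)
    moreover have "0 \<le> ml_ker \<alpha> l (\<alpha> + 1) t"
      by (rule ml_ker_conv_nonneg) (use assms t alpha K in auto)
    then have "ml_ker \<alpha> l 1 t \<le> frac_ker 1 t"
      using assms t by (intro ml_ker_le_frac_ker) (auto simp: add.commute)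
    ultimately show ?thesis using t by (simp add: ml_ker_1 frac_ker_def)
  qed
  then show "0 \<le> mittag_leffler \<alpha> 1 (- l * t powr \<alpha>)" "mittag_leffler \<alpha> 1 (- l * t powr \<alpha>) \<le> 1" by auto
qed

end

section \<open>The Trudinger inequality\<close>

definition plane :: "real \<times> real \<Rightarrow> real^2" where
  "plane p = fst p *\<^sub>R axis 1 1 + snd p *\<^sub>R axis 2 1"

lemma plane_nth [simp]: "plane p $ 1 = fst p" "plane p $ 2 = snd p"
  by (simp_all add: plane_def axis_def)

lemma borel_measurable_plane [measurable]: "plane \<in> borel_measurable (lborel \<Otimes>\<^sub>M lborel)"
proof -
  have "continuous_on UNIV plane" unfolding plane_def[abs_def] by (intro continuous_intros)
  then have "plane \<in> borel_measurable borel" by (rule borel_measurable_continuous_onI)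
  then show ?thesis by (simp add: borel_prod[symmetric] measurable_cong_sets[OF sets_pair_measure_cong[OF sets_lborel sets_lborel] refl])
qed

text \<open>Lebesgue measure is determined by its values on boxes, and the preimage of a box under
  \<open>plane\<close> is a product of intervals. This makes iterated integrals available on
  \<open>real^2\<close>.\<close>

lemma lborel_plane: "(lborel :: (real^2) measure) = distr (lborel \<Otimes>\<^sub>M lborel) borel plane"
proof (rule lborel_eqI)
  fix l u :: "real^2" assume lu: "\<And>b. b \<in> Basis \<Longrightarrow> l \<bullet> b \<le> u \<bullet> b"
  have B: "(Basis :: (real^2) set) = {axis 1 1, axis 2 1}"
    by (auto simp: Basis_vec_def UNIV_2)
  have ne: "(axis 1 1 :: real^2) \<noteq> axis 2 1" by (simp add: axis_eq_axis)
  have lu': "l $ 1 \<le> u $ 1" "l $ 2 \<le> u $ 2"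
    using lu[of "axis 1 1"] lu[of "axis 2 1"] by (auto simp: B inner_axis)
  have pre: "plane -` box l u \<inter> space (lborel \<Otimes>\<^sub>M lborel) = {l $ 1<..<u $ 1} \<times> {l $ 2<..<u $ 2}"
    by (auto simp: space_pair_measure mem_box B inner_axis)
  have "emeasure (distr (lborel \<Otimes>\<^sub>M lborel) borel plane) (box l u) = 
      emeasure (lborel \<Otimes>\<^sub>M lborel) ({l $ 1<..<u $ 1} \<times> {l $ 2<..<u $ 2})"
    by (subst emeasure_distr) (auto simp: pre)
  also have "\<dots> = emeasure lborel {l $ 1<..<u $ 1} * emeasure lborel {l $ 2<..<u $ 2}"
    by (rule lborel.emeasure_pair_measure_Times) auto
  also have "\<dots> = (\<Prod>b\<in>Basis. (u - l) \<bullet> b)"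
    using lu' ne by (simp add: B inner_axis ennreal_mult)
  finally show "emeasure (distr (lborel \<Otimes>\<^sub>M lborel) borel plane) (box l u) = (\<Prod>b\<in>Basis. (u - l) \<bullet> b)" .
qed simp

lemma nn_integral_plane:
  assumes "f \<in> borel_measurable borel"
  shows "(\<integral>\<^sup>+x. f x \<partial>lborel) = (\<integral>\<^sup>+p. f (plane p) \<partial>(lborel \<Otimes>\<^sub>M lborel))"
  by (subst lborel_plane) (simp add: nn_integral_distr assms)

text \<open>Weaker than being a test function, because the truncations in
  \<open>C1_compact_step\<close> are only continuously differentiable.\<close>

definition C1_compact :: "(real^2 \<Rightarrow> real) \<Rightarrow> bool" where
  "C1_compact f \<longleftrightarrow> (\<forall>x. f differentiable at x) \<and> (\<forall>i. continuous_on UNIV (partial_deriv i f)) \<and>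
     (\<exists>R. \<forall>x. R \<le> norm x \<longrightarrow> f x = 0)"

lemma C1_compact_continuous: "C1_compact f \<Longrightarrow> continuous_on UNIV f"
  unfolding C1_compact_def by (meson continuous_at_imp_continuous_on differentiable_imp_continuous_within)

lemma has_real_derivative_slice:
  assumes "f differentiable at (x + a *\<^sub>R axis i 1)"
  shows "((\<lambda>s. f (x + s *\<^sub>R axis i 1)) has_real_derivative partial_deriv i f (x + a *\<^sub>R axis i 1)) (at a)"
proof -
  let ?D = "frechet_derivative f (at (x + a *\<^sub>R axis i 1))"
  have D: "(f has_derivative ?D) (at (x + a *\<^sub>R axis i 1))" using assms frechet_derivative_works by blast
  have "((\<lambda>s. x + s *\<^sub>R axis i 1) has_derivative (\<lambda>h. h *\<^sub>R axis i 1)) (at a)"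
    by (auto intro!: derivative_eq_intros)
  from has_derivative_compose[OF this D]
  have "((\<lambda>s. f (x + s *\<^sub>R axis i 1)) has_derivative (\<lambda>h. ?D (h *\<^sub>R axis i 1))) (at a)" .
  moreover have "?D (h *\<^sub>R axis i 1) = partial_deriv i f (x + a *\<^sub>R axis i 1) * h" for h
    using linear_scale[OF has_derivative_linear[OF D], of h] by (simp add: partial_deriv_def)
  ultimately show ?thesis by (simp add: has_field_derivative_def)
qed

lemma abs_le_nn_integral_deriv:
  fixes F D :: "real \<Rightarrow> real"
  assumes "\<And>s. (F has_real_derivative D s) (at s)" "continuous_on UNIV D" "\<And>s. s \<le> r \<Longrightarrow> F s = 0"
  shows "ennreal \<bar>F a\<bar> \<le> (\<integral>\<^sup>+s. ennreal \<bar>D s\<bar> \<partial>lborel)"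
proof -
  define b where "b = min r a"
  have "b \<le> a" "F b = 0" using assms(3)[of b] by (auto simp: b_def)
  have hb: "has_bochner_integral lborel (\<lambda>s. D s * indicator {b..a} s) (F a - F b)"
    using assms(2) by (intro has_bochner_integral_FTC_Icc_real \<open>b \<le> a\<close> assms(1)) 
      (simp add: continuous_on_eq_continuous_at)
  have "ennreal (norm (\<integral>s. D s * indicator {b..a} s \<partial>lborel)) \<le> (\<integral>\<^sup>+s. norm (D s * indicator {b..a} s) \<partial>lborel)"
    using hb by (intro integral_norm_bound_ennreal) (rule integrable.intros)
  also have "\<dots> \<le> (\<integral>\<^sup>+s. ennreal \<bar>D s\<bar> \<partial>lborel)"
    by (intro nn_integral_mono) (auto simp: indicator_def)
  finally show ?thesis using hb \<open>F b = 0\<close> by (simp add: has_bochner_integral_integral_eq)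
qed

text \<open>Gagliardo's argument: integrating along a horizontal line bounds |f (a, b)| by a
  function of b alone, along a vertical line by a function of a alone, and the integral of the
  product of the two factorises.\<close>

lemma sobolev_plane:
  assumes "C1_compact f"
  shows "(\<integral>\<^sup>+x. ennreal ((f x)\<^sup>2) \<partial>lborel) \<le>
    (\<integral>\<^sup>+x. ennreal \<bar>partial_deriv 1 f x\<bar> \<partial>lborel) * (\<integral>\<^sup>+x. ennreal \<bar>partial_deriv 2 f x\<bar> \<partial>lborel)"
proof -
  have diff: "f differentiable at x" and cont: "continuous_on UNIV (partial_deriv i f)" for x i
    using assms by (auto simp: C1_compact_def)
  obtain R where R: "\<And>x. R \<le> norm x \<Longrightarrow> f x = 0" using assms by (auto simp: C1_compact_def)
  have [measurable]: "f \<in> borel_measurable borel" "partial_deriv i f \<in> borel_measurable borel" for i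
    using C1_compact_continuous[OF assms] cont by (auto intro: borel_measurable_continuous_onI)
  have p1: "plane (a, b) = b *\<^sub>R axis 2 1 + a *\<^sub>R axis 1 1" and p2: "plane (a, b) = a *\<^sub>R axis 1 1 + b *\<^sub>R axis 2 1" for a b
    by (simp_all add: plane_def add.commute)
  define A where "A b = (\<integral>\<^sup>+s. ennreal \<bar>partial_deriv 1 f (plane (s, b))\<bar> \<partial>lborel)" for b
  define B where "B a = (\<integral>\<^sup>+s. ennreal \<bar>partial_deriv 2 f (plane (a, s))\<bar> \<partial>lborel)" for a
  have z: "f (plane (a, b)) = 0" if "a \<le> - R \<or> b \<le> - R" for a b
  proof (rule R)
    show "R \<le> norm (plane (a, b))"
      using that component_le_norm_cart[of "plane (a, b)" 1] component_le_norm_cart[of "plane (a, b)" 2] by auto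
  qed
  have fA: "ennreal \<bar>f (plane (a, b))\<bar> \<le> A b" for a b
    unfolding A_def
  proof (rule abs_le_nn_integral_deriv[of "\<lambda>s. f (plane (s, b))" "\<lambda>s. partial_deriv 1 f (plane (s, b))" "-R" a])
    show "((\<lambda>s. f (plane (s, b))) has_real_derivative partial_deriv 1 f (plane (s, b))) (at s)" for s
      unfolding p1 by (intro has_real_derivative_slice diff)
    show "continuous_on UNIV (\<lambda>s. partial_deriv 1 f (plane (s, b)))"
      unfolding p1 by (intro continuous_on_compose2[OF cont] continuous_intros) auto
  qed (use z in auto)
  have fB: "ennreal \<bar>f (plane (a, b))\<bar> \<le> B a" for a b
    unfolding B_def
  proof (rule abs_le_nn_integral_deriv[of "\<lambda>s. f (plane (a, s))" "\<lambda>s. partial_deriv 2 f (plane (a, s))" "-R" b])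
    show "((\<lambda>s. f (plane (a, s))) has_real_derivative partial_deriv 2 f (plane (a, s))) (at s)" for s
      unfolding p2 by (intro has_real_derivative_slice diff)
    show "continuous_on UNIV (\<lambda>s. partial_deriv 2 f (plane (a, s)))"
      unfolding p2 by (intro continuous_on_compose2[OF cont] continuous_intros) auto
  qed (use z in auto)
  have [measurable]: "A \<in> borel_measurable lborel" "B \<in> borel_measurable lborel"
    unfolding A_def B_def by measurable
  have IA: "(\<integral>\<^sup>+b. A b \<partial>lborel) = (\<integral>\<^sup>+x. ennreal \<bar>partial_deriv 1 f x\<bar> \<partial>lborel)"
    unfolding A_def by (subst nn_integral_plane, measurable) (subst lborel_pair.nn_integral_snd, simp_all)
  have IB: "(\<integral>\<^sup>+a. B a \<partial>lborel) = (\<integral>\<^sup>+x. ennreal \<bar>partial_deriv 2 f x\<bar> \<partial>lborel)"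
    unfolding B_def by (subst nn_integral_plane, measurable) (subst lborel.nn_integral_fst, simp_all)
  have "(\<integral>\<^sup>+x. ennreal ((f x)\<^sup>2) \<partial>lborel) = (\<integral>\<^sup>+a. \<integral>\<^sup>+b. ennreal ((f (plane (a, b)))\<^sup>2) \<partial>lborel \<partial>lborel)"
    by (subst nn_integral_plane, measurable) (subst lborel.nn_integral_fst, simp_all)
  also have "\<dots> \<le> (\<integral>\<^sup>+a. \<integral>\<^sup>+b. B a * A b \<partial>lborel \<partial>lborel)"
  proof (intro nn_integral_mono)
    fix a b
    have "ennreal ((f (plane (a, b)))\<^sup>2) = ennreal \<bar>f (plane (a, b))\<bar> * ennreal \<bar>f (plane (a, b))\<bar>"
      by (simp add: ennreal_mult[symmetric] power2_eq_square)
    also have "\<dots> \<le> B a * A b" by (intro mult_mono fA fB) auto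
    finally show "ennreal ((f (plane (a, b)))\<^sup>2) \<le> B a * A b" .
  qed
  also have "\<dots> = (\<integral>\<^sup>+a. B a \<partial>lborel) * (\<integral>\<^sup>+b. A b \<partial>lborel)"
    by (simp add: nn_integral_cmult nn_integral_multc)
  finally show ?thesis by (simp add: IA IB mult.commute)
qed

section \<open>Truncation between levels and decay of level sets\<close>

definition pos_sq :: "real \<Rightarrow> real" where "pos_sq x = (max 0 x)\<^sup>2"

lemma DERIV_pos_sq: "(pos_sq has_real_derivative 2 * max 0 x) (at x)"
proof -
  consider "x > 0" | "x < 0" | "x = 0" by linarith
  then show ?thesis
  proof cases
    case 1
    have "((\<lambda>x. x\<^sup>2) has_real_derivative 2 * max 0 x) (at x)"
      using 1 by (auto intro!: derivative_eq_intros)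
    then show ?thesis
      by (rule has_field_derivative_transform_within_open[of _ _ _ "{0<..}"]) (use 1 in \<open>auto simp: pos_sq_def\<close>)
  next
    case 2
    have "((\<lambda>x. 0) has_real_derivative 2 * max 0 x) (at x)"
      using 2 by auto
    then show ?thesis
      by (rule has_field_derivative_transform_within_open[of _ _ _ "{..<0}"]) (use 2 in \<open>auto simp: pos_sq_def\<close>)
  next
    case 3
    have "((\<lambda>h::real. max 0 h) \<longlongrightarrow> max 0 0) (at 0)" by (intro tendsto_intros)
    moreover have "(pos_sq (0 + h) - pos_sq 0) / h = max 0 h" for h
      by (simp add: pos_sq_def power2_eq_square max_def)
    ultimately show ?thesis using 3 by (simp add: DERIV_def)
  qed
qed

text \<open>A continuously differentiable transition from 0 to 1, equal to 1 - (1 - x^2)^2 on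
  [0, 1]. Only the slope bound 2 and the vanishing of the derivative outside (0, 1) are used
  later.\<close>

definition C1_step :: "real \<Rightarrow> real" where "C1_step x = 1 - pos_sq (1 - pos_sq x)"

definition C1_step' :: "real \<Rightarrow> real" where "C1_step' x = 4 * max 0 (1 - pos_sq x) * max 0 x"

lemma DERIV_C1_step: "(C1_step has_real_derivative C1_step' x) (at x)"
  unfolding C1_step_def[abs_def] C1_step'_def
  by (rule derivative_eq_intros DERIV_chain'[OF _ DERIV_pos_sq] DERIV_pos_sq refl)+ simp

lemma C1_step_ge_1: "x \<ge> 1 \<Longrightarrow> C1_step x = 1"
proof -
  assume "x \<ge> 1"
  then have "1 \<le> x\<^sup>2" using power_mono[of 1 x 2] by simp
  then show ?thesis using \<open>x \<ge> 1\<close> by (simp add: C1_step_def pos_sq_def)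
qed

lemma C1_step_le_0: "x \<le> 0 \<Longrightarrow> C1_step x = 0"
  by (simp add: C1_step_def pos_sq_def max_def)

lemma C1_step'_bound: "\<bar>C1_step' x\<bar> \<le> 2 * indicator {0<..<1} x"
proof -
  consider "x \<le> 0" | "x \<ge> 1" | "0 < x" "x < 1" by linarith
  then show ?thesis
  proof cases
    case 1 then show ?thesis by (simp add: C1_step'_def)
  next
    case 2 
    then show ?thesis using power_mono[of 1 x 2] by (simp add: C1_step'_def pos_sq_def)
  next
    case 3
    have x2: "x\<^sup>2 < 1" using 3 by (simp add: power_less_one_iff)
    have "x * (1 - x) \<le> 1 / 4" using zero_le_power2[of "2 * x - 1"] by (simp add: power2_eq_square algebra_simps)
    then have "x * (1 - x) * (1 + x) \<le> 1 / 4 * 2" using 3 by (intro mult_mono) auto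
    then have "4 * (1 - x\<^sup>2) * x \<le> 2" by (simp add: power2_eq_square algebra_simps)
    then show ?thesis using 3 x2 by (simp add: C1_step'_def pos_sq_def max_def abs_mult)
  qed
qed

lemma continuous_on_C1_step': "continuous_on UNIV C1_step'"
  unfolding C1_step'_def[abs_def] pos_sq_def by (intro continuous_intros)

lemma partial_deriv_compose:
  assumes "f differentiable at x" "(g has_real_derivative g') (at (f x))"
  shows "(\<lambda>x. g (f x)) differentiable at x" "partial_deriv i (\<lambda>x. g (f x)) x = g' * partial_deriv i f x"
proof -
  have D: "(f has_derivative frechet_derivative f (at x)) (at x)" using assms frechet_derivative_works by blast
  from has_derivative_compose[OF D assms(2)[unfolded has_field_derivative_def]]
  have *: "((\<lambda>x. g (f x)) has_derivative (\<lambda>h. g' * frechet_derivative f (at x) h)) (at x)" .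
  then show "(\<lambda>x. g (f x)) differentiable at x" by (auto simp: differentiable_def)
  show "partial_deriv i (\<lambda>x. g (f x)) x = g' * partial_deriv i f x"
    unfolding partial_deriv_def frechet_derivative_at[OF *, symmetric] ..
qed

lemma C1_compact_step:
  assumes "C1_compact f" "0 \<le> s" "0 < h"
  shows "C1_compact (\<lambda>x. C1_step ((f x - s) / h))"
    and "partial_deriv i (\<lambda>x. C1_step ((f x - s) / h)) x = C1_step' ((f x - s) / h) / h * partial_deriv i f x"
proof -
  have diff: "f differentiable at x" and cont: "continuous_on UNIV (partial_deriv i f)" for x i
    using assms by (auto simp: C1_compact_def)
  obtain R where R: "\<And>x. R \<le> norm x \<Longrightarrow> f x = 0" using assms by (auto simp: C1_compact_def)
  have D: "((\<lambda>y. C1_step ((y - s) / h)) has_real_derivative C1_step' ((y - s) / h) / h) (at y)" for y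
    by (rule DERIV_chain'[OF _ DERIV_C1_step, THEN DERIV_cong]) (use assms(3) in \<open>auto intro!: derivative_eq_intros\<close>)
  note P = partial_deriv_compose[OF diff D]
  show "partial_deriv i (\<lambda>x. C1_step ((f x - s) / h)) x = C1_step' ((f x - s) / h) / h * partial_deriv i f x"
    by (rule P)
  have "continuous_on UNIV (partial_deriv i (\<lambda>x. C1_step ((f x - s) / h)))" for i
  proof -
    have "partial_deriv i (\<lambda>x. C1_step ((f x - s) / h)) = (\<lambda>x. C1_step' ((f x - s) / h) / h * partial_deriv i f x)"
      by (intro ext P)
    then show ?thesis unfolding divide_inverse
    by (simp only:) (intro continuous_intros cont continuous_on_compose2[OF continuous_on_C1_step'] C1_compact_continuous assms(1), auto)
  qed
  moreover have "C1_step ((f x - s) / h) = 0" if "R \<le> norm x" for x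
    using R[OF that] assms by (intro C1_step_le_0) (auto simp: divide_nonpos_pos)
  ultimately show "C1_compact (\<lambda>x. C1_step ((f x - s) / h))"
    unfolding C1_compact_def using P(1) by blast
qed

lemma ennreal_mult_le_sum_sq: "a * b \<le> a\<^sup>2 + (b::ennreal)\<^sup>2"
proof (cases "a \<le> b")
  case True
  then have "a * b \<le> b\<^sup>2" by (simp add: power2_eq_square mult_right_mono)
  then show ?thesis by (simp add: add_increasing)
next
  case False
  then have "a * b \<le> a\<^sup>2" by (simp add: power2_eq_square mult_left_mono)
  then show ?thesis by (simp add: add_increasing2)
qed

definition grad_sq :: "(real^2 \<Rightarrow> real) \<Rightarrow> real^2 \<Rightarrow> real" where
  "grad_sq f x = (\<Sum>i\<in>UNIV. (partial_deriv i f x)\<^sup>2)"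

text \<open>The Sobolev inequality is applied to a truncation that is 1 above the strip and whose
  gradient lives on the strip, with size at most 2 / h times that of the gradient of f.
  Cauchy-Schwarz then splits the L^1 norms of its derivatives into measure and energy of the
  strip.\<close>

lemma level_set_estimate:
  assumes "C1_compact f" "0 \<le> s" "0 < h"
  shows "ennreal (h\<^sup>2 / 4) * emeasure lborel {x. s + h < f x} \<le>
    emeasure lborel {x. s < f x \<and> f x < s + h} *
      (\<integral>\<^sup>+x. indicator {x. s < f x \<and> f x < s + h} x * ennreal (grad_sq f x) \<partial>lborel)"
proof -
  have cont: "continuous_on UNIV (partial_deriv i f)" for i
    using assms by (auto simp: C1_compact_def)
  have [measurable]: "f \<in> borel_measurable borel" "partial_deriv i f \<in> borel_measurable borel" for i
    using C1_compact_continuous[OF assms(1)] cont by (auto intro: borel_measurable_continuous_onI)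
  define A where "A = {x. s < f x \<and> f x < s + h}"
  have [measurable]: "A \<in> sets borel" unfolding A_def by measurable
  define F where "F x = C1_step ((f x - s) / h)" for x
  note F = C1_compact_step[OF assms, folded F_def[abs_def]]
  define e where "e i = (\<integral>\<^sup>+x. indicator A x * ennreal ((partial_deriv i f x)\<^sup>2) \<partial>lborel)" for i
  have D: "(\<integral>\<^sup>+x. ennreal \<bar>partial_deriv i F x\<bar> \<partial>lborel)\<^sup>2 \<le> ennreal (4 / h\<^sup>2) * (emeasure lborel A * e i)" for i
  proof -
    \<comment> \<open>The indicator appears twice so that Cauchy-Schwarz can give one copy to each
      factor.\<close>
    have "(\<integral>\<^sup>+x. ennreal \<bar>partial_deriv i F x\<bar> \<partial>lborel) \<le> (\<integral>\<^sup>+x. ennreal (2 / h) * (indicator A x * (indicator A x * ennreal \<bar>partial_deriv i f x\<bar>)) \<partial>lborel)"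
    proof (intro nn_integral_mono)
      fix x
      have ind: "indicator {0<..<1} ((f x - s) / h) = (indicator A x :: real)"
        using assms(3) by (auto simp: A_def indicator_def field_simps)
      have "\<bar>partial_deriv i F x\<bar> = \<bar>C1_step' ((f x - s) / h)\<bar> / h * \<bar>partial_deriv i f x\<bar>"
        using assms(3) by (simp add: F(2) abs_mult)
      also have "\<dots> \<le> 2 * indicator A x / h * \<bar>partial_deriv i f x\<bar>"
        using assms(3) C1_step'_bound[of "(f x - s) / h"] unfolding ind
        by (intro mult_right_mono divide_right_mono) auto
      finally show "ennreal \<bar>partial_deriv i F x\<bar> \<le> ennreal (2 / h) * (indicator A x * (indicator A x * ennreal \<bar>partial_deriv i f x\<bar>))"
        using assms(3) by (auto simp: indicator_def ennreal_mult[symmetric] intro!: ennreal_leI)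
    qed
    also have "\<dots> = ennreal (2 / h) * (\<integral>\<^sup>+x. indicator A x * (indicator A x * ennreal \<bar>partial_deriv i f x\<bar>) \<partial>lborel)"
      by (rule nn_integral_cmult) measurable
    finally have "(\<integral>\<^sup>+x. ennreal \<bar>partial_deriv i F x\<bar> \<partial>lborel)\<^sup>2 \<le> (ennreal (2 / h))\<^sup>2 * (\<integral>\<^sup>+x. indicator A x * (indicator A x * ennreal \<bar>partial_deriv i f x\<bar>) \<partial>lborel)\<^sup>2"
      unfolding power_mult_distrib[symmetric] by (intro power_mono) auto
    also have "\<dots> \<le> (ennreal (2 / h))\<^sup>2 * ((\<integral>\<^sup>+x. (indicator A x)\<^sup>2 \<partial>lborel) * (\<integral>\<^sup>+x. (indicator A x * ennreal \<bar>partial_deriv i f x\<bar>)\<^sup>2 \<partial>lborel))"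
      by (intro mult_left_mono Cauchy_Schwarz_nn_integral) measurable
    also have "(\<integral>\<^sup>+x. (indicator A x)\<^sup>2 \<partial>lborel) = emeasure lborel A"
    proof -
      have "(indicator A x)\<^sup>2 = (indicator A x :: ennreal)" for x by (simp split: split_indicator)
      then show ?thesis by simp
    qed
    also have "(\<integral>\<^sup>+x. (indicator A x * ennreal \<bar>partial_deriv i f x\<bar>)\<^sup>2 \<partial>lborel) = e i"
      unfolding e_def by (intro nn_integral_cong) (auto simp: indicator_def ennreal_power)
    also have "(ennreal (2 / h))\<^sup>2 = ennreal (4 / h\<^sup>2)"
      using assms(3) by (simp add: ennreal_power power_divide)
    finally show ?thesis .
  qed
  have "emeasure lborel {x. s + h < f x} = (\<integral>\<^sup>+x. indicator {x. s + h < f x} x \<partial>lborel)"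
    by (simp add: nn_integral_indicator)
  also have "\<dots> \<le> (\<integral>\<^sup>+x. ennreal ((F x)\<^sup>2) \<partial>lborel)"
  proof (intro nn_integral_mono)
    fix x
    have "F x = 1" if "s + h < f x" unfolding F_def using that assms(3) by (intro C1_step_ge_1) (simp add: field_simps)
    then show "indicator {x. s + h < f x} x \<le> ennreal ((F x)\<^sup>2)" by (auto simp: indicator_def)
  qed
  also have "\<dots> \<le> (\<integral>\<^sup>+x. ennreal \<bar>partial_deriv 1 F x\<bar> \<partial>lborel) * (\<integral>\<^sup>+x. ennreal \<bar>partial_deriv 2 F x\<bar> \<partial>lborel)"
    by (rule sobolev_plane[OF F(1)])
  \<comment> \<open>Replacing the product by the sum of squares lets both partial derivatives
    combine to the full energy \<open>grad_sq\<close>.\<close>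
  also have "\<dots> \<le> (\<integral>\<^sup>+x. ennreal \<bar>partial_deriv 1 F x\<bar> \<partial>lborel)\<^sup>2 + (\<integral>\<^sup>+x. ennreal \<bar>partial_deriv 2 F x\<bar> \<partial>lborel)\<^sup>2"
    by (rule ennreal_mult_le_sum_sq)
  also have "\<dots> \<le> ennreal (4 / h\<^sup>2) * (emeasure lborel A * e 1) + ennreal (4 / h\<^sup>2) * (emeasure lborel A * e 2)"
    by (intro add_mono D)
  also have "\<dots> = ennreal (4 / h\<^sup>2) * (emeasure lborel A * (e 1 + e 2))"
    by (simp add: distrib_left)
  also have "e 1 + e 2 = (\<integral>\<^sup>+x. indicator A x * ennreal (grad_sq f x) \<partial>lborel)"
    unfolding e_def grad_sq_def sum_2 by (subst nn_integral_add[symmetric]) (auto intro!: nn_integral_cong simp: indicator_def)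
  finally have "ennreal (h\<^sup>2 / 4) * emeasure lborel {x. s + h < f x} \<le> ennreal (h\<^sup>2 / 4) * (ennreal (4 / h\<^sup>2) * (emeasure lborel A * (\<integral>\<^sup>+x. indicator A x * ennreal (grad_sq f x) \<partial>lborel)))"
    by (rule mult_left_mono) simp
  also have "ennreal (h\<^sup>2 / 4) * (ennreal (4 / h\<^sup>2) * y) = y" for y
    using assms(3) by (simp add: mult.assoc[symmetric] ennreal_mult[symmetric])
  finally show ?thesis unfolding A_def .
qed

text \<open>
  The bound \<open>x / (1 + x) \<le> exp ((x - 1) / 2) / 2\<close> turns the recursion into geometric decay as long
  as the average of \<open>e j / b\<close> is at most 1.
\<close>

lemma geometric_decay:
  fixes \<nu> e :: "nat \<Rightarrow> real"
  assumes b: "b > 0" and nonneg: "\<And>j. 0 \<le> \<nu> j" "\<And>j. 0 \<le> e j"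
    and rec: "\<And>j. b * \<nu> (Suc j) \<le> (\<nu> j - \<nu> (Suc j)) * e j"
  shows "2 ^ n * \<nu> n \<le> \<nu> 0 * exp (((\<Sum>j<n. e j / b) - real n) / 2)"
proof (induction n)
  case (Suc n)
  define x where "x = e n / b"
  have x: "x \<ge> 0" using nonneg b by (simp add: x_def)
  have "\<nu> (Suc n) * (b + e n) \<le> \<nu> n * e n" using rec[of n] by (simp add: algebra_simps)
  then have "\<nu> (Suc n) * ((b + e n) / b) \<le> \<nu> n * (e n / b)"
    using b by (simp add: divide_right_mono)
  also have "(b + e n) / b = 1 + x" using b by (simp add: x_def add_divide_distrib)
  finally have 1: "\<nu> (Suc n) * (1 + x) \<le> \<nu> n * x" by (simp add: x_def)
  \<comment> \<open>The bound on x / (1 + x) is obtained from (1 - x)^2 >= 0 together with the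
    tangent inequality of exp at 0.\<close>
  have "4 * x \<le> (1 + x) * (1 + x)" using zero_le_power2[of "1 - x"] by (simp add: power2_eq_square algebra_simps)
  also have "\<dots> \<le> (1 + x) * (2 * exp ((x - 1) / 2))"
  proof (intro mult_left_mono)
    have "1 + x = 2 * (1 + (x - 1) / 2)" by (simp add: field_simps)
    also have "\<dots> \<le> 2 * exp ((x - 1) / 2)" by (intro mult_left_mono exp_ge_add_one_self) simp
    finally show "1 + x \<le> 2 * exp ((x - 1) / 2)" .
  qed (use x in auto)
  finally have 2: "2 * x \<le> (1 + x) * exp ((x - 1) / 2)" by simp
  have "(2 ^ Suc n * \<nu> (Suc n)) * (1 + x) \<le> 2 ^ n * \<nu> n * (2 * x)"
    using 1 by (simp add: mult.assoc mult_left_mono)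
  also have "\<dots> \<le> 2 ^ n * \<nu> n * ((1 + x) * exp ((x - 1) / 2))"
    using 2 nonneg by (intro mult_left_mono) auto
  finally have "2 ^ Suc n * \<nu> (Suc n) \<le> 2 ^ n * \<nu> n * exp ((x - 1) / 2)"
    using x mult_right_le_imp_le[of "2 ^ Suc n * \<nu> (Suc n)" "1 + x" "2 ^ n * \<nu> n * exp ((x - 1) / 2)"] by (simp add: mult_ac)
  also have "\<dots> \<le> \<nu> 0 * exp (((\<Sum>j<n. e j / b) - real n) / 2) * exp ((x - 1) / 2)"
    by (intro mult_right_mono Suc) auto
  also have "\<dots> = \<nu> 0 * exp (((\<Sum>j<n. e j / b) - real n) / 2 + (x - 1) / 2)"
    by (simp add: exp_add)
  also have "((\<Sum>j<n. e j / b) - real n) / 2 + (x - 1) / 2 = ((\<Sum>j<Suc n. e j / b) - real (Suc n)) / 2"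
    by (simp add: x_def field_simps)
  finally show ?case .
qed simp

text \<open>The range up to the level sqrt (4 E N) is cut into N strips of equal height. They share
  the energy E, so their energies average at most E / N, which is exactly the threshold at which the
  measure halves per strip on average.\<close>

lemma level_set_decay:
  assumes f: "C1_compact f" and E: "(\<integral>\<^sup>+x. ennreal (grad_sq f x) \<partial>lborel) \<le> ennreal E" "E > 0"
  shows "emeasure lborel {x. 0 < f x \<and> 4 * E * real N < (f x)\<^sup>2} \<le> ennreal ((1 / 2) ^ N) * emeasure lborel {x. f x \<noteq> 0}"
proof (cases "N = 0")
  case True
  have "f \<in> borel_measurable borel" using C1_compact_continuous[OF f] by (rule borel_measurable_continuous_onI)
  then show ?thesis using True by (auto intro!: emeasure_mono)
next
  case False
  have cont: "continuous_on UNIV (partial_deriv i f)" for i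
    using f by (auto simp: C1_compact_def)
  have [measurable]: "f \<in> borel_measurable borel" "partial_deriv i f \<in> borel_measurable borel" for i
    using C1_compact_continuous[OF f] cont by (auto intro: borel_measurable_continuous_onI)
  have [measurable]: "grad_sq f \<in> borel_measurable borel" unfolding grad_sq_def by measurable
  obtain R where R: "\<And>x. R \<le> norm x \<Longrightarrow> f x = 0" using f by (auto simp: C1_compact_def)
  have fin: "emeasure lborel {x. f x \<noteq> 0} < \<infinity>"
    by (rule emeasure_bounded_finite, rule bounded_subset[of "ball 0 R"]) (use R in \<open>auto simp: not_le[symmetric]\<close>)
  \<comment> \<open>This height makes \<open>b = h\<^sup>2 / 4\<close> equal to E / N, so that E / b
    = N cancels the exponent in \<open>geometric_decay\<close>, and N steps reach (N h)^2 = 4 E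
    N.\<close>
  define h where "h = sqrt (4 * E / real N)"
  have h: "h > 0" "h\<^sup>2 / 4 = E / real N" using E False by (auto simp: h_def)
  define b where "b = h\<^sup>2 / 4"
  have b: "b > 0" using h(1) by (simp add: b_def)
  define A where "A j = {x. real j * h < f x \<and> f x < real j * h + h}" for j
  have [measurable]: "A j \<in> sets borel" for j unfolding A_def by measurable
  define \<nu> where "\<nu> j = measure lborel {x. real j * h < f x}" for j
  define e where "e j = enn2real (\<integral>\<^sup>+x. indicator (A j) x * ennreal (grad_sq f x) \<partial>lborel)" for j
  have fin_sub: "emeasure lborel S < \<infinity>" if "S \<subseteq> {x. f x \<noteq> 0}" for S
    using fin that emeasure_mono[of S "{x. f x \<noteq> 0}" lborel] by (auto simp: top.not_eq_extremum)
  have sub1: "{x. real j * h < f x} \<subseteq> {x. f x \<noteq> 0}" and sub2: "A j \<subseteq> {x. f x \<noteq> 0}" for j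
  proof -
    have "0 \<le> real j * h" using h(1) by simp
    then show "{x. real j * h < f x} \<subseteq> {x. f x \<noteq> 0}" "A j \<subseteq> {x. f x \<noteq> 0}" by (force simp: A_def)+
  qed
  have \<nu>: "emeasure lborel {x. real j * h < f x} = ennreal (\<nu> j)" for j
    unfolding \<nu>_def using less_imp_neq[OF fin_sub[OF sub1]] by (intro emeasure_eq_ennreal_measure) simp
  have e: "(\<integral>\<^sup>+x. indicator (A j) x * ennreal (grad_sq f x) \<partial>lborel) = ennreal (e j)" for j
  proof -
    have "(\<integral>\<^sup>+x. indicator (A j) x * ennreal (grad_sq f x) \<partial>lborel) \<le> (\<integral>\<^sup>+x. ennreal (grad_sq f x) \<partial>lborel)"
      by (intro nn_integral_mono) (auto simp: indicator_def)
    also have "\<dots> < \<infinity>" using E by (auto intro: le_less_trans)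
    finally show ?thesis unfolding e_def by simp
  qed
  have rec: "b * \<nu> (Suc j) \<le> (\<nu> j - \<nu> (Suc j)) * e j" for j
  proof -
    have "ennreal b * ennreal (\<nu> (Suc j)) \<le> emeasure lborel (A j) * ennreal (e j)"
      using level_set_estimate[OF f, of "real j * h" h] h
      unfolding e[symmetric] \<nu>[symmetric] A_def b_def by (simp add: algebra_simps)
    also have "emeasure lborel (A j) = ennreal (measure lborel (A j))"
      using less_imp_neq[OF fin_sub[OF sub2]] by (intro emeasure_eq_ennreal_measure) simp
    finally have "b * \<nu> (Suc j) \<le> measure lborel (A j) * e j"
      using b by (simp add: ennreal_mult[symmetric] e_def \<nu>_def)
    also have "measure lborel (A j) \<le> \<nu> j - \<nu> (Suc j)"
    proof -
      have fm: "A j \<in> fmeasurable lborel" "{x. real k * h < f x} \<in> fmeasurable lborel" for k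
        using fin_sub[OF sub1[of k]] fin_sub[OF sub2[of j]] by (auto intro!: fmeasurableI)
      have "measure lborel (A j) + measure lborel {x. real (Suc j) * h < f x} = measure lborel (A j \<union> {x. real (Suc j) * h < f x})"
      proof -
        have "A j \<inter> {x. real (Suc j) * h < f x} = {}" by (auto simp: A_def algebra_simps)
        then show ?thesis using measure_Un3[OF fm(1) fm(2)[of "Suc j"]] by simp
      qed
      also have "\<dots> \<le> measure lborel {x. real j * h < f x}"
        using h by (intro measure_mono_fmeasurable fm) (auto simp: A_def algebra_simps)
      finally show ?thesis by (simp add: \<nu>_def)
    qed
    finally show ?thesis by (auto simp: e_def mult_right_mono)
  qed
  have disj: "disjoint_family_on A {..<N}"
  proof (unfold disjoint_family_on_def, intro ballI impI)
    have *: "A i \<inter> A j = {}" if "i < j" for i j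
    proof -
      have "(real i + 1) * h \<le> real j * h" using that h by (intro mult_right_mono) auto
      then show ?thesis by (auto simp: A_def algebra_simps)
    qed
    fix i j :: nat assume "i \<noteq> j" then show "A i \<inter> A j = {}" using *[of i j] *[of j i] by (cases "i < j") auto
  qed
  \<comment> \<open>The strips are disjoint, so their energies add up to at most the total
    energy.\<close>
  have "ennreal (\<Sum>j<N. e j) = (\<Sum>j<N. \<integral>\<^sup>+x. indicator (A j) x * ennreal (grad_sq f x) \<partial>lborel)"
    unfolding e by (subst sum_ennreal) (auto simp: e_def)
  also have "\<dots> = (\<integral>\<^sup>+x. (\<Sum>j<N. indicator (A j) x * ennreal (grad_sq f x)) \<partial>lborel)"
    by (rule nn_integral_sum[symmetric]) measurable
  also have "\<dots> \<le> (\<integral>\<^sup>+x. ennreal (grad_sq f x) \<partial>lborel)"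
  proof (intro nn_integral_mono)
    fix x
    have "(\<Sum>j<N. indicator (A j) x * ennreal (grad_sq f x)) = indicator (\<Union>j<N. A j) x * ennreal (grad_sq f x)"
      unfolding sum_distrib_right[symmetric] by (subst indicator_UN_disjoint[OF _ disj]) auto
    also have "\<dots> \<le> ennreal (grad_sq f x)" by (simp add: indicator_def)
    finally show "(\<Sum>j<N. indicator (A j) x * ennreal (grad_sq f x)) \<le> ennreal (grad_sq f x)" .
  qed
  also note E(1)
  finally have "(\<Sum>j<N. e j) \<le> E" using E(2) by simp
  then have "(\<Sum>j<N. e j / b) \<le> E / b"
    unfolding sum_divide_distrib[symmetric] using b by (intro divide_right_mono) auto
  also have "E / b = real N" using h E False by (simp add: b_def)
  finally have sum: "((\<Sum>j<N. e j / b) - real N) / 2 \<le> 0" by simp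
  have "2 ^ N * \<nu> N \<le> \<nu> 0 * exp (((\<Sum>j<N. e j / b) - real N) / 2)"
    by (rule geometric_decay[where \<nu>=\<nu> and e=e, OF b _ _ rec]) (auto simp: \<nu>_def e_def)
  also have "\<dots> \<le> \<nu> 0 * 1" using sum by (intro mult_left_mono) (auto simp: \<nu>_def)
  finally have "\<nu> N \<le> (1 / 2) ^ N * \<nu> 0" by (simp add: power_divide field_simps)
  then have "ennreal (\<nu> N) \<le> ennreal ((1 / 2) ^ N) * ennreal (\<nu> 0)"
    by (simp add: ennreal_mult[symmetric] \<nu>_def)
  also have "\<dots> \<le> ennreal ((1 / 2) ^ N) * emeasure lborel {x. f x \<noteq> 0}"
    unfolding \<nu>[symmetric] by (intro mult_left_mono emeasure_mono) auto
  also have "ennreal (\<nu> N) = emeasure lborel {x. real N * h < f x}" by (simp add: \<nu>)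
  also have "{x. real N * h < f x} = {x. 0 < f x \<and> 4 * E * real N < (f x)\<^sup>2}"
  proof -
    have Nh: "(real N * h)\<^sup>2 = 4 * E * real N" 
      using h(2) False by (simp add: power_mult_distrib) (simp add: power2_eq_square field_simps)
    have "real N * h < y \<longleftrightarrow> 0 < y \<and> 4 * E * real N < y\<^sup>2" for y
      unfolding Nh[symmetric] using h False
      by (metis mult_pos_pos neq0_conv of_nat_0_less_iff order_less_trans power2_less_imp_less power_strict_mono less_imp_le pos2)
    then show ?thesis by simp
  qed
  finally show ?thesis .
qed

text \<open>The one-sided estimate is used for f and for - f, whence the factor 2.\<close>

lemma level_set_decay_abs:
  assumes f: "C1_compact f" and E: "(\<integral>\<^sup>+x. ennreal (grad_sq f x) \<partial>lborel) \<le> ennreal E" "E > 0"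
  shows "emeasure lborel {x. 4 * E * real N < (f x)\<^sup>2} \<le> ennreal (2 * (1 / 2) ^ N) * emeasure lborel {x. f x \<noteq> 0}"
proof -
  have diff: "f differentiable at x" for x using f by (auto simp: C1_compact_def)
  have *: "(\<lambda>x. - f x) differentiable at x" "partial_deriv i (\<lambda>x. - f x) x = - 1 * partial_deriv i f x" for i x
  proof -
    have "(uminus has_real_derivative - 1) (at y)" for y :: real
      by (auto intro!: derivative_eq_intros)
    from partial_deriv_compose[OF diff this]
    show "(\<lambda>x. - f x) differentiable at x" "partial_deriv i (\<lambda>x. - f x) x = - 1 * partial_deriv i f x" by auto
  qed
  have m: "C1_compact (\<lambda>x. - f x)"
  proof -
    have "partial_deriv i (\<lambda>x. - f x) = (\<lambda>x. - 1 * partial_deriv i f x)" for i by (intro ext *)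
    then show ?thesis using f unfolding C1_compact_def by (auto intro!: *(1) continuous_intros)
  qed
  have g: "grad_sq (\<lambda>x. - f x) = grad_sq f" by (simp add: grad_sq_def[abs_def] *(2))
  have [measurable]: "f \<in> borel_measurable borel"
    using C1_compact_continuous[OF f] by (auto intro: borel_measurable_continuous_onI)
  have "{x. 4 * E * real N < (f x)\<^sup>2} \<subseteq> {x. 0 < f x \<and> 4 * E * real N < (f x)\<^sup>2} \<union> {x. 0 < - f x \<and> 4 * E * real N < (- f x)\<^sup>2}"
  proof
    fix x assume x: "x \<in> {x. 4 * E * real N < (f x)\<^sup>2}"
    moreover have "0 \<le> 4 * E * real N" using E by simp
    ultimately have "f x \<noteq> 0" by auto
    then show "x \<in> {x. 0 < f x \<and> 4 * E * real N < (f x)\<^sup>2} \<union> {x. 0 < - f x \<and> 4 * E * real N < (- f x)\<^sup>2}"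
      using x by auto
  qed
  then have "emeasure lborel {x. 4 * E * real N < (f x)\<^sup>2} \<le>
    emeasure lborel {x. 0 < f x \<and> 4 * E * real N < (f x)\<^sup>2} + emeasure lborel {x. 0 < - f x \<and> 4 * E * real N < (- f x)\<^sup>2}"
    by (intro order_trans[OF emeasure_mono emeasure_subadditive]) measurable
  also have "\<dots> \<le> ennreal ((1 / 2) ^ N) * emeasure lborel {x. f x \<noteq> 0} + ennreal ((1 / 2) ^ N) * emeasure lborel {x. f x \<noteq> 0}"
    using level_set_decay[OF f E, of N] level_set_decay[OF m, of E N] E by (intro add_mono) (auto simp: g)
  also have "\<dots> = ennreal (2 * (1 / 2) ^ N) * emeasure lborel {x. f x \<noteq> 0}"
    by (simp add: ennreal_mult flip: mult_2)
      (simp add: mult.assoc)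
  finally show ?thesis .
qed

text \<open>The layer sum \<open>\<Sum>N<n. exp (c * (N + 1)) - exp (c * N)\<close> telescopes.\<close>

lemma exp_le_layer_sum:
  assumes "c > 0" "z \<ge> 0"
  shows "ennreal (exp (c * z) - 1) \<le> (\<Sum>N. ennreal ((exp c - 1) * exp c ^ N) * indicator {N. real N < z} N)"
proof -
  define n where "n = nat \<lceil>z\<rceil>"
  have "exp (c * z) \<le> exp (c * real n)" using assms by (simp add: n_def)
  also have "\<dots> = exp c ^ n" by (metis exp_of_nat_mult mult.commute)
  finally have "exp (c * z) - 1 \<le> exp c ^ n - 1" by simp
  also have "\<dots> = (exp c - 1) * (\<Sum>N<n. exp c ^ N)" by (rule power_diff_1_eq)
  finally have "ennreal (exp (c * z) - 1) \<le> ennreal (\<Sum>N<n. (exp c - 1) * exp c ^ N)"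
    by (intro ennreal_leI) (simp add: sum_distrib_left)
  also have "\<dots> = (\<Sum>N<n. ennreal ((exp c - 1) * exp c ^ N))"
    using assms by (intro sum_ennreal[symmetric]) auto
  also have "\<dots> = (\<Sum>N<n. ennreal ((exp c - 1) * exp c ^ N) * indicator {N. real N < z} N)"
  proof (intro sum.cong refl)
    fix N assume "N \<in> {..<n}"
    then have "real N < z" unfolding n_def using assms by (auto simp: zless_nat_eq_int_zless less_ceiling_iff)
    then show "ennreal ((exp c - 1) * exp c ^ N) = ennreal ((exp c - 1) * exp c ^ N) * indicator {N. real N < z} N"
      by simp
  qed
  also have "\<dots> \<le> (\<Sum>N. ennreal ((exp c - 1) * exp c ^ N) * indicator {N. real N < z} N)"
    by (intro sum_le_suminf) auto
  finally show ?thesis .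
qed

text \<open>The integral is summed over the layers of \<open>exp_le_layer_sum\<close> at z = f^2 /
  (4 E): the weights grow like exp c ^ N and the level sets shrink like 2^(-N), so a small c gives a
  geometric series. The constant depends on the bound m for the measure of the support only.\<close>

lemma trudinger:
  assumes "m \<ge> 0"
  obtains C where "C > 0" "\<And>f E. C1_compact f \<Longrightarrow> E > 0 \<Longrightarrow> (\<integral>\<^sup>+x. ennreal (grad_sq f x) \<partial>lborel) \<le> ennreal E \<Longrightarrow>
    emeasure lborel {x. f x \<noteq> 0} \<le> ennreal m \<Longrightarrow>
    (\<integral>\<^sup>+x. ennreal (exp ((f x)\<^sup>2 / (C * E)) - 1) \<partial>lborel) \<le> 1"
proof -
  \<comment> \<open>With exp c = 1 + q the layers sum to 4 m q / (1 - q), and (4 m + 2) q = 1 makes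
    this at most 1. The constant of the lemma is then 4 / c.\<close>
  define q where "q = 1 / (4 * m + 2)"
  have q: "q > 0" "q < 1" using assms by (auto simp: q_def)
  define c where "c = ln (1 + q)"
  have c: "c > 0" "exp c = 1 + q" using q by (auto simp: c_def)
  have "(\<integral>\<^sup>+x. ennreal (exp ((f x)\<^sup>2 / (4 / c * E)) - 1) \<partial>lborel) \<le> 1"
    if f: "C1_compact f" and E: "E > 0" "(\<integral>\<^sup>+x. ennreal (grad_sq f x) \<partial>lborel) \<le> ennreal E"
      and m: "emeasure lborel {x. f x \<noteq> 0} \<le> ennreal m" for f E
  proof -
    have [measurable]: "f \<in> borel_measurable borel"
      using C1_compact_continuous[OF f] by (auto intro: borel_measurable_continuous_onI)
    have "(\<integral>\<^sup>+x. ennreal (exp ((f x)\<^sup>2 / (4 / c * E)) - 1) \<partial>lborel) \<le>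
      (\<integral>\<^sup>+x. (\<Sum>N. ennreal ((exp c - 1) * exp c ^ N) * indicator {x. 4 * E * real N < (f x)\<^sup>2} x) \<partial>lborel)"
    proof (intro nn_integral_mono)
      fix x
      have a: "(f x)\<^sup>2 / (4 / c * E) = c * ((f x)\<^sup>2 / (4 * E))" using c E by simp
      have b: "indicator {N. real N < (f x)\<^sup>2 / (4 * E)} N = (indicator {x. 4 * E * real N < (f x)\<^sup>2} x :: ennreal)" for N
        using E by (simp add: indicator_def pos_less_divide_eq mult.commute)
      show "ennreal (exp ((f x)\<^sup>2 / (4 / c * E)) - 1) \<le> (\<Sum>N. ennreal ((exp c - 1) * exp c ^ N) * indicator {x. 4 * E * real N < (f x)\<^sup>2} x)"
        using exp_le_layer_sum[OF c(1), of "(f x)\<^sup>2 / (4 * E)"] E unfolding a b by simp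
    qed
    also have "\<dots> = (\<Sum>N. ennreal ((exp c - 1) * exp c ^ N) * emeasure lborel {x. 4 * E * real N < (f x)\<^sup>2})"
      by (subst nn_integral_suminf) (auto simp: nn_integral_cmult_indicator)
    also have "\<dots> \<le> (\<Sum>N. ennreal ((exp c - 1) * exp c ^ N) * (ennreal (2 * (1 / 2) ^ N) * ennreal m))"
      by (intro suminf_le mult_left_mono order_trans[OF level_set_decay_abs[OF f E(2,1)]] m) auto
    also have "\<dots> = (\<Sum>N. ennreal (2 * m * q * ((1 + q) / 2) ^ N))"
      using q assms by (simp add: c ennreal_mult[symmetric] power_divide mult_ac)
    also have "\<dots> = ennreal (2 * m * q * (1 / (1 - (1 + q) / 2)))"
    proof (rule suminf_ennreal_eq)
      show "(\<lambda>N. 2 * m * q * ((1 + q) / 2) ^ N) sums (2 * m * q * (1 / (1 - (1 + q) / 2)))"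
        using q by (intro sums_mult geometric_sums) auto
    qed (use q assms in auto)
    also have "\<dots> \<le> 1"
    proof -
      have "2 * m * q * (1 / (1 - (1 + q) / 2)) = 4 * m * q / (1 - q)" using q by (simp add: field_simps)
      also have "\<dots> \<le> 1" 
      proof -
        have "(4 * m + 2) * q = 1" using assms by (simp add: q_def)
        then have "4 * m * q \<le> 1 - q" using q by (simp add: algebra_simps)
        then show ?thesis using q by simp
      qed
      finally show ?thesis by simp
    qed
    finally show ?thesis .
  qed
  moreover have "4 / c > 0" using c by simp
  ultimately show ?thesis using that by blast
qed

section \<open>Square integrable functions\<close>

lemma L2_measurable: "w \<in> L2 \<Omega> \<Longrightarrow> w \<in> borel_measurable (lebesgue_on \<Omega>)"
  by (simp add: L2_def)

lemma L2_mult_integrable: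
  assumes "w \<in> L2 \<Omega>" "v \<in> L2 \<Omega>"
  shows "integrable (lebesgue_on \<Omega>) (\<lambda>x. w x * v x)"
proof (rule Bochner_Integration.integrable_bound)
  show "integrable (lebesgue_on \<Omega>) (\<lambda>x. (w x)\<^sup>2 + (v x)\<^sup>2)"
    using assms by (simp add: L2_def)
  show "(\<lambda>x. w x * v x) \<in> borel_measurable (lebesgue_on \<Omega>)"
    using assms by (auto simp: L2_def)
  have "norm (a * b) \<le> norm (a\<^sup>2 + b\<^sup>2)" for a b :: real
    unfolding real_norm_def abs_of_nonneg[OF sum_power2_ge_zero] by (rule abs_mult_le_sum_sq)
  then show "AE x in lebesgue_on \<Omega>. norm (w x * v x) \<le> norm ((w x)\<^sup>2 + (v x)\<^sup>2)" by simp
qed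

lemma L2_zero: "(\<lambda>x. 0) \<in> L2 \<Omega>"
  by (simp add: L2_def)

lemma L2_add:
  assumes "w \<in> L2 \<Omega>" "v \<in> L2 \<Omega>"
  shows "(\<lambda>x. w x + v x) \<in> L2 \<Omega>"
  using assms L2_mult_integrable[OF assms] by (auto simp: L2_def power2_sum mult.assoc)

lemma L2_scale: "w \<in> L2 \<Omega> \<Longrightarrow> (\<lambda>x. c * w x) \<in> L2 \<Omega>"
  by (auto simp: L2_def power_mult_distrib)

lemma L2_diff:
  assumes "w \<in> L2 \<Omega>" "v \<in> L2 \<Omega>"
  shows "(\<lambda>x. w x - v x) \<in> L2 \<Omega>"
  using L2_add[OF assms(1) L2_scale[OF assms(2), of "-1"]] by simp

lemma L2_sum: "(\<And>k. k \<in> A \<Longrightarrow> f k \<in> L2 \<Omega>) \<Longrightarrow> (\<lambda>x. \<Sum>k\<in>A. f k x) \<in> L2 \<Omega>"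
  by (induction A rule: infinite_finite_induct) (auto intro!: L2_zero L2_add)

lemma L2_inner_commute: "L2_inner \<Omega> w v = L2_inner \<Omega> v w"
  by (simp add: L2_inner_def mult.commute)

lemma L2_inner_add:
  assumes "w \<in> L2 \<Omega>" "w' \<in> L2 \<Omega>" "v \<in> L2 \<Omega>"
  shows "L2_inner \<Omega> (\<lambda>x. w x + w' x) v = L2_inner \<Omega> w v + L2_inner \<Omega> w' v"
  unfolding L2_inner_def distrib_right
  by (intro Bochner_Integration.integral_add L2_mult_integrable assms)

lemma L2_inner_scale: "L2_inner \<Omega> (\<lambda>x. c * w x) v = c * L2_inner \<Omega> w v"
  by (simp add: L2_inner_def mult.assoc)

lemma L2_inner_diff:
  assumes "w \<in> L2 \<Omega>" "w' \<in> L2 \<Omega>" "v \<in> L2 \<Omega>"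
  shows "L2_inner \<Omega> (\<lambda>x. w x - w' x) v = L2_inner \<Omega> w v - L2_inner \<Omega> w' v"
  unfolding L2_inner_def left_diff_distrib
  by (intro Bochner_Integration.integral_diff L2_mult_integrable assms)

lemma L2_inner_sum:
  assumes "\<And>k. k \<in> A \<Longrightarrow> f k \<in> L2 \<Omega>" "v \<in> L2 \<Omega>"
  shows "L2_inner \<Omega> (\<lambda>x. \<Sum>k\<in>A. f k x) v = (\<Sum>k\<in>A. L2_inner \<Omega> (f k) v)"
  unfolding L2_inner_def sum_distrib_right
  by (intro Bochner_Integration.integral_sum L2_mult_integrable assms)

lemma L2_inner_self_nonneg: "0 \<le> L2_inner \<Omega> w w"
  unfolding L2_inner_def by (intro Bochner_Integration.integral_nonneg) simp

lemma L2_norm_nonneg: "0 \<le> L2_norm \<Omega> w"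
  by (simp add: L2_norm_def L2_inner_self_nonneg)

lemma L2_norm_sq: "(L2_norm \<Omega> w)\<^sup>2 = L2_inner \<Omega> w w"
  by (simp add: L2_norm_def L2_inner_self_nonneg)

lemma L2_norm_sq_integral: "(L2_norm \<Omega> w)\<^sup>2 = (LINT x|lebesgue_on \<Omega>. (w x)\<^sup>2)"
  unfolding L2_norm_sq L2_inner_def by (simp add: power2_eq_square)

lemma L2_norm_sq_nn_integral:
  assumes "w \<in> L2 \<Omega>"
  shows "(\<integral>\<^sup>+x. ennreal ((w x)\<^sup>2) \<partial>lebesgue_on \<Omega>) = ennreal ((L2_norm \<Omega> w)\<^sup>2)"
  using assms by (simp add: L2_norm_sq_integral L2_def nn_integral_eq_integral)

lemma L2_norm_zero_iff:
  assumes "w \<in> L2 \<Omega>"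
  shows "L2_norm \<Omega> w = 0 \<longleftrightarrow> (AE x in lebesgue_on \<Omega>. w x = 0)"
proof -
  have "L2_norm \<Omega> w = 0 \<longleftrightarrow> (LINT x|lebesgue_on \<Omega>. (w x)\<^sup>2) = 0"
    by (metis L2_norm_sq_integral zero_eq_power2)
  also have "\<dots> \<longleftrightarrow> (AE x in lebesgue_on \<Omega>. (w x)\<^sup>2 = 0)"
    using assms by (intro integral_nonneg_eq_0_iff_AE) (auto simp: L2_def)
  finally show ?thesis by simp
qed

lemma L2_norm_scale: "L2_norm \<Omega> (\<lambda>x. c * w x) = \<bar>c\<bar> * L2_norm \<Omega> w"
proof -
  have "L2_inner \<Omega> (\<lambda>x. c * w x) (\<lambda>x. c * w x) = (LINT x|lebesgue_on \<Omega>. c\<^sup>2 * (w x * w x))"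
    unfolding L2_inner_def by (simp add: power2_eq_square mult_ac)
  also have "\<dots> = c\<^sup>2 * L2_inner \<Omega> w w" unfolding L2_inner_def by (rule integral_mult_right_zero)
  finally show ?thesis by (simp add: L2_norm_def real_sqrt_mult)
qed

lemma L2_norm_minus_commute: "L2_norm \<Omega> (\<lambda>x. w x - v x) = L2_norm \<Omega> (\<lambda>x. v x - w x)"
  using L2_norm_scale[of \<Omega> "-1" "\<lambda>x. w x - v x"] by simp

lemma L2_norm_sq_add:
  assumes "w \<in> L2 \<Omega>" "v \<in> L2 \<Omega>"
  shows "(L2_norm \<Omega> (\<lambda>x. w x + v x))\<^sup>2 = (L2_norm \<Omega> w)\<^sup>2 + 2 * L2_inner \<Omega> w v + (L2_norm \<Omega> v)\<^sup>2"
proof -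
  have "L2_inner \<Omega> (\<lambda>x. w x + v x) (\<lambda>x. w x + v x) = L2_inner \<Omega> w (\<lambda>x. w x + v x) + L2_inner \<Omega> v (\<lambda>x. w x + v x)"
    by (intro L2_inner_add L2_add assms)
  also have "\<dots> = L2_inner \<Omega> (\<lambda>x. w x + v x) w + L2_inner \<Omega> (\<lambda>x. w x + v x) v"
    by (simp only: L2_inner_commute)
  also have "\<dots> = (L2_inner \<Omega> w w + L2_inner \<Omega> v w) + (L2_inner \<Omega> w v + L2_inner \<Omega> v v)"
    by (intro arg_cong2[where f="(+)"] L2_inner_add assms)
  finally show ?thesis by (simp add: L2_norm_sq L2_inner_commute[of \<Omega> v w])
qed

lemma L2_Cauchy_Schwarz:
  assumes "w \<in> L2 \<Omega>" "v \<in> L2 \<Omega>"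
  shows "\<bar>L2_inner \<Omega> w v\<bar> \<le> L2_norm \<Omega> w * L2_norm \<Omega> v"
proof -
  have *: "- L2_inner \<Omega> w v \<le> L2_norm \<Omega> w * L2_norm \<Omega> v" if w: "w \<in> L2 \<Omega>" for w
  proof (cases "L2_norm \<Omega> w = 0 \<or> L2_norm \<Omega> v = 0")
    case True
    then have "AE x in lebesgue_on \<Omega>. w x * v x = 0"
      using L2_norm_zero_iff[OF w] L2_norm_zero_iff[OF assms(2)] by (auto elim: eventually_mono)
    then have "L2_inner \<Omega> w v = 0" unfolding L2_inner_def by (rule integral_eq_zero_AE)
    then show ?thesis by (simp add: L2_norm_nonneg)
  next
    case False
    define a where "a = L2_norm \<Omega> w"
    define b where "b = L2_norm \<Omega> v"
    have ab: "a > 0" "b > 0" using False L2_norm_nonneg[of \<Omega> w] L2_norm_nonneg[of \<Omega> v] by (auto simp: a_def b_def)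
    have "0 \<le> (L2_norm \<Omega> (\<lambda>x. b * w x + a * v x))\<^sup>2" by simp
    also have "\<dots> = (b * a)\<^sup>2 + 2 * (a * b * L2_inner \<Omega> w v) + (a * b)\<^sup>2"
      using ab by (simp add: L2_norm_sq_add L2_scale w assms L2_norm_scale a_def[symmetric] b_def[symmetric]
          L2_inner_scale L2_inner_commute[of \<Omega> w "\<lambda>x. a * v x"] L2_inner_commute[of \<Omega> v w])
    finally have "0 \<le> (2 * (a * b)) * (a * b + L2_inner \<Omega> w v)" 
      by (simp add: power2_eq_square algebra_simps)
    then have "0 \<le> a * b + L2_inner \<Omega> w v" using ab mult_le_cancel_left_pos[of "2 * (a * b)" 0 "a * b + L2_inner \<Omega> w v"] by simp
    then show ?thesis by (simp add: a_def b_def)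
  qed
  have "- L2_inner \<Omega> (\<lambda>x. (-1) * w x) v \<le> L2_norm \<Omega> (\<lambda>x. (-1) * w x) * L2_norm \<Omega> v"
    by (rule *) (rule L2_scale[OF assms(1)])
  then show ?thesis using *[OF assms(1)] unfolding L2_inner_scale L2_norm_scale by simp
qed

lemma L2_norm_triangle:
  assumes "w \<in> L2 \<Omega>" "v \<in> L2 \<Omega>"
  shows "L2_norm \<Omega> (\<lambda>x. w x + v x) \<le> L2_norm \<Omega> w + L2_norm \<Omega> v"
proof (rule power2_le_imp_le)
  show "(L2_norm \<Omega> (\<lambda>x. w x + v x))\<^sup>2 \<le> (L2_norm \<Omega> w + L2_norm \<Omega> v)\<^sup>2"
    using L2_Cauchy_Schwarz[OF assms] by (simp add: L2_norm_sq_add[OF assms] power2_sum)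
qed (simp add: L2_norm_nonneg)

lemma L2_norm_triangle_diff:
  assumes "u \<in> L2 \<Omega>" "v \<in> L2 \<Omega>" "w \<in> L2 \<Omega>"
  shows "L2_norm \<Omega> (\<lambda>x. u x - w x) \<le> L2_norm \<Omega> (\<lambda>x. u x - v x) + L2_norm \<Omega> (\<lambda>x. v x - w x)"
  using L2_norm_triangle[OF L2_diff[OF assms(1,2)] L2_diff[OF assms(2,3)]] by simp

lemma L2_norm_reverse_triangle:
  assumes "u \<in> L2 \<Omega>" "v \<in> L2 \<Omega>"
  shows "\<bar>L2_norm \<Omega> u - L2_norm \<Omega> v\<bar> \<le> L2_norm \<Omega> (\<lambda>x. u x - v x)"
  using L2_norm_triangle_diff[OF assms L2_zero] L2_norm_triangle_diff[OF assms(2,1) L2_zero]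
    L2_norm_minus_commute[of \<Omega> u v] unfolding diff_0_right by linarith

lemma L2_inner_tendsto:
  assumes "\<And>n. f n \<in> L2 \<Omega>" "v \<in> L2 \<Omega>" "(\<lambda>n. L2_norm \<Omega> (\<lambda>x. f n x - v x)) \<longlonglongrightarrow> 0" "w \<in> L2 \<Omega>"
  shows "(\<lambda>n. L2_inner \<Omega> (f n) w) \<longlonglongrightarrow> L2_inner \<Omega> v w"
proof (rule LIM_zero_cancel, rule Lim_null_comparison)
  show "\<forall>\<^sub>F n in sequentially. norm (L2_inner \<Omega> (f n) w - L2_inner \<Omega> v w) \<le> L2_norm \<Omega> (\<lambda>x. f n x - v x) * L2_norm \<Omega> w"
    using L2_Cauchy_Schwarz[OF L2_diff[OF assms(1,2)] assms(4)]
    by (simp add: L2_inner_diff assms)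
  show "(\<lambda>n. L2_norm \<Omega> (\<lambda>x. f n x - v x) * L2_norm \<Omega> w) \<longlonglongrightarrow> 0"
    using tendsto_mult_left_zero[OF assms(3)] by simp
qed

lemma L2_of_nn_integral_le:
  assumes "w \<in> borel_measurable (lebesgue_on \<Omega>)" "(\<integral>\<^sup>+x. ennreal ((w x)\<^sup>2) \<partial>lebesgue_on \<Omega>) \<le> ennreal (c\<^sup>2)" "0 \<le> c"
  shows "w \<in> L2 \<Omega>" "L2_norm \<Omega> w \<le> c"
proof -
  have "integrable (lebesgue_on \<Omega>) (\<lambda>x. (w x)\<^sup>2)"
    using assms(1) le_less_trans[OF assms(2)] by (intro integrableI_bounded) auto
  then show w: "w \<in> L2 \<Omega>" using assms(1) by (simp add: L2_def)
  have "ennreal ((L2_norm \<Omega> w)\<^sup>2) \<le> ennreal (c\<^sup>2)"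
    using assms(2) by (simp add: L2_norm_sq_nn_integral[OF w])
  then show "L2_norm \<Omega> w \<le> c" using assms(3) by (simp add: power2_le_iff_abs_le L2_norm_nonneg)
qed

text \<open>Riesz-Fischer for raw functions: a subsequence with geometric gaps converges almost
  everywhere, and Fatou's lemma transfers the Cauchy estimate to its limit.\<close>

lemma L2_complete:
  assumes \<Omega>: "\<Omega> \<in> lmeasurable" and f: "\<And>n. f n \<in> L2 \<Omega>"
    and C: "\<And>e. e > 0 \<Longrightarrow> \<exists>N. \<forall>m\<ge>N. \<forall>n\<ge>N. L2_norm \<Omega> (\<lambda>x. f m x - f n x) < e"
  shows "\<exists>v \<in> L2 \<Omega>. (\<lambda>n. L2_norm \<Omega> (\<lambda>x. f n x - v x)) \<longlonglongrightarrow> 0"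
proof -
  have [measurable]: "f n \<in> borel_measurable (lebesgue_on \<Omega>)" for n by (rule L2_measurable[OF f])
  have one: "(\<lambda>x. 1) \<in> L2 \<Omega>" 
    using finite_measure.integrable_const[OF finite_measure_lebesgue_on[OF \<Omega>], of "1::real"]
    by (simp add: L2_def)
  have "\<forall>k. \<exists>N. \<forall>m\<ge>N. \<forall>n\<ge>N. L2_norm \<Omega> (\<lambda>x. f m x - f n x) < (1/2) ^ k"
    by (intro allI C) simp
  from choice[OF this] obtain N
    where N: "\<And>k m n. m \<ge> N k \<Longrightarrow> n \<ge> N k \<Longrightarrow> L2_norm \<Omega> (\<lambda>x. f m x - f n x) < (1/2) ^ k"
    by blast
  \<comment> \<open>A sum of the thresholds exceeds each \<open>N j\<close> with j <= k, so the
    chosen indices stay beyond every threshold reached so far.\<close>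
  define r where "r k = (\<Sum>j\<le>k. N j)" for k
  have r: "r k \<ge> N k" "r (Suc k) \<ge> r k" for k unfolding r_def by (auto intro: member_le_sum)
  have rk: "r k \<ge> N j" if "j \<le> k" for j k
    unfolding r_def using that by (intro member_le_sum) auto
  \<comment> \<open>Cauchy-Schwarz against the constant 1, which is square integrable because
    \<Omega> has finite measure, turns L^2 gaps into summable L^1 gaps.\<close>
  have g: "(\<integral>\<^sup>+x. ennreal \<bar>f (r (Suc k)) x - f (r k) x\<bar> \<partial>lebesgue_on \<Omega>) \<le> ennreal (L2_norm \<Omega> (\<lambda>x. 1) * (1/2) ^ k)" for k
  proof -
    have d: "(\<lambda>x. f (r (Suc k)) x - f (r k) x) \<in> L2 \<Omega>" by (intro L2_diff f)
    have a: "(\<lambda>x. \<bar>f (r (Suc k)) x - f (r k) x\<bar>) \<in> L2 \<Omega>"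
      using d by (auto simp: L2_def)
    have an: "L2_norm \<Omega> (\<lambda>x. \<bar>f (r (Suc k)) x - f (r k) x\<bar>) = L2_norm \<Omega> (\<lambda>x. f (r (Suc k)) x - f (r k) x)"
      by (simp add: L2_norm_def L2_inner_def)
    have "(\<integral>\<^sup>+x. ennreal \<bar>f (r (Suc k)) x - f (r k) x\<bar> \<partial>lebesgue_on \<Omega>) = ennreal (L2_inner \<Omega> (\<lambda>x. \<bar>f (r (Suc k)) x - f (r k) x\<bar>) (\<lambda>x. 1))"
      unfolding L2_inner_def using L2_mult_integrable[OF a one] by (subst nn_integral_eq_integral) auto
    also have "\<dots> \<le> ennreal (L2_norm \<Omega> (\<lambda>x. \<bar>f (r (Suc k)) x - f (r k) x\<bar>) * L2_norm \<Omega> (\<lambda>x. 1))"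
      using L2_Cauchy_Schwarz[OF a one] by (intro ennreal_leI) simp
    also have "\<dots> \<le> ennreal ((1/2) ^ k * L2_norm \<Omega> (\<lambda>x. 1))"
      unfolding an using less_imp_le[OF N[of k "r (Suc k)" "r k"]] rk[of k "Suc k"] rk[of k k]
      by (intro ennreal_leI mult_right_mono L2_norm_nonneg) auto
    finally show ?thesis by (simp add: mult.commute)
  qed
  have "(\<integral>\<^sup>+x. (\<Sum>k. ennreal \<bar>f (r (Suc k)) x - f (r k) x\<bar>) \<partial>lebesgue_on \<Omega>) = 
     (\<Sum>k. \<integral>\<^sup>+x. ennreal \<bar>f (r (Suc k)) x - f (r k) x\<bar> \<partial>lebesgue_on \<Omega>)"
    by (rule nn_integral_suminf) measurable
  also have "\<dots> \<le> (\<Sum>k. ennreal (L2_norm \<Omega> (\<lambda>x. 1) * (1/2) ^ k))"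
    by (intro suminf_le g) auto
  also have "\<dots> = ennreal (L2_norm \<Omega> (\<lambda>x. 1) * (1 / (1 - 1/2)))"
    by (intro suminf_ennreal_eq sums_mult geometric_sums) (auto simp: L2_norm_nonneg)
  also have "\<dots> < \<infinity>" by simp
  finally have "AE x in lebesgue_on \<Omega>. (\<Sum>k. ennreal \<bar>f (r (Suc k)) x - f (r k) x\<bar>) \<noteq> \<infinity>"
    by (intro nn_integral_PInf_AE) auto
  then have conv: "AE x in lebesgue_on \<Omega>. convergent (\<lambda>k. f (r k) x)"
  proof eventually_elim
    case (elim x)
    then have "summable (\<lambda>k. \<bar>f (r (Suc k)) x - f (r k) x\<bar>)"
      by (intro summable_suminf_not_top) auto
    then have "summable (\<lambda>k. f (r (Suc k)) x - f (r k) x)" by (rule summable_rabs_cancel)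
    then have "convergent (\<lambda>n. \<Sum>k<n. f (r (Suc k)) x - f (r k) x)" by (simp add: summable_iff_convergent)
    then obtain L where "(\<lambda>n. \<Sum>k<n. f (r (Suc k)) x - f (r k) x) \<longlonglongrightarrow> L" by (auto simp: convergent_def)
    then have "(\<lambda>n. f (r n) x - f (r 0) x) \<longlonglongrightarrow> L" by (simp only: sum_lessThan_telescope[of "\<lambda>k. f (r k) x"])
    from tendsto_add[OF this tendsto_const[of "f (r 0) x"]]
    have "(\<lambda>n. f (r n) x) \<longlonglongrightarrow> L + f (r 0) x" by (simp only: diff_add_cancel)
    then show ?case by (rule convergentI)
  qed
  define v where "v x = lim (\<lambda>k. f (r k) x)" for x
  have [measurable]: "v \<in> borel_measurable (lebesgue_on \<Omega>)" unfolding v_def by (rule borel_measurable_lim_metric) measurable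
  have est: "(\<lambda>x. f m x - v x) \<in> L2 \<Omega> \<and> L2_norm \<Omega> (\<lambda>x. f m x - v x) \<le> (1/2) ^ k" if "m \<ge> N k" for m k
  proof -
    \<comment> \<open>Almost everywhere the limit inferior is an honest limit along the subsequence;
      Fatou then applies to the squares.\<close>
    have "(\<integral>\<^sup>+x. ennreal ((f m x - v x)\<^sup>2) \<partial>lebesgue_on \<Omega>) = (\<integral>\<^sup>+x. liminf (\<lambda>j. ennreal ((f m x - f (r j) x)\<^sup>2)) \<partial>lebesgue_on \<Omega>)"
      using conv
    proof (intro nn_integral_cong_AE, eventually_elim)
      case (elim x)
      then have "(\<lambda>j. f (r j) x) \<longlonglongrightarrow> v x" unfolding v_def by (simp add: convergent_LIMSEQ_iff)
      then have "(\<lambda>j. ennreal ((f m x - f (r j) x)\<^sup>2)) \<longlonglongrightarrow> ennreal ((f m x - v x)\<^sup>2)"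
        by (intro tendsto_intros)
      from lim_imp_Liminf[OF _ this] show ?case by simp
    qed
    also have "\<dots> \<le> liminf (\<lambda>j. \<integral>\<^sup>+x. ennreal ((f m x - f (r j) x)\<^sup>2) \<partial>lebesgue_on \<Omega>)"
      by (rule nn_integral_liminf) measurable
    also have "\<dots> \<le> ennreal (((1/2) ^ k)\<^sup>2)"
    proof (rule Liminf_le)
      show "\<forall>\<^sub>F j in sequentially. (\<integral>\<^sup>+x. ennreal ((f m x - f (r j) x)\<^sup>2) \<partial>lebesgue_on \<Omega>) \<le> ennreal (((1/2) ^ k)\<^sup>2)"
        unfolding eventually_sequentially
      proof (intro exI allI impI)
        fix j assume "j \<ge> k"
        then show "(\<integral>\<^sup>+x. ennreal ((f m x - f (r j) x)\<^sup>2) \<partial>lebesgue_on \<Omega>) \<le> ennreal (((1/2) ^ k)\<^sup>2)"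
          using N[OF that rk[OF \<open>j \<ge> k\<close>]]
          by (subst L2_norm_sq_nn_integral) (auto intro!: L2_diff f ennreal_leI power_mono L2_norm_nonneg)
      qed
    qed simp
    finally show ?thesis using L2_of_nn_integral_le[of "\<lambda>x. f m x - v x" \<Omega> "(1/2) ^ k"] by simp
  qed
  have "v \<in> L2 \<Omega>" using L2_diff[OF f[of "N 0"] conjunct1[OF est[of 0 "N 0"]]] by simp
  moreover have "(\<lambda>n. L2_norm \<Omega> (\<lambda>x. f n x - v x)) \<longlonglongrightarrow> 0"
  proof (rule LIMSEQ_I)
    fix e :: real assume "e > 0"
    then obtain k where "(1/2) ^ k < e" using real_arch_pow_inv[of e "1/2"] by auto
    then have "norm (L2_norm \<Omega> (\<lambda>x. f n x - v x) - 0) < e" if "n \<ge> N k" for n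
      using est[OF that] L2_norm_nonneg[of \<Omega> "\<lambda>x. f n x - v x"] by simp
    then show "\<exists>no. \<forall>n\<ge>no. norm (L2_norm \<Omega> (\<lambda>x. f n x - v x) - 0) < e" by blast
  qed
  ultimately show ?thesis by blast
qed

section \<open>Coordinates with respect to an orthonormal basis\<close>

definition L2_coord :: "(real^2) set \<Rightarrow> (nat \<Rightarrow> real^2 \<Rightarrow> real) \<Rightarrow> (real^2 \<Rightarrow> real) \<Rightarrow> ell2" where
  "L2_coord \<Omega> \<phi> w = Abs_ell2 (\<lambda>k. L2_inner \<Omega> w (\<phi> k))"

text \<open>It uses the same choice \<open>L2_suminf\<close> and the same shape of series as
  \<open>S_op\<close> and \<open>R_op\<close>, so that \<open>S_op_eq\<close> and
  \<open>R_op_eq\<close> are equalities of functions and not merely almost everywhere.\<close>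

definition L2_of :: "(real^2) set \<Rightarrow> (nat \<Rightarrow> real^2 \<Rightarrow> real) \<Rightarrow> ell2 \<Rightarrow> real^2 \<Rightarrow> real" where
  "L2_of \<Omega> \<phi> y = L2_suminf \<Omega> (\<lambda>k x. coord y k * \<phi> k x)"

context
  fixes \<Omega> :: "(real^2) set" and \<phi> :: "nat \<Rightarrow> real^2 \<Rightarrow> real"
  assumes basis: "complete_orthonormal \<Omega> \<phi>" and Omega: "\<Omega> \<in> lmeasurable"
begin

lemma basis_L2: "\<phi> k \<in> L2 \<Omega>"
  using basis by (simp add: complete_orthonormal_def)

lemma basis_orthonormal: "L2_inner \<Omega> (\<phi> j) (\<phi> k) = (if j = k then 1 else 0)"
  using basis by (simp add: complete_orthonormal_def)

lemma partial_sum_L2: "(\<lambda>x. \<Sum>k<n. c k * \<phi> k x) \<in> L2 \<Omega>"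
  by (intro L2_sum L2_scale basis_L2)

lemma L2_inner_partial_sum:
  assumes "v \<in> L2 \<Omega>"
  shows "L2_inner \<Omega> (\<lambda>x. \<Sum>k<n. c k * \<phi> k x) v = (\<Sum>k<n. c k * L2_inner \<Omega> v (\<phi> k))"
  using assms
  by (subst L2_inner_sum) (auto intro: L2_scale basis_L2 simp: L2_inner_scale L2_inner_commute[of \<Omega> "\<phi> _" v])

lemma L2_inner_partial_sum_basis:
  "L2_inner \<Omega> (\<lambda>x. \<Sum>k<n. c k * \<phi> k x) (\<phi> j) = (if j < n then c j else 0)"
proof -
  have "L2_inner \<Omega> (\<lambda>x. \<Sum>k<n. c k * \<phi> k x) (\<phi> j) = (\<Sum>k<n. if k = j then c j else 0)"
    unfolding L2_inner_partial_sum[OF basis_L2] basis_orthonormal by (intro sum.cong) auto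
  then show ?thesis by simp
qed

lemma L2_norm_sq_diff_partial_sum:
  assumes "w \<in> L2 \<Omega>"
  shows "(L2_norm \<Omega> (\<lambda>x. (\<Sum>k<n. c k * \<phi> k x) - w x))\<^sup>2 =
    (L2_norm \<Omega> w)\<^sup>2 - 2 * (\<Sum>k<n. c k * L2_inner \<Omega> w (\<phi> k)) + (\<Sum>k<n. (c k)\<^sup>2)"
proof -
  let ?s = "\<lambda>x. \<Sum>k<n. c k * \<phi> k x"
  have "(L2_norm \<Omega> (\<lambda>x. ?s x + (- 1) * w x))\<^sup>2 =
     (L2_norm \<Omega> ?s)\<^sup>2 + 2 * L2_inner \<Omega> ?s (\<lambda>x. (- 1) * w x) + (L2_norm \<Omega> (\<lambda>x. (- 1) * w x))\<^sup>2"
    by (intro L2_norm_sq_add partial_sum_L2 L2_scale assms)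
  also have "L2_inner \<Omega> ?s (\<lambda>x. (- 1) * w x) = - (\<Sum>k<n. c k * L2_inner \<Omega> w (\<phi> k))"
  proof -
    have "L2_inner \<Omega> ?s (\<lambda>x. (- 1) * w x) = L2_inner \<Omega> (\<lambda>x. (- 1) * w x) ?s" by (rule L2_inner_commute)
    also have "\<dots> = (- 1) * L2_inner \<Omega> w ?s" by (rule L2_inner_scale)
    also have "L2_inner \<Omega> w ?s = L2_inner \<Omega> ?s w" by (rule L2_inner_commute)
    also have "L2_inner \<Omega> ?s w = (\<Sum>k<n. c k * L2_inner \<Omega> w (\<phi> k))" by (rule L2_inner_partial_sum[OF assms])
    finally show ?thesis by simp
  qed
  also have "(L2_norm \<Omega> ?s)\<^sup>2 = (\<Sum>k<n. (c k)\<^sup>2)"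
    unfolding L2_norm_sq L2_inner_partial_sum[OF partial_sum_L2] L2_inner_partial_sum_basis
    by (simp add: power2_eq_square)
  also have "(L2_norm \<Omega> (\<lambda>x. (- 1) * w x))\<^sup>2 = (L2_norm \<Omega> w)\<^sup>2" unfolding L2_norm_scale by simp
  finally show ?thesis by simp
qed

lemma parseval:
  assumes "w \<in> L2 \<Omega>"
  shows "(\<lambda>k. (L2_inner \<Omega> w (\<phi> k))\<^sup>2) sums (L2_norm \<Omega> w)\<^sup>2"
proof -
  have "(\<lambda>n. L2_norm \<Omega> (\<lambda>x. (\<Sum>k<n. L2_inner \<Omega> w (\<phi> k) * \<phi> k x) - w x)) \<longlonglongrightarrow> 0"
    using basis assms by (simp add: complete_orthonormal_def L2_sums_def)
  from tendsto_diff[OF tendsto_const[of "(L2_norm \<Omega> w)\<^sup>2"] tendsto_power[OF this, of 2]]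
  have "(\<lambda>n. \<Sum>k<n. (L2_inner \<Omega> w (\<phi> k))\<^sup>2) \<longlonglongrightarrow> (L2_norm \<Omega> w)\<^sup>2"
    unfolding L2_norm_sq_diff_partial_sum[OF assms] by (simp add: power2_eq_square)
  then show ?thesis by (simp add: sums_def)
qed

lemma coord_L2_coord: "w \<in> L2 \<Omega> \<Longrightarrow> coord (L2_coord \<Omega> \<phi> w) k = L2_inner \<Omega> w (\<phi> k)"
  unfolding L2_coord_def by (rule coord_Abs) (rule sums_summable[OF parseval])

lemma norm_L2_coord:
  assumes "w \<in> L2 \<Omega>"
  shows "norm (L2_coord \<Omega> \<phi> w) = L2_norm \<Omega> w"
proof -
  have "(norm (L2_coord \<Omega> \<phi> w))\<^sup>2 = (L2_norm \<Omega> w)\<^sup>2"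
    using sums_unique[OF parseval[OF assms]] by (simp add: norm_ell2_sq coord_L2_coord[OF assms])
  then show ?thesis by (simp add: L2_norm_nonneg)
qed

lemma L2_coord_diff:
  assumes "w \<in> L2 \<Omega>" "v \<in> L2 \<Omega>"
  shows "L2_coord \<Omega> \<phi> (\<lambda>x. w x - v x) = L2_coord \<Omega> \<phi> w - L2_coord \<Omega> \<phi> v"
  by (rule ell2_eqI) (simp add: coord_L2_coord L2_diff L2_inner_diff assms basis_L2)

lemma L2_coord_scale: "w \<in> L2 \<Omega> \<Longrightarrow> L2_coord \<Omega> \<phi> (\<lambda>x. c * w x) = c *\<^sub>R L2_coord \<Omega> \<phi> w"
  by (rule ell2_eqI) (simp add: coord_L2_coord L2_scale L2_inner_scale)

lemma L2_coord_sum: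
  "(\<And>k. k \<in> A \<Longrightarrow> f k \<in> L2 \<Omega>) \<Longrightarrow> L2_coord \<Omega> \<phi> (\<lambda>x. \<Sum>k\<in>A. f k x) = (\<Sum>k\<in>A. L2_coord \<Omega> \<phi> (f k))"
  by (rule ell2_eqI) (simp add: coord_sum coord_L2_coord L2_sum L2_inner_sum basis_L2)

lemma L2_coord_eq_iff:
  assumes "w \<in> L2 \<Omega>" "v \<in> L2 \<Omega>"
  shows "L2_coord \<Omega> \<phi> w = L2_coord \<Omega> \<phi> v \<longleftrightarrow> (AE x in lebesgue_on \<Omega>. w x = v x)"
proof -
  have "L2_coord \<Omega> \<phi> w = L2_coord \<Omega> \<phi> v \<longleftrightarrow> norm (L2_coord \<Omega> \<phi> (\<lambda>x. w x - v x)) = 0"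
    by (simp add: L2_coord_diff assms)
  also have "\<dots> \<longleftrightarrow> (AE x in lebesgue_on \<Omega>. w x - v x = 0)"
    by (simp add: norm_L2_coord L2_diff assms L2_norm_zero_iff)
  finally show ?thesis by simp
qed

text \<open>Partial sums have truncations as coordinates, so they are Cauchy, and completeness
  supplies a witness for the choice behind \<open>L2_suminf\<close>.\<close>

lemma L2_sums_L2_of: "L2_sums \<Omega> (\<lambda>k x. coord y k * \<phi> k x) (L2_of \<Omega> \<phi> y)"
proof -
  let ?s = "\<lambda>n x. \<Sum>k<n. coord y k * \<phi> k x"
  have c: "L2_coord \<Omega> \<phi> (?s n) = ell2_trunc n y" for n
    by (rule ell2_eqI) (simp add: coord_L2_coord partial_sum_L2 L2_inner_partial_sum_basis)
  have "\<exists>v \<in> L2 \<Omega>. (\<lambda>n. L2_norm \<Omega> (\<lambda>x. ?s n x - v x)) \<longlonglongrightarrow> 0"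
  proof (rule L2_complete[OF Omega])
    show "?s n \<in> L2 \<Omega>" for n by (rule partial_sum_L2)
    fix e :: real assume "e > 0"
    have "L2_norm \<Omega> (\<lambda>x. ?s m x - ?s n x) = norm (ell2_trunc m y - ell2_trunc n y)" for m n
      by (simp add: norm_L2_coord[symmetric] L2_diff partial_sum_L2 L2_coord_diff c)
    then show "\<exists>N. \<forall>m\<ge>N. \<forall>n\<ge>N. L2_norm \<Omega> (\<lambda>x. ?s m x - ?s n x) < e"
      using LIMSEQ_imp_Cauchy[OF ell2_trunc_tendsto[of y]] \<open>e > 0\<close> by (simp add: Cauchy_def dist_norm)
  qed
  then have "\<exists>v. L2_sums \<Omega> (\<lambda>k x. coord y k * \<phi> k x) v" by (auto simp: L2_sums_def)
  then show ?thesis unfolding L2_of_def L2_suminf_def by (rule someI_ex)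
qed

lemma L2_of_L2: "L2_of \<Omega> \<phi> y \<in> L2 \<Omega>"
  using L2_sums_L2_of by (simp add: L2_sums_def)

lemma L2_coord_L2_of: "L2_coord \<Omega> \<phi> (L2_of \<Omega> \<phi> y) = y"
proof (rule ell2_eqI)
  fix j
  have lim: "(\<lambda>n. L2_inner \<Omega> (\<lambda>x. \<Sum>k<n. coord y k * \<phi> k x) (\<phi> j)) \<longlonglongrightarrow> L2_inner \<Omega> (L2_of \<Omega> \<phi> y) (\<phi> j)"
    using L2_sums_L2_of[of y] by (intro L2_inner_tendsto partial_sum_L2 basis_L2) (auto simp: L2_sums_def)
  have ev: "\<forall>\<^sub>F n in sequentially. L2_inner \<Omega> (\<lambda>x. \<Sum>k<n. coord y k * \<phi> k x) (\<phi> j) = coord y j"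
    using eventually_gt_at_top[of j] by eventually_elim (simp add: L2_inner_partial_sum_basis)
  have "L2_inner \<Omega> (L2_of \<Omega> \<phi> y) (\<phi> j) = coord y j"
    by (rule LIMSEQ_unique[OF lim tendsto_eventually[OF ev]])
  then show "coord (L2_coord \<Omega> \<phi> (L2_of \<Omega> \<phi> y)) j = coord y j"
    by (simp add: coord_L2_coord L2_of_L2)
qed

lemma L2_of_unique:
  assumes "w \<in> L2 \<Omega>" "L2_coord \<Omega> \<phi> w = y"
  shows "AE x in lebesgue_on \<Omega>. w x = L2_of \<Omega> \<phi> y x"
  using L2_coord_eq_iff[OF assms(1) L2_of_L2[of y]] assms(2) L2_coord_L2_of by simp

lemma L2_of_add: "AE x in lebesgue_on \<Omega>. L2_of \<Omega> \<phi> (y + z) x = L2_of \<Omega> \<phi> y x + L2_of \<Omega> \<phi> z x"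
proof -
  have "AE x in lebesgue_on \<Omega>. L2_of \<Omega> \<phi> y x + L2_of \<Omega> \<phi> z x = L2_of \<Omega> \<phi> (y + z) x"
  proof (rule L2_of_unique)
    show "L2_coord \<Omega> \<phi> (\<lambda>x. L2_of \<Omega> \<phi> y x + L2_of \<Omega> \<phi> z x) = y + z"
      using L2_coord_sum[of "UNIV :: bool set" "\<lambda>b. if b then L2_of \<Omega> \<phi> y else L2_of \<Omega> \<phi> z"]
      by (simp add: L2_of_L2 L2_coord_L2_of UNIV_bool add.commute)
  qed (intro L2_add L2_of_L2)
  then show ?thesis by (auto elim: eventually_mono)
qed

lemma L2_of_diff: "AE x in lebesgue_on \<Omega>. L2_of \<Omega> \<phi> (y - z) x = L2_of \<Omega> \<phi> y x - L2_of \<Omega> \<phi> z x"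
proof -
  have "AE x in lebesgue_on \<Omega>. L2_of \<Omega> \<phi> y x - L2_of \<Omega> \<phi> z x = L2_of \<Omega> \<phi> (y - z) x"
    by (rule L2_of_unique) (auto intro!: L2_diff simp: L2_of_L2 L2_coord_diff L2_coord_L2_of)
  then show ?thesis by (auto elim: eventually_mono)
qed

end

section \<open>The embedding into the Orlicz space\<close>

lemma Ck_add:
  "Ck k f \<Longrightarrow> Ck k g \<Longrightarrow> Ck k (\<lambda>x. f x + g x)"
proof (induction k arbitrary: f g)
  case 0 then show ?case by (auto intro: continuous_intros)
next
  case (Suc k)
  have D: "((\<lambda>x. f x + g x) has_derivative (\<lambda>v. frechet_derivative f (at x) v + frechet_derivative g (at x) v)) (at x)" for x
    using Suc.prems by (intro has_derivative_add) (auto simp: frechet_derivative_works)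
  have "frechet_derivative (\<lambda>x. f x + g x) (at x) v = frechet_derivative f (at x) v + frechet_derivative g (at x) v" for x v
    by (simp add: frechet_derivative_at[OF D, symmetric])
  moreover have "(\<lambda>x. f x + g x) differentiable (at x)" for x using D[of x] unfolding differentiable_def by blast
  ultimately show ?case using Suc by auto
qed

lemma Ck_scale: "Ck k f \<Longrightarrow> Ck k (\<lambda>x. c * f x)"
proof (induction k arbitrary: f)
  case 0 then show ?case by (auto intro: continuous_intros)
next
  case (Suc k)
  have D: "((\<lambda>x. c * f x) has_derivative (\<lambda>v. c * frechet_derivative f (at x) v)) (at x)" for x
    using Suc.prems by (intro has_derivative_mult_right) (auto simp: frechet_derivative_works)
  have "frechet_derivative (\<lambda>x. c * f x) (at x) v = c * frechet_derivative f (at x) v" for x v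
    by (simp add: frechet_derivative_at[OF D, symmetric])
  moreover have "(\<lambda>x. c * f x) differentiable (at x)" for x using D[of x] unfolding differentiable_def by blast
  ultimately show ?case using Suc by auto
qed

lemma Ck_zero: "Ck k (\<lambda>x. 0)"
  by (induction k) auto

lemma test_function_zero: "test_function \<Omega> (\<lambda>x. 0)"
  unfolding test_function_def by (auto intro!: Ck_zero exI[of _ "{}"])

lemma test_function_add:
  assumes "test_function \<Omega> f" "test_function \<Omega> g"
  shows "test_function \<Omega> (\<lambda>x. f x + g x)"
proof -
  obtain K L where "compact K" "K \<subseteq> \<Omega>" "\<And>x. x \<notin> K \<Longrightarrow> f x = 0" "compact L" "L \<subseteq> \<Omega>" "\<And>x. x \<notin> L \<Longrightarrow> g x = 0"
    using assms by (auto simp: test_function_def)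
  then have "compact (K \<union> L) \<and> K \<union> L \<subseteq> \<Omega> \<and> (\<forall>x. x \<notin> K \<union> L \<longrightarrow> f x + g x = 0)" by (auto intro: compact_Un)
  then show ?thesis using assms by (auto simp: test_function_def intro!: Ck_add)
qed

lemma test_function_scale: "test_function \<Omega> f \<Longrightarrow> test_function \<Omega> (\<lambda>x. c * f x)"
  unfolding test_function_def by (metis Ck_scale mult_zero_right)

lemma test_function_sum: "(\<And>k. k \<in> A \<Longrightarrow> test_function \<Omega> (f k)) \<Longrightarrow> test_function \<Omega> (\<lambda>x. \<Sum>k\<in>A. f k x)"
  by (induction A rule: infinite_finite_induct) (auto intro: test_function_zero test_function_add)

lemma test_function_differentiable: "test_function \<Omega> f \<Longrightarrow> f differentiable (at x)"
  using Ck.simps(2)[of 0 f] by (simp add: test_function_def del: Ck.simps)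

lemma partial_deriv_sum_scale:
  assumes "\<And>k. k \<in> A \<Longrightarrow> f k differentiable (at x)" "finite A"
  shows "partial_deriv i (\<lambda>x. \<Sum>k\<in>A. c k * f k x) x = (\<Sum>k\<in>A. c k * partial_deriv i (f k) x)"
proof -
  have "((\<lambda>x. \<Sum>k\<in>A. c k * f k x) has_derivative (\<lambda>v. \<Sum>k\<in>A. c k * frechet_derivative (f k) (at x) v)) (at x)"
    using assms by (intro has_derivative_sum has_derivative_mult_right) (auto simp: frechet_derivative_works)
  then show ?thesis by (simp add: partial_deriv_def frechet_derivative_at[symmetric])
qed

lemma test_function_partial_deriv:
  assumes "test_function \<Omega> f"
  shows "test_function \<Omega> (partial_deriv i f)"
proof -
  obtain K where K: "compact K" "K \<subseteq> \<Omega>" "\<And>x. x \<notin> K \<Longrightarrow> f x = 0"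
    using assms by (auto simp: test_function_def)
  have "partial_deriv i f x = 0" if "x \<notin> K" for x
  proof -
    have "((\<lambda>x. 0) has_derivative (\<lambda>h. 0)) (at x)" by simp
    then have "(f has_derivative (\<lambda>h. 0)) (at x)"
      by (rule has_derivative_transform_within_open[of _ _ _ _ "- K"]) (use K that in \<open>auto simp: compact_imp_closed\<close>)
    then show ?thesis by (simp add: partial_deriv_def frechet_derivative_at[symmetric])
  qed
  moreover have "Ck k (partial_deriv i f)" for k
  proof -
    have "Ck (Suc k) f" using assms by (simp only: test_function_def)
    then show ?thesis by (simp add: partial_deriv_def[abs_def])
  qed
  ultimately show ?thesis using K by (auto simp: test_function_def)
qed

lemma test_function_continuous: "test_function \<Omega> f \<Longrightarrow> continuous_on UNIV f"
  using Ck.simps(1)[of f] by (simp add: test_function_def del: Ck.simps)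

lemma test_function_C1_compact:
  assumes "test_function \<Omega> f"
  shows "C1_compact f"
proof -
  obtain K where K: "compact K" "\<And>x. x \<notin> K \<Longrightarrow> f x = 0"
    using assms by (auto simp: test_function_def)
  obtain R where R: "\<And>x. x \<in> K \<Longrightarrow> norm x \<le> R" using compact_imp_bounded[OF K(1)] by (auto simp: bounded_iff)
  have "f x = 0" if "R + 1 \<le> norm x" for x
    using K(2)[of x] R[of x] that by fastforce
  then show ?thesis unfolding C1_compact_def
    using test_function_differentiable[OF assms] test_function_continuous[OF test_function_partial_deriv[OF assms]] by blast
qed

lemma nn_integral_lebesgue_on_eq:
  assumes "\<Omega> \<in> sets borel" "\<And>x. x \<notin> \<Omega> \<Longrightarrow> f x = (0 :: ennreal)"
  shows "(\<integral>\<^sup>+x. f x \<partial>lebesgue_on \<Omega>) = (\<integral>\<^sup>+x. f x \<partial>lborel)"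
proof -
  have "(\<integral>\<^sup>+x. f x \<partial>lebesgue_on \<Omega>) = (\<integral>\<^sup>+x. f x * indicator \<Omega> x \<partial>lebesgue)"
    using assms by (subst nn_integral_restrict_space) auto
  also have "\<dots> = (\<integral>\<^sup>+x. f x * indicator \<Omega> x \<partial>lborel)" by (rule nn_integral_completion)
  also have "\<dots> = (\<integral>\<^sup>+x. f x \<partial>lborel)"
    using assms by (intro nn_integral_cong) (auto simp: indicator_def)
  finally show ?thesis .
qed

text \<open>It says that \<kappa> is admissible in the infimum of \<open>LXi_norm\<close>. Working
  with admissible values avoids both the infimum and the triangle inequality of the Luxemburg
  norm.\<close>

definition LXi_le :: "(real^2) set \<Rightarrow> real \<Rightarrow> (real^2 \<Rightarrow> real) \<Rightarrow> bool" where
  "LXi_le \<Omega> \<kappa> w \<longleftrightarrow> w \<in> borel_measurable (lebesgue_on \<Omega>) \<and> 0 < \<kappa> \<and>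
     (\<integral>\<^sup>+x. ennreal (Xi (\<bar>w x\<bar> / \<kappa>)) \<partial>lebesgue_on \<Omega>) \<le> 1"

lemma bounded_domain_lmeasurable: "bounded_domain \<Omega> \<Longrightarrow> \<Omega> \<in> lmeasurable"
  by (simp add: bounded_domain_def lmeasurable_open)

section \<open>From test functions to the energy space\<close>

context
  fixes \<Omega> :: "(real^2) set"
  assumes dom: "bounded_domain \<Omega>"
begin

lemma Omega_borel: "\<Omega> \<in> sets borel"
  using dom by (auto simp: bounded_domain_def)

lemma test_function_L2:
  assumes "test_function \<Omega> f"
  shows "f \<in> L2 \<Omega>"
proof -
  obtain K where K: "compact K" "\<And>x. x \<notin> K \<Longrightarrow> f x = 0"
    using assms by (auto simp: test_function_def)
  have m: "f \<in> borel_measurable (lebesgue_on \<Omega>)"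
    using borel_measurable_continuous_onI[OF test_function_continuous[OF assms]]
    by (intro measurable_restrict_space1 measurable_completion) (simp add: measurable_lborel1)
  have "compact (f ` K)" using test_function_continuous[OF assms] K
    by (intro compact_continuous_image) (auto intro: continuous_on_subset)
  from compact_imp_bounded[OF this] obtain B where "\<forall>y\<in>f ` K. norm y \<le> B" unfolding bounded_iff by blast
  then have B: "\<And>x. x \<in> K \<Longrightarrow> \<bar>f x\<bar> \<le> B" by auto
  have "\<bar>f x\<bar> \<le> \<bar>B\<bar>" for x using B[of x] K(2)[of x] by fastforce
  then have "(f x)\<^sup>2 \<le> B\<^sup>2" for x by (simp add: abs_le_square_iff)
  then have "integrable (lebesgue_on \<Omega>) (\<lambda>x. (f x)\<^sup>2)"
    using m by (intro finite_measure.integrable_const_bound[OF finite_measure_lebesgue_on, of _ _ "B\<^sup>2"] 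
        bounded_domain_lmeasurable dom) auto
  then show ?thesis using m by (simp add: L2_def)
qed

lemma test_function_energy:
  assumes "test_function \<Omega> f"
  shows "(\<integral>\<^sup>+x. ennreal (grad_sq f x) \<partial>lborel) = ennreal (\<Sum>i\<in>UNIV. (L2_norm \<Omega> (partial_deriv i f))\<^sup>2)"
proof -
  have p: "test_function \<Omega> (partial_deriv i f)" for i by (rule test_function_partial_deriv[OF assms])
  have "(\<integral>\<^sup>+x. ennreal (grad_sq f x) \<partial>lborel) = (\<integral>\<^sup>+x. (\<Sum>i\<in>UNIV. ennreal ((partial_deriv i f x)\<^sup>2)) \<partial>lborel)"
    unfolding grad_sq_def by (intro nn_integral_cong sum_ennreal[symmetric]) auto
  also have "\<dots> = (\<Sum>i\<in>UNIV. \<integral>\<^sup>+x. ennreal ((partial_deriv i f x)\<^sup>2) \<partial>lborel)"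
    using borel_measurable_continuous_onI[OF test_function_continuous[OF p]]
    by (intro nn_integral_sum) (auto intro!: measurable_compose[OF _ measurable_ennreal] borel_measurable_power)
  also have "\<dots> = (\<Sum>i\<in>UNIV. ennreal ((L2_norm \<Omega> (partial_deriv i f))\<^sup>2))"
  proof (intro sum.cong refl)
    fix i
    have "(\<integral>\<^sup>+x. ennreal ((partial_deriv i f x)\<^sup>2) \<partial>lborel) = (\<integral>\<^sup>+x. ennreal ((partial_deriv i f x)\<^sup>2) \<partial>lebesgue_on \<Omega>)"
      using p[of i] by (intro nn_integral_lebesgue_on_eq[symmetric] Omega_borel) (auto simp: test_function_def)
    also have "\<dots> = ennreal ((L2_norm \<Omega> (partial_deriv i f))\<^sup>2)"
      by (rule L2_norm_sq_nn_integral[OF test_function_L2[OF p]])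
    finally show "(\<integral>\<^sup>+x. ennreal ((partial_deriv i f x)\<^sup>2) \<partial>lborel) = ennreal ((L2_norm \<Omega> (partial_deriv i f))\<^sup>2)" .
  qed
  finally show ?thesis by (simp add: sum_ennreal)
qed

lemma trudinger_test_function:
  obtains C where "C > 0" "\<And>f E. test_function \<Omega> f \<Longrightarrow> E > 0 \<Longrightarrow>
    (\<Sum>i\<in>UNIV. (L2_norm \<Omega> (partial_deriv i f))\<^sup>2) \<le> E \<Longrightarrow>
    (\<integral>\<^sup>+x. ennreal (exp ((f x)\<^sup>2 / (C * E)) - 1) \<partial>lebesgue_on \<Omega>) \<le> 1"
proof -
  obtain C where C: "C > 0" "\<And>f E. C1_compact f \<Longrightarrow> E > 0 \<Longrightarrow> (\<integral>\<^sup>+x. ennreal (grad_sq f x) \<partial>lborel) \<le> ennreal E \<Longrightarrow>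
    emeasure lborel {x. f x \<noteq> 0} \<le> ennreal (measure lborel \<Omega>) \<Longrightarrow>
    (\<integral>\<^sup>+x. ennreal (exp ((f x)\<^sup>2 / (C * E)) - 1) \<partial>lborel) \<le> 1"
    using trudinger[of "measure lborel \<Omega>"] by auto
  have "(\<integral>\<^sup>+x. ennreal (exp ((f x)\<^sup>2 / (C * E)) - 1) \<partial>lebesgue_on \<Omega>) \<le> 1"
    if f: "test_function \<Omega> f" and E: "E > 0" "(\<Sum>i\<in>UNIV. (L2_norm \<Omega> (partial_deriv i f))\<^sup>2) \<le> E" for f E
  proof -
    have z: "f x = 0" if "x \<notin> \<Omega>" for x using f that by (auto simp: test_function_def)
    have "emeasure lborel {x. f x \<noteq> 0} \<le> emeasure lborel \<Omega>"
      using z Omega_borel by (intro emeasure_mono) auto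
    also have "\<dots> = ennreal (measure lborel \<Omega>)"
      using dom emeasure_bounded_finite[of \<Omega>] by (intro emeasure_eq_ennreal_measure) (auto simp: bounded_domain_def)
    finally have "(\<integral>\<^sup>+x. ennreal (exp ((f x)\<^sup>2 / (C * E)) - 1) \<partial>lborel) \<le> 1"
      using E test_function_energy[OF f] by (intro C(2) test_function_C1_compact[OF f]) (auto intro: ennreal_leI)
    then show ?thesis
      using z by (subst nn_integral_lebesgue_on_eq[OF Omega_borel]) auto
  qed
  then show ?thesis using that C(1) by blast
qed

lemma L2_norm_sum_le:
  assumes "\<And>k. k \<in> A \<Longrightarrow> f k \<in> L2 \<Omega>"
  shows "L2_norm \<Omega> (\<lambda>x. \<Sum>k\<in>A. f k x) \<le> (\<Sum>k\<in>A. L2_norm \<Omega> (f k))"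
  using assms
proof (induction A rule: infinite_finite_induct)
  case (insert a A)
  have "L2_norm \<Omega> (\<lambda>x. \<Sum>k\<in>insert a A. f k x) = L2_norm \<Omega> (\<lambda>x. f a x + (\<Sum>k\<in>A. f k x))"
    using insert by simp
  also have "\<dots> \<le> L2_norm \<Omega> (f a) + L2_norm \<Omega> (\<lambda>x. \<Sum>k\<in>A. f k x)"
    using insert by (intro L2_norm_triangle L2_sum) auto
  finally show ?case using insert by auto
qed (auto simp: L2_norm_def L2_inner_def)

lemma L2_norm_lincomb_tendsto:
  assumes "\<And>k n. f k n \<in> L2 \<Omega>" "\<And>k. g k \<in> L2 \<Omega>" "\<And>k. (\<lambda>n. L2_norm \<Omega> (\<lambda>x. f k n x - g k x)) \<longlonglongrightarrow> 0"
  shows "(\<lambda>n. L2_norm \<Omega> (\<lambda>x. (\<Sum>k\<in>A. c k * f k n x) - (\<Sum>k\<in>A. c k * g k x))) \<longlonglongrightarrow> 0"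
proof (rule Lim_null_comparison)
  have "L2_norm \<Omega> (\<lambda>x. (\<Sum>k\<in>A. c k * f k n x) - (\<Sum>k\<in>A. c k * g k x)) \<le> (\<Sum>k\<in>A. \<bar>c k\<bar> * L2_norm \<Omega> (\<lambda>x. f k n x - g k x))" for n
  proof -
    have "L2_norm \<Omega> (\<lambda>x. \<Sum>k\<in>A. c k * (f k n x - g k x)) \<le> (\<Sum>k\<in>A. L2_norm \<Omega> (\<lambda>x. c k * (f k n x - g k x)))"
      by (intro L2_norm_sum_le L2_scale L2_diff assms)
    then show ?thesis unfolding L2_norm_scale by (simp add: right_diff_distrib sum_subtractf)
  qed
  then show "\<forall>\<^sub>F n in sequentially. norm (L2_norm \<Omega> (\<lambda>x. (\<Sum>k\<in>A. c k * f k n x) - (\<Sum>k\<in>A. c k * g k x))) \<le> (\<Sum>k\<in>A. \<bar>c k\<bar> * L2_norm \<Omega> (\<lambda>x. f k n x - g k x))"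
    by (simp add: L2_norm_nonneg)
  show "(\<lambda>n. \<Sum>k\<in>A. \<bar>c k\<bar> * L2_norm \<Omega> (\<lambda>x. f k n x - g k x)) \<longlonglongrightarrow> 0"
    by (rule tendsto_null_sum) (rule tendsto_mult_right_zero[OF assms(3)])
qed

lemma L2_norm_tendsto:
  assumes "\<And>n. f n \<in> L2 \<Omega>" "g \<in> L2 \<Omega>" "(\<lambda>n. L2_norm \<Omega> (\<lambda>x. f n x - g x)) \<longlonglongrightarrow> 0"
  shows "(\<lambda>n. L2_norm \<Omega> (f n)) \<longlonglongrightarrow> L2_norm \<Omega> g"
proof (rule LIM_zero_cancel, rule Lim_null_comparison[OF _ assms(3)])
  show "\<forall>\<^sub>F n in sequentially. norm (L2_norm \<Omega> (f n) - L2_norm \<Omega> g) \<le> L2_norm \<Omega> (\<lambda>x. f n x - g x)"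
    using L2_norm_reverse_triangle[OF assms(1,2)] by simp
qed

context
  fixes \<theta> :: "nat \<Rightarrow> real" and \<phi> :: "nat \<Rightarrow> real^2 \<Rightarrow> real"
  assumes eig: "Dirichlet_eigensystem \<Omega> \<theta> \<phi>"
begin

text \<open>The weak eigenvalue equation is tested with the approximants that membership in
  \<open>H1_0\<close> provides, and the limit shows that the gradients are orthogonal with squared
  norms \<theta>.\<close>

lemma eigenfunctions_gradient:
  obtains g :: "nat \<Rightarrow> 2 \<Rightarrow> real^2 \<Rightarrow> real" and \<psi> where "\<And>k i. g k i \<in> L2 \<Omega>" "\<And>k n. test_function \<Omega> (\<psi> k n)"
    "\<And>k. (\<lambda>n. L2_norm \<Omega> (\<lambda>x. \<psi> k n x - \<phi> k x)) \<longlonglongrightarrow> 0"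
    "\<And>k i. (\<lambda>n. L2_norm \<Omega> (\<lambda>x. partial_deriv i (\<psi> k n) x - g k i x)) \<longlonglongrightarrow> 0"
    "\<And>k l. (\<Sum>i\<in>UNIV. L2_inner \<Omega> (g k i) (g l i)) = (if k = l then \<theta> k else 0)"
proof -
  have basis: "complete_orthonormal \<Omega> \<phi>" using eig by (simp add: Dirichlet_eigensystem_def)
  have \<phi>L: "\<phi> k \<in> L2 \<Omega>" for k using basis by (simp add: complete_orthonormal_def)
  have ef: "Dirichlet_eigenfunction \<Omega> (\<theta> k) (\<phi> k)" for k using eig by (simp add: Dirichlet_eigensystem_def)
  define P where "P k g \<psi> \<longleftrightarrow> weak_gradient \<Omega> (\<phi> k) g \<and> (\<forall>n. test_function \<Omega> (\<psi> n)) \<and>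
        (\<lambda>n. L2_norm \<Omega> (\<lambda>x. \<psi> n x - \<phi> k x)) \<longlonglongrightarrow> 0 \<and>
        (\<forall>i. (\<lambda>n. L2_norm \<Omega> (\<lambda>x. partial_deriv i (\<psi> n) x - g i x)) \<longlonglongrightarrow> 0)" for k g \<psi>
  have "\<forall>k. \<exists>g \<psi>. P k g \<psi>"
    using ef unfolding P_def Dirichlet_eigenfunction_def H1_0_def by blast
  from choice[OF this] obtain g where "\<forall>k. \<exists>\<psi>. P k (g k) \<psi>" ..
  from choice[OF this] obtain \<psi> where "\<forall>k. P k (g k) (\<psi> k)" ..
  then have g: "\<And>k. weak_gradient \<Omega> (\<phi> k) (g k)" and \<psi>: "\<And>k n. test_function \<Omega> (\<psi> k n)"
    "\<And>k. (\<lambda>n. L2_norm \<Omega> (\<lambda>x. \<psi> k n x - \<phi> k x)) \<longlonglongrightarrow> 0"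
    "\<And>k i. (\<lambda>n. L2_norm \<Omega> (\<lambda>x. partial_deriv i (\<psi> k n) x - g k i x)) \<longlonglongrightarrow> 0"
    unfolding P_def by auto
  define Q where "Q k h \<longleftrightarrow> weak_gradient \<Omega> (\<phi> k) h \<and> (\<forall>\<eta>. test_function \<Omega> \<eta> \<longrightarrow>
      (\<Sum>i\<in>UNIV. L2_inner \<Omega> (h i) (partial_deriv i \<eta>)) = \<theta> k * L2_inner \<Omega> (\<phi> k) \<eta>)" for k h
  have "\<forall>k. \<exists>h. Q k h"
    using ef unfolding Q_def Dirichlet_eigenfunction_def by blast
  from choice[OF this] obtain h where "\<forall>k. Q k (h k)" ..
  then have h: "\<And>k. weak_gradient \<Omega> (\<phi> k) (h k)" "\<And>k \<eta>. test_function \<Omega> \<eta> \<Longrightarrow>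
      (\<Sum>i\<in>UNIV. L2_inner \<Omega> (h k i) (partial_deriv i \<eta>)) = \<theta> k * L2_inner \<Omega> (\<phi> k) \<eta>"
    unfolding Q_def by auto
  have gL: "g k i \<in> L2 \<Omega>" for k i using g by (simp add: weak_gradient_def)
  \<comment> \<open>\<open>H1_0\<close> and the eigenvalue equation each come with their own weak
    gradient. Their pairings with test functions coincide, and only these are compared.\<close>
  have gh: "L2_inner \<Omega> (g k i) \<eta> = L2_inner \<Omega> (h k i) \<eta>" if "test_function \<Omega> \<eta>" for k i \<eta>
    using g[of k] h(1)[of k] that unfolding weak_gradient_def by fastforce
  have "(\<Sum>i\<in>UNIV. L2_inner \<Omega> (g k i) (g l i)) = (if k = l then \<theta> k else 0)" for k l
  proof -
    \<comment> \<open>The eigenvalue equation of index k, tested with the approximants of the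
      eigenfunction of index l; both sides converge as n grows.\<close>
    have eq: "(\<Sum>i\<in>UNIV. L2_inner \<Omega> (partial_deriv i (\<psi> l n)) (g k i)) = \<theta> k * L2_inner \<Omega> (\<psi> l n) (\<phi> k)" for n
    proof -
      have "(\<Sum>i\<in>UNIV. L2_inner \<Omega> (partial_deriv i (\<psi> l n)) (g k i)) = (\<Sum>i\<in>UNIV. L2_inner \<Omega> (h k i) (partial_deriv i (\<psi> l n)))"
        by (intro sum.cong refl trans[OF L2_inner_commute gh] test_function_partial_deriv \<psi>)
      also have "\<dots> = \<theta> k * L2_inner \<Omega> (\<phi> k) (\<psi> l n)" by (rule h(2)[OF \<psi>(1)])
      also have "L2_inner \<Omega> (\<phi> k) (\<psi> l n) = L2_inner \<Omega> (\<psi> l n) (\<phi> k)" by (rule L2_inner_commute)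
      finally show ?thesis .
    qed
    have 1: "(\<lambda>n. \<Sum>i\<in>UNIV. L2_inner \<Omega> (partial_deriv i (\<psi> l n)) (g k i)) \<longlonglongrightarrow> (\<Sum>i\<in>UNIV. L2_inner \<Omega> (g l i) (g k i))"
      by (intro tendsto_sum L2_inner_tendsto gL \<psi>(3) test_function_L2 test_function_partial_deriv \<psi>(1))
    have 2: "(\<lambda>n. \<theta> k * L2_inner \<Omega> (\<psi> l n) (\<phi> k)) \<longlonglongrightarrow> \<theta> k * L2_inner \<Omega> (\<phi> l) (\<phi> k)"
      by (intro tendsto_intros L2_inner_tendsto \<phi>L \<psi>(2) test_function_L2 \<psi>(1))
    have "(\<Sum>i\<in>UNIV. L2_inner \<Omega> (g l i) (g k i)) = \<theta> k * L2_inner \<Omega> (\<phi> l) (\<phi> k)"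
      using LIMSEQ_unique[OF 1[unfolded eq] 2] .
    moreover have "L2_inner \<Omega> (\<phi> l) (\<phi> k) = (if k = l then 1 else 0)"
      using basis by (auto simp: complete_orthonormal_def)
    moreover have "(\<Sum>i\<in>UNIV. L2_inner \<Omega> (g k i) (g l i)) = (\<Sum>i\<in>UNIV. L2_inner \<Omega> (g l i) (g k i))"
      by (intro sum.cong refl L2_inner_commute)
    ultimately show ?thesis by simp
  qed
  then show ?thesis using that gL \<psi> by blast
qed

text \<open>Partial eigenfunction sums have energy
  \<open>\<Sum>k<n. \<theta> k * (c k)\<^sup>2\<close> by orthogonality of the gradients. As this is
  strictly below E, nearby combinations of test functions still have energy at most E.\<close>

lemma D1_approx_test_functions:
  assumes "w \<in> D1 \<Omega> \<theta> \<phi>" "(D1_norm \<Omega> \<theta> \<phi> w)\<^sup>2 < E"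
  obtains \<eta> where "\<And>n. test_function \<Omega> (\<eta> n)" "\<And>n. (\<Sum>i\<in>UNIV. (L2_norm \<Omega> (partial_deriv i (\<eta> n)))\<^sup>2) \<le> E"
    "(\<lambda>n. L2_norm \<Omega> (\<lambda>x. \<eta> n x - w x)) \<longlonglongrightarrow> 0"
proof -
  have basis: "complete_orthonormal \<Omega> \<phi>" using eig by (simp add: Dirichlet_eigensystem_def)
  have \<phi>L: "\<phi> k \<in> L2 \<Omega>" for k using basis by (simp add: complete_orthonormal_def)
  have \<theta>: "\<theta> k > 0" for k using eig by (simp add: Dirichlet_eigensystem_def)
  have w: "w \<in> L2 \<Omega>" "summable (\<lambda>k. \<theta> k * (L2_inner \<Omega> w (\<phi> k))\<^sup>2)" using assms(1) by (auto simp: D1_def)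
  define c where "c k = L2_inner \<Omega> w (\<phi> k)" for k
  define s where "s n = (\<lambda>x. \<Sum>k<n. c k * \<phi> k x)" for n :: nat
  have sL: "s n \<in> L2 \<Omega>" for n unfolding s_def by (intro L2_sum L2_scale \<phi>L)
  have s_lim: "(\<lambda>n. L2_norm \<Omega> (\<lambda>x. s n x - w x)) \<longlonglongrightarrow> 0"
    using basis w(1) by (simp add: complete_orthonormal_def L2_sums_def s_def c_def)
  have D: "(D1_norm \<Omega> \<theta> \<phi> w)\<^sup>2 = (\<Sum>k. \<theta> k * (c k)\<^sup>2)"
  proof -
    have "0 \<le> (\<Sum>k. \<theta> k * (c k)\<^sup>2)"
      using \<theta> w(2) unfolding c_def by (intro suminf_nonneg mult_nonneg_nonneg) (auto intro: less_imp_le)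
    then show ?thesis by (simp add: D1_norm_def c_def)
  qed
  have partial: "(\<Sum>k<n. \<theta> k * (c k)\<^sup>2) < E" for n
  proof -
    have "(\<Sum>k<n. \<theta> k * (c k)\<^sup>2) \<le> (\<Sum>k. \<theta> k * (c k)\<^sup>2)"
      using w(2) \<theta> by (intro sum_le_suminf) (auto simp: c_def less_imp_le)
    then show ?thesis using D assms(2) by simp
  qed
  obtain g \<psi> where g: "\<And>k i. g k i \<in> L2 \<Omega>" and \<psi>: "\<And>k n. test_function \<Omega> (\<psi> k n)"
    "\<And>k. (\<lambda>n. L2_norm \<Omega> (\<lambda>x. \<psi> k n x - \<phi> k x)) \<longlonglongrightarrow> 0"
    "\<And>k i. (\<lambda>n. L2_norm \<Omega> (\<lambda>x. partial_deriv i (\<psi> k n) x - g k i x)) \<longlonglongrightarrow> 0"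
    and orth: "\<And>k l. (\<Sum>i\<in>UNIV. L2_inner \<Omega> (g k i) (g l i)) = (if k = l then \<theta> k else 0)"
    by (rule eigenfunctions_gradient) blast
  \<comment> \<open>One test function per partial sum, within 1 / (n + 1) of it: a diagonal choice
    through the two limits.\<close>
  have "\<exists>\<eta>. test_function \<Omega> \<eta> \<and> (\<Sum>i\<in>UNIV. (L2_norm \<Omega> (partial_deriv i \<eta>))\<^sup>2) \<le> E \<and>
      L2_norm \<Omega> (\<lambda>x. \<eta> x - s n x) \<le> 1 / real (Suc n)" for n
  proof -
    define \<eta> where "\<eta> j = (\<lambda>x. \<Sum>k<n. c k * \<psi> k j x)" for j
    have \<eta>: "test_function \<Omega> (\<eta> j)" for j unfolding \<eta>_def by (intro test_function_sum test_function_scale \<psi>)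
    have pd: "partial_deriv i (\<eta> j) = (\<lambda>x. \<Sum>k<n. c k * partial_deriv i (\<psi> k j) x)" for i j
      unfolding \<eta>_def by (intro ext partial_deriv_sum_scale test_function_differentiable[OF \<psi>(1)]) simp
    have 1: "(\<lambda>j. L2_norm \<Omega> (\<lambda>x. \<eta> j x - s n x)) \<longlonglongrightarrow> 0"
      unfolding \<eta>_def s_def by (intro L2_norm_lincomb_tendsto \<psi>(2) \<phi>L test_function_L2 \<psi>(1))
    have "(\<lambda>j. L2_norm \<Omega> (partial_deriv i (\<eta> j))) \<longlonglongrightarrow> L2_norm \<Omega> (\<lambda>x. \<Sum>k<n. c k * g k i x)" for i
    proof (rule L2_norm_tendsto)
      show "(\<lambda>j. L2_norm \<Omega> (\<lambda>x. partial_deriv i (\<eta> j) x - (\<Sum>k<n. c k * g k i x))) \<longlonglongrightarrow> 0"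
        unfolding pd by (intro L2_norm_lincomb_tendsto \<psi>(3) g test_function_L2 test_function_partial_deriv \<psi>(1))
    qed (intro test_function_L2 test_function_partial_deriv \<eta> L2_sum L2_scale g)+
    then have "(\<lambda>j. \<Sum>i\<in>UNIV. (L2_norm \<Omega> (partial_deriv i (\<eta> j)))\<^sup>2) \<longlonglongrightarrow> (\<Sum>i\<in>UNIV. (L2_norm \<Omega> (\<lambda>x. \<Sum>k<n. c k * g k i x))\<^sup>2)"
      by (intro tendsto_intros)
    also have "(\<Sum>i\<in>UNIV. (L2_norm \<Omega> (\<lambda>x. \<Sum>k<n. c k * g k i x))\<^sup>2) = (\<Sum>i\<in>UNIV. \<Sum>k<n. \<Sum>l<n. c k * c l * L2_inner \<Omega> (g k i) (g l i))"
    proof (intro sum.cong refl)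
      fix i
      let ?G = "\<lambda>x. \<Sum>k<n. c k * g k i x"
      have G: "L2_inner \<Omega> ?G v = (\<Sum>k<n. c k * L2_inner \<Omega> (g k i) v)" if "v \<in> L2 \<Omega>" for v
        using that by (subst L2_inner_sum) (auto intro: L2_scale g simp: L2_inner_scale)
      have "(L2_norm \<Omega> ?G)\<^sup>2 = (\<Sum>k<n. c k * L2_inner \<Omega> (g k i) ?G)"
        unfolding L2_norm_sq by (intro G L2_sum L2_scale g)
      also have "\<dots> = (\<Sum>k<n. c k * (\<Sum>l<n. c l * L2_inner \<Omega> (g l i) (g k i)))"
        by (intro sum.cong refl arg_cong2[where f="(*)"] trans[OF L2_inner_commute G] g)
      also have "\<dots> = (\<Sum>k<n. \<Sum>l<n. c k * c l * L2_inner \<Omega> (g k i) (g l i))"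
        unfolding sum_distrib_left mult.assoc by (intro sum.cong refl arg_cong2[where f="(*)"] L2_inner_commute)
      finally show "(L2_norm \<Omega> ?G)\<^sup>2 = (\<Sum>k<n. \<Sum>l<n. c k * c l * L2_inner \<Omega> (g k i) (g l i))" .
    qed
    also have "\<dots> = (\<Sum>k<n. \<Sum>l<n. c k * c l * (\<Sum>i\<in>UNIV. L2_inner \<Omega> (g k i) (g l i)))"
      unfolding sum_distrib_left by (subst sum.swap, intro sum.cong refl, subst sum.swap, rule refl)
    also have "\<dots> = (\<Sum>k<n. \<theta> k * (c k)\<^sup>2)"
      unfolding orth by (simp add: if_distrib power2_eq_square mult_ac cong: if_cong)
    finally have "\<forall>\<^sub>F j in sequentially. (\<Sum>i\<in>UNIV. (L2_norm \<Omega> (partial_deriv i (\<eta> j)))\<^sup>2) < E"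
      by (rule order_tendstoD) (rule partial)
    moreover have "\<forall>\<^sub>F j in sequentially. L2_norm \<Omega> (\<lambda>x. \<eta> j x - s n x) < 1 / real (Suc n)"
      by (rule order_tendstoD(2)[OF 1]) simp
    ultimately have "\<forall>\<^sub>F j in sequentially. (\<Sum>i\<in>UNIV. (L2_norm \<Omega> (partial_deriv i (\<eta> j)))\<^sup>2) < E \<and> L2_norm \<Omega> (\<lambda>x. \<eta> j x - s n x) < 1 / real (Suc n)"
      by (rule eventually_conj)
    then obtain j where "(\<Sum>i\<in>UNIV. (L2_norm \<Omega> (partial_deriv i (\<eta> j)))\<^sup>2) < E" "L2_norm \<Omega> (\<lambda>x. \<eta> j x - s n x) < 1 / real (Suc n)"
      using eventually_happens'[OF sequentially_bot] by blast
    then show ?thesis using \<eta>[of j] less_imp_le by blast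
  qed
  then have "\<forall>n. \<exists>\<eta>. test_function \<Omega> \<eta> \<and> (\<Sum>i\<in>UNIV. (L2_norm \<Omega> (partial_deriv i \<eta>))\<^sup>2) \<le> E \<and>
      L2_norm \<Omega> (\<lambda>x. \<eta> x - s n x) \<le> 1 / real (Suc n)" by (rule allI)
  from choice[OF this] obtain \<eta> where \<eta>: "\<And>n. test_function \<Omega> (\<eta> n)" "\<And>n. (\<Sum>i\<in>UNIV. (L2_norm \<Omega> (partial_deriv i (\<eta> n)))\<^sup>2) \<le> E"
      "\<And>n. L2_norm \<Omega> (\<lambda>x. \<eta> n x - s n x) \<le> 1 / real (Suc n)" by blast
  have "(\<lambda>n. L2_norm \<Omega> (\<lambda>x. \<eta> n x - w x)) \<longlonglongrightarrow> 0"
  proof (rule Lim_null_comparison)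
    have "L2_norm \<Omega> (\<lambda>x. \<eta> n x - w x) \<le> 1 / real (Suc n) + L2_norm \<Omega> (\<lambda>x. s n x - w x)" for n
      using L2_norm_triangle_diff[OF test_function_L2[OF \<eta>(1)] sL w(1), of n n] \<eta>(3)[of n] by linarith
    then show "\<forall>\<^sub>F n in sequentially. norm (L2_norm \<Omega> (\<lambda>x. \<eta> n x - w x)) \<le> 1 / real (Suc n) + L2_norm \<Omega> (\<lambda>x. s n x - w x)"
      by (simp add: L2_norm_nonneg)
    show "(\<lambda>n. 1 / real (Suc n) + L2_norm \<Omega> (\<lambda>x. s n x - w x)) \<longlonglongrightarrow> 0"
      using tendsto_add[OF LIMSEQ_Suc[OF lim_1_over_n] s_lim] by simp
  qed
  then show ?thesis using that \<eta> by blast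
qed

lemma L2_tendsto_AE_subseq:
  assumes "\<And>n. f n \<in> L2 \<Omega>" "g \<in> L2 \<Omega>" "(\<lambda>n. L2_norm \<Omega> (\<lambda>x. f n x - g x)) \<longlonglongrightarrow> 0"
  obtains r :: "nat \<Rightarrow> nat" where "strict_mono r" "AE x in lebesgue_on \<Omega>. (\<lambda>n. f (r n) x) \<longlonglongrightarrow> g x"
proof -
  have d: "(\<lambda>x. f n x - g x) \<in> L2 \<Omega>" for n by (intro L2_diff assms)
  have "(\<lambda>n. (L2_norm \<Omega> (\<lambda>x. f n x - g x))\<^sup>2) \<longlonglongrightarrow> 0" using tendsto_power[OF assms(3), of 2] by simp
  then have "(\<lambda>n. LINT x|lebesgue_on \<Omega>. norm ((f n x - g x)\<^sup>2)) \<longlonglongrightarrow> 0" by (simp add: L2_norm_sq_integral)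
  then obtain r where r: "strict_mono r" "AE x in lebesgue_on \<Omega>. (\<lambda>n. (f (r n) x - g x)\<^sup>2) \<longlonglongrightarrow> 0"
    using tendsto_L1_AE_subseq[of "lebesgue_on \<Omega>" "\<lambda>n x. (f n x - g x)\<^sup>2"] d by (auto simp: L2_def)
  from r(2) have "AE x in lebesgue_on \<Omega>. (\<lambda>n. f (r n) x) \<longlonglongrightarrow> g x"
  proof eventually_elim
    case (elim x)
    from tendsto_real_sqrt[OF this] have "(\<lambda>n. \<bar>f (r n) x - g x\<bar>) \<longlonglongrightarrow> 0" by simp
    from LIM_zero_cancel[OF tendsto_rabs_zero_cancel[OF this]] show ?case .
  qed
  then show ?thesis using that r(1) by blast
qed

text \<open>The Trudinger bound passes from test functions to their limit by Fatou's lemma along an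
  almost everywhere convergent subsequence. The strict inequality leaves room for the energies of
  the approximants and forces \<kappa> > 0.\<close>

lemma D1_embedding:
  obtains C where "C > 0" "\<And>w \<kappa>. w \<in> D1 \<Omega> \<theta> \<phi> \<Longrightarrow> C * D1_norm \<Omega> \<theta> \<phi> w < \<kappa> \<Longrightarrow> LXi_le \<Omega> \<kappa> w"
proof -
  obtain C where C: "C > 0" "\<And>f E. test_function \<Omega> f \<Longrightarrow> E > 0 \<Longrightarrow>
    (\<Sum>i\<in>UNIV. (L2_norm \<Omega> (partial_deriv i f))\<^sup>2) \<le> E \<Longrightarrow>
    (\<integral>\<^sup>+x. ennreal (exp ((f x)\<^sup>2 / (C * E)) - 1) \<partial>lebesgue_on \<Omega>) \<le> 1"
    by (rule trudinger_test_function) blast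
  have "LXi_le \<Omega> \<kappa> w" if w: "w \<in> D1 \<Omega> \<theta> \<phi>" and \<kappa>: "sqrt C * D1_norm \<Omega> \<theta> \<phi> w < \<kappa>" for w \<kappa>
  proof -
    have D0: "0 \<le> D1_norm \<Omega> \<theta> \<phi> w"
      using w eig unfolding D1_norm_def D1_def Dirichlet_eigensystem_def
      by (intro real_sqrt_ge_zero suminf_nonneg mult_nonneg_nonneg) (auto intro: less_imp_le)
    have \<kappa>0: "\<kappa> > 0" using \<kappa> D0 C(1) by (smt (verit) mult_nonneg_nonneg real_sqrt_ge_zero)
    \<comment> \<open>The largest energy for which the Trudinger integrand is dominated with scale
      \<kappa>: as C E = \<kappa>^2, the integrand becomes \<open>Xi\<close> of the quotient by
      \<kappa>.\<close>
    define E where "E = \<kappa>\<^sup>2 / C"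
    have CE: "C * E = \<kappa>\<^sup>2" "E > 0" using C(1) \<kappa>0 by (auto simp: E_def)
    have "(sqrt C * D1_norm \<Omega> \<theta> \<phi> w)\<^sup>2 < \<kappa>\<^sup>2" using \<kappa> D0 C(1) by (intro power_strict_mono) auto
    then have "(D1_norm \<Omega> \<theta> \<phi> w)\<^sup>2 < E" using C(1) by (simp add: E_def power_mult_distrib field_simps)
    then obtain \<eta> where \<eta>: "\<And>n. test_function \<Omega> (\<eta> n)" "\<And>n. (\<Sum>i\<in>UNIV. (L2_norm \<Omega> (partial_deriv i (\<eta> n)))\<^sup>2) \<le> E"
      "(\<lambda>n. L2_norm \<Omega> (\<lambda>x. \<eta> n x - w x)) \<longlonglongrightarrow> 0"
      using D1_approx_test_functions[OF w] by blast
    have wL: "w \<in> L2 \<Omega>" using w by (simp add: D1_def)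
    note \<eta>L = test_function_L2[OF \<eta>(1)]
    obtain r where r: "AE x in lebesgue_on \<Omega>. (\<lambda>n. \<eta> (r n) x) \<longlonglongrightarrow> w x"
      using L2_tendsto_AE_subseq[OF \<eta>L wL \<eta>(3)] by blast
    have [measurable]: "\<eta> n \<in> borel_measurable (lebesgue_on \<Omega>)" for n by (rule L2_measurable[OF \<eta>L])
    have "(\<integral>\<^sup>+x. ennreal (Xi (\<bar>w x\<bar> / \<kappa>)) \<partial>lebesgue_on \<Omega>) = 
        (\<integral>\<^sup>+x. liminf (\<lambda>n. ennreal (exp ((\<eta> (r n) x)\<^sup>2 / (C * E)) - 1)) \<partial>lebesgue_on \<Omega>)"
      using r
    proof (intro nn_integral_cong_AE, eventually_elim)
      case (elim x)
      have "(\<lambda>n. ennreal (exp ((\<eta> (r n) x)\<^sup>2 / (C * E)) - 1)) \<longlonglongrightarrow> ennreal (exp ((w x)\<^sup>2 / (C * E)) - 1)"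
        using CE \<kappa>0 by (intro tendsto_intros elim) auto
      from lim_imp_Liminf[OF _ this] show ?case by (simp add: Xi_def CE power_divide)
    qed
    also have "\<dots> \<le> liminf (\<lambda>n. \<integral>\<^sup>+x. ennreal (exp ((\<eta> (r n) x)\<^sup>2 / (C * E)) - 1) \<partial>lebesgue_on \<Omega>)"
      by (rule nn_integral_liminf) measurable
    also have "\<dots> \<le> 1"
      by (rule Liminf_le) (auto intro!: always_eventually C(2) \<eta> CE)
    finally show ?thesis using \<kappa>0 L2_measurable[OF wL] by (simp add: LXi_le_def)
  qed
  moreover have "sqrt C > 0" using C(1) by simp
  ultimately show ?thesis using that by blast
qed

end

end

section \<open>The nonlinearity on the Orlicz space\<close>

lemma Xi_nonneg: "0 \<le> Xi z"
  by (simp add: Xi_def)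

lemma Xi_mono: "0 \<le> a \<Longrightarrow> a \<le> b \<Longrightarrow> Xi a \<le> Xi b"
  by (simp add: Xi_def power_mono)

lemma Xi_ge_sq: "z\<^sup>2 \<le> Xi z"
  unfolding Xi_def using exp_ge_add_one_self[of "z\<^sup>2"] by linarith

text \<open>Convexity of exp between 0 and z^2. Enlarging the scale thus decreases the integral of
  \<open>Xi\<close> by a definite factor.\<close>

lemma Xi_scale:
  assumes "1 \<le> s"
  shows "Xi (z / s) \<le> Xi z / s\<^sup>2"
proof -
  define a where "a = 1 / s\<^sup>2"
  have a: "0 \<le> a" "a \<le> 1" using assms by (auto simp: a_def divide_le_eq one_le_power)
  have "exp ((1 - a) * 0 + a * z\<^sup>2) \<le> (1 - a) * exp 0 + a * exp (z\<^sup>2)"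
    using convex_onD[OF exp_convex, of a 0 "z\<^sup>2"] a by simp
  then have "exp (a * z\<^sup>2) - 1 \<le> a * (exp (z\<^sup>2) - 1)" by (simp add: algebra_simps)
  then show ?thesis by (simp add: Xi_def a_def power_divide)
qed

lemma borel_measurable_Xi [measurable]: "Xi \<in> borel_measurable borel"
  unfolding Xi_def[abs_def] by measurable

lemma LXi_le_pos: "LXi_le \<Omega> \<kappa> w \<Longrightarrow> 0 < \<kappa>"
  by (simp add: LXi_le_def)

lemma LXi_le_integral: "LXi_le \<Omega> \<kappa> w \<Longrightarrow> (\<integral>\<^sup>+x. ennreal (Xi (\<bar>w x\<bar> / \<kappa>)) \<partial>lebesgue_on \<Omega>) \<le> 1"
  by (simp add: LXi_le_def)

lemma LXi_le_mono:
  assumes "LXi_le \<Omega> \<kappa> w" "\<kappa> \<le> \<kappa>'"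
  shows "LXi_le \<Omega> \<kappa>' w"
proof -
  have "(\<integral>\<^sup>+x. ennreal (Xi (\<bar>w x\<bar> / \<kappa>')) \<partial>lebesgue_on \<Omega>) \<le> (\<integral>\<^sup>+x. ennreal (Xi (\<bar>w x\<bar> / \<kappa>)) \<partial>lebesgue_on \<Omega>)"
    using assms LXi_le_pos[OF assms(1)] by (intro nn_integral_mono ennreal_leI Xi_mono divide_left_mono) auto
  then show ?thesis using assms order_trans[OF _ LXi_le_integral[OF assms(1)]] by (auto simp: LXi_le_def)
qed

lemma LXi_le_imp_LXi: "LXi_le \<Omega> \<kappa> w \<Longrightarrow> w \<in> LXi \<Omega>"
  unfolding LXi_le_def LXi_def by (auto intro!: exI[of _ \<kappa>] intro: le_less_trans)

lemma LXi_norm_le: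
  assumes "LXi_le \<Omega> \<kappa> w"
  shows "LXi_norm \<Omega> w \<le> \<kappa>"
  unfolding LXi_norm_def
  using assms by (intro cInf_lower bdd_belowI[of _ 0]) (auto simp: LXi_le_def)

lemma LXi_imp_LXi_le:
  assumes "w \<in> LXi \<Omega>"
  obtains \<kappa> where "LXi_le \<Omega> \<kappa> w"
proof -
  obtain \<kappa> where \<kappa>: "\<kappa> > 0" "(\<integral>\<^sup>+x. ennreal (Xi (\<bar>w x\<bar> / \<kappa>)) \<partial>lebesgue_on \<Omega>) < \<infinity>" 
    and [measurable]: "w \<in> borel_measurable (lebesgue_on \<Omega>)"
    using assms by (auto simp: LXi_def)
  define I where "I = enn2real (\<integral>\<^sup>+x. ennreal (Xi (\<bar>w x\<bar> / \<kappa>)) \<partial>lebesgue_on \<Omega>)"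
  have I: "(\<integral>\<^sup>+x. ennreal (Xi (\<bar>w x\<bar> / \<kappa>)) \<partial>lebesgue_on \<Omega>) = ennreal I" "0 \<le> I"
    using \<kappa>(2) by (simp_all add: I_def)
  \<comment> \<open>Enlarging the scale by s divides the integral by s^2, and I <= s <= s^2.\<close>
  define s where "s = I + 1"
  have s: "1 \<le> s" using I by (simp add: s_def)
  define r where "r = 1 / s\<^sup>2"
  have r: "r \<ge> 0" by (simp add: r_def)
  have "(\<integral>\<^sup>+x. ennreal (Xi (\<bar>w x\<bar> / (\<kappa> * s))) \<partial>lebesgue_on \<Omega>) \<le> (\<integral>\<^sup>+x. ennreal r * ennreal (Xi (\<bar>w x\<bar> / \<kappa>)) \<partial>lebesgue_on \<Omega>)"
    unfolding ennreal_mult'[OF r, symmetric]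
  proof (intro nn_integral_mono ennreal_leI)
    fix x show "Xi (\<bar>w x\<bar> / (\<kappa> * s)) \<le> r * Xi (\<bar>w x\<bar> / \<kappa>)"
      using Xi_scale[OF s, of "\<bar>w x\<bar> / \<kappa>"] by (simp add: r_def)
  qed
  also have "\<dots> = ennreal r * ennreal I" by (simp add: nn_integral_cmult I(1))
  also have "\<dots> = ennreal (I / s\<^sup>2)" unfolding ennreal_mult'[OF r, symmetric] by (simp add: r_def)
  also have "\<dots> \<le> 1"
  proof -
    have "I \<le> s * 1" by (simp add: s_def)
    also have "\<dots> \<le> s * s" using s by (intro mult_left_mono) auto
    finally have "I / s\<^sup>2 \<le> 1" using s by (simp add: power2_eq_square divide_le_eq)
    then show ?thesis by simp
  qed
  finally have "LXi_le \<Omega> (\<kappa> * s) w" using \<kappa> s by (simp add: LXi_le_def)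
  then show ?thesis by (rule that)
qed

text \<open>Membership in \<open>LXi\<close> makes the set of admissible values nonempty, without
  which its infimum would be unspecified.\<close>

lemma LXi_le_of_norm_less:
  assumes "w \<in> LXi \<Omega>" "LXi_norm \<Omega> w < \<kappa>"
  shows "LXi_le \<Omega> \<kappa> w"
proof -
  obtain \<kappa>0 where "LXi_le \<Omega> \<kappa>0 w" by (rule LXi_imp_LXi_le[OF assms(1)])
  then have "{\<kappa>. 0 < \<kappa> \<and> (\<integral>\<^sup>+x. ennreal (Xi (\<bar>w x\<bar> / \<kappa>)) \<partial>lebesgue_on \<Omega>) \<le> 1} \<noteq> {}"
    by (auto simp: LXi_le_def)
  from cInf_lessD[OF this, of \<kappa>] obtain \<kappa>1 where "\<kappa>1 < \<kappa>" "0 < \<kappa>1" "(\<integral>\<^sup>+x. ennreal (Xi (\<bar>w x\<bar> / \<kappa>1)) \<partial>lebesgue_on \<Omega>) \<le> 1"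
    using assms(2) by (auto simp: LXi_norm_def)
  then have "LXi_le \<Omega> \<kappa>1 w" using assms(1) by (simp add: LXi_le_def LXi_def)
  then show ?thesis by (rule LXi_le_mono) (use \<open>\<kappa>1 < \<kappa>\<close> in simp)
qed

lemma LXi_norm_nonneg:
  assumes "w \<in> LXi \<Omega>"
  shows "0 \<le> LXi_norm \<Omega> w"
proof (rule ccontr)
  assume "\<not> 0 \<le> LXi_norm \<Omega> w"
  then have "LXi_le \<Omega> 0 w" by (intro LXi_le_of_norm_less[OF assms]) auto
  then show False by (simp add: LXi_le_def)
qed

lemma LXi_le_AE_cong:
  assumes "LXi_le \<Omega> \<kappa> w" "AE x in lebesgue_on \<Omega>. v x = w x" "v \<in> borel_measurable (lebesgue_on \<Omega>)"
  shows "LXi_le \<Omega> \<kappa> v"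
proof -
  have "(\<integral>\<^sup>+x. ennreal (Xi (\<bar>v x\<bar> / \<kappa>)) \<partial>lebesgue_on \<Omega>) = (\<integral>\<^sup>+x. ennreal (Xi (\<bar>w x\<bar> / \<kappa>)) \<partial>lebesgue_on \<Omega>)"
    using assms(2) by (intro nn_integral_cong_AE) (auto elim: eventually_mono)
  then show ?thesis using assms by (simp add: LXi_le_def)
qed

text \<open>
  The constant 3 leaves room for \<open>Xi (z / 3) \<le> Xi (z / 2) / 2\<close>, which avoids convexity of the norm.
\<close>

lemma LXi_le_diff:
  assumes "LXi_le \<Omega> \<kappa> w" "LXi_le \<Omega> \<kappa> v"
  shows "LXi_le \<Omega> (3 * \<kappa>) (\<lambda>x. w x - v x)"
proof -
  have [measurable]: "w \<in> borel_measurable (lebesgue_on \<Omega>)" "v \<in> borel_measurable (lebesgue_on \<Omega>)"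
    using assms by (auto simp: LXi_le_def)
  have \<kappa>: "\<kappa> > 0" using assms(1) by (rule LXi_le_pos)
  define h :: real where "h = 1 / 2"
  have h: "h \<ge> 0" by (simp add: h_def)
  have "(\<integral>\<^sup>+x. ennreal (Xi (\<bar>w x - v x\<bar> / (3 * \<kappa>))) \<partial>lebesgue_on \<Omega>) \<le>
    (\<integral>\<^sup>+x. ennreal h * (ennreal (Xi (\<bar>w x\<bar> / \<kappa>)) + ennreal (Xi (\<bar>v x\<bar> / \<kappa>))) \<partial>lebesgue_on \<Omega>)"
  proof (intro nn_integral_mono)
    fix x
    define m where "m = max \<bar>w x\<bar> \<bar>v x\<bar>"
    have "\<bar>w x - v x\<bar> \<le> 2 * m" by (auto simp: m_def)
    \<comment> \<open>The factor 3/2 left over by |w - v| <= 2 m enters \<open>Xi_scale\<close>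
      squared, and 9/4 >= 2 gives the factor h = 1/2 that absorbs the sum of the two
      integrals.\<close>
    then have "\<bar>w x - v x\<bar> / (3 * \<kappa>) \<le> (m / \<kappa>) / (3 / 2)" using \<kappa> by (simp add: field_simps)
    then have "Xi (\<bar>w x - v x\<bar> / (3 * \<kappa>)) \<le> Xi ((m / \<kappa>) / (3 / 2))" using \<kappa> by (intro Xi_mono) auto
    also have "\<dots> \<le> Xi (m / \<kappa>) / (3 / 2)\<^sup>2" by (rule Xi_scale) simp
    also have "\<dots> \<le> h * Xi (m / \<kappa>)" using Xi_nonneg[of "m / \<kappa>"] by (simp add: power2_eq_square h_def)
    also have "\<dots> \<le> h * (Xi (\<bar>w x\<bar> / \<kappa>) + Xi (\<bar>v x\<bar> / \<kappa>))"
      using Xi_nonneg h by (intro mult_left_mono) (auto simp: m_def max_def)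
    finally show "ennreal (Xi (\<bar>w x - v x\<bar> / (3 * \<kappa>))) \<le> ennreal h * (ennreal (Xi (\<bar>w x\<bar> / \<kappa>)) + ennreal (Xi (\<bar>v x\<bar> / \<kappa>)))"
      unfolding ennreal_plus[OF Xi_nonneg Xi_nonneg, symmetric] ennreal_mult'[OF h, symmetric] by (rule ennreal_leI)
  qed
  also have "\<dots> = ennreal h * ((\<integral>\<^sup>+x. ennreal (Xi (\<bar>w x\<bar> / \<kappa>)) \<partial>lebesgue_on \<Omega>) + (\<integral>\<^sup>+x. ennreal (Xi (\<bar>v x\<bar> / \<kappa>)) \<partial>lebesgue_on \<Omega>))"
    by (subst nn_integral_cmult, measurable) (subst nn_integral_add, measurable)
  also have "\<dots> \<le> ennreal h * (1 + 1)"
    by (intro mult_left_mono add_mono LXi_le_integral assms) auto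
  also have "\<dots> = ennreal (h * 2)" unfolding ennreal_mult'[OF h] by simp
  also have "\<dots> = 1" by (simp add: h_def)
  finally show ?thesis using \<kappa> by (simp add: LXi_le_def)
qed

lemma LXi_diff:
  assumes "w \<in> LXi \<Omega>" "v \<in> LXi \<Omega>"
  shows "(\<lambda>x. w x - v x) \<in> LXi \<Omega>"
proof -
  obtain a where a: "LXi_le \<Omega> a w" by (rule LXi_imp_LXi_le[OF assms(1)])
  obtain b where b: "LXi_le \<Omega> b v" by (rule LXi_imp_LXi_le[OF assms(2)])
  show ?thesis
    using LXi_le_diff[OF LXi_le_mono[OF a max.cobounded1[of a b]] LXi_le_mono[OF b max.cobounded2[of b a]]]
    by (rule LXi_le_imp_LXi)
qed

text \<open>Since z^2 <= \<open>Xi z\<close>, the integral of w^2 is at most \<kappa>^2 for every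
  positive \<kappa>.\<close>

lemma LXi_le_zero:
  assumes "\<And>\<kappa>. 0 < \<kappa> \<Longrightarrow> LXi_le \<Omega> \<kappa> w"
  shows "AE x in lebesgue_on \<Omega>. w x = 0"
proof -
  have [measurable]: "w \<in> borel_measurable (lebesgue_on \<Omega>)"
    using assms[of 1] by (simp add: LXi_le_def)
  have "(\<integral>\<^sup>+x. ennreal ((w x)\<^sup>2) \<partial>lebesgue_on \<Omega>) \<le> ennreal (\<kappa>\<^sup>2)" if "0 < \<kappa>" for \<kappa>
  proof -
    have "(\<integral>\<^sup>+x. ennreal ((w x)\<^sup>2) \<partial>lebesgue_on \<Omega>) \<le> (\<integral>\<^sup>+x. ennreal (\<kappa>\<^sup>2) * ennreal (Xi (\<bar>w x\<bar> / \<kappa>)) \<partial>lebesgue_on \<Omega>)"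
    proof (intro nn_integral_mono)
      fix x
      have "(w x)\<^sup>2 = \<kappa>\<^sup>2 * (\<bar>w x\<bar> / \<kappa>)\<^sup>2" using that by (simp add: power_divide)
      also have "\<dots> \<le> \<kappa>\<^sup>2 * Xi (\<bar>w x\<bar> / \<kappa>)" by (intro mult_left_mono Xi_ge_sq) simp
      finally show "ennreal ((w x)\<^sup>2) \<le> ennreal (\<kappa>\<^sup>2) * ennreal (Xi (\<bar>w x\<bar> / \<kappa>))"
        by (simp add: ennreal_mult'[symmetric] ennreal_leI)
    qed
    also have "\<dots> = ennreal (\<kappa>\<^sup>2) * (\<integral>\<^sup>+x. ennreal (Xi (\<bar>w x\<bar> / \<kappa>)) \<partial>lebesgue_on \<Omega>)"
      by (rule nn_integral_cmult) measurable
    also have "\<dots> \<le> ennreal (\<kappa>\<^sup>2) * 1" by (intro mult_left_mono LXi_le_integral assms that) simp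
    finally show ?thesis by simp
  qed
  then have est: "(\<integral>\<^sup>+x. ennreal ((w x)\<^sup>2) \<partial>lebesgue_on \<Omega>) \<le> ennreal e" if "0 < e" for e
    using that by (metis less_imp_le real_sqrt_gt_zero real_sqrt_pow2)
  have "(\<integral>\<^sup>+x. ennreal ((w x)\<^sup>2) \<partial>lebesgue_on \<Omega>) \<le> 0"
    by (rule ennreal_le_epsilon) (simp add: est)
  then have "AE x in lebesgue_on \<Omega>. ennreal ((w x)\<^sup>2) = 0"
    by (subst nn_integral_0_iff_AE[symmetric]) auto
  then show ?thesis by (auto elim!: eventually_mono)
qed

section \<open>Lipschitz bound for the nonlinearity\<close>

definition Hfun :: "real \<Rightarrow> real" where "Hfun z = z ^ 3 * exp (z\<^sup>2)"

lemma borel_measurable_Hfun [measurable]: "Hfun \<in> borel_measurable borel"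
  unfolding Hfun_def[abs_def] by measurable

text \<open>Mean value theorem. The polynomial factor 3 + 2 z^2 of the derivative is absorbed into a
  second exponential, which explains the exponent 2 m^2.\<close>

lemma Hfun_diff_le:
  assumes "\<bar>a\<bar> \<le> m" "\<bar>b\<bar> \<le> m"
  shows "\<bar>Hfun a - Hfun b\<bar> \<le> 3 * \<bar>a - b\<bar> * m\<^sup>2 * exp (2 * m\<^sup>2)"
proof -
  have D: "(Hfun has_real_derivative (3 * z\<^sup>2 + 2 * z ^ 4) * exp (z\<^sup>2)) (at z)" for z
    unfolding Hfun_def[abs_def]
    by (auto intro!: derivative_eq_intros simp: algebra_simps power2_eq_square power3_eq_cube power4_eq_xxxx)
  have bound: "\<bar>(3 * z\<^sup>2 + 2 * z ^ 4) * exp (z\<^sup>2)\<bar> \<le> 3 * m\<^sup>2 * exp (2 * m\<^sup>2)" if "\<bar>z\<bar> \<le> m" for z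
  proof -
    have z2: "z\<^sup>2 \<le> m\<^sup>2" using power_mono[OF that, of 2] by simp
    have "3 * z\<^sup>2 + 2 * z ^ 4 = z\<^sup>2 * (3 + 2 * z\<^sup>2)" by (simp add: power2_eq_square power4_eq_xxxx algebra_simps)
    also have "\<dots> \<le> m\<^sup>2 * (3 * exp (m\<^sup>2))"
    proof (intro mult_mono z2)
      show "3 + 2 * z\<^sup>2 \<le> 3 * exp (m\<^sup>2)"
        using exp_ge_add_one_self[of "m\<^sup>2"] z2 zero_le_power2[of m] by linarith
    qed auto
    finally have "(3 * z\<^sup>2 + 2 * z ^ 4) * exp (z\<^sup>2) \<le> m\<^sup>2 * (3 * exp (m\<^sup>2)) * exp (m\<^sup>2)"
      using z2 by (intro mult_mono) auto
    also have "\<dots> = 3 * m\<^sup>2 * exp (2 * m\<^sup>2)" by (simp add: mult_exp_exp)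
    finally show ?thesis by (simp add: abs_of_nonneg)
  qed
  have *: "\<bar>Hfun b - Hfun a\<bar> \<le> 3 * \<bar>b - a\<bar> * m\<^sup>2 * exp (2 * m\<^sup>2)" if ab: "a < b" "\<bar>a\<bar> \<le> m" "\<bar>b\<bar> \<le> m" for a b
  proof -
    obtain z where z: "a < z" "z < b" "Hfun b - Hfun a = (b - a) * ((3 * z\<^sup>2 + 2 * z ^ 4) * exp (z\<^sup>2))"
      using MVT2[OF ab(1) D] by blast
    have "\<bar>Hfun b - Hfun a\<bar> = \<bar>b - a\<bar> * \<bar>(3 * z\<^sup>2 + 2 * z ^ 4) * exp (z\<^sup>2)\<bar>" unfolding z(3) by (rule abs_mult)
    also have "\<dots> \<le> \<bar>b - a\<bar> * (3 * m\<^sup>2 * exp (2 * m\<^sup>2))"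
      using z ab by (intro mult_left_mono bound) auto
    finally show ?thesis by (simp add: mult_ac)
  qed
  consider "a < b" | "b < a" | "a = b" by linarith
  then show ?thesis
  proof cases
    case 1 then show ?thesis using *[of a b] assms by (simp add: abs_minus_commute)
  next
    case 2 then show ?thesis using *[of b a] assms by simp
  qed simp
qed

text \<open>Three powers of y are absorbed by exp (y / 4), with 1728 = 12^3 from y / 12 <= exp (y /
  12). The fourth is kept to match the zero of exp y - 1 at 0 and contributes the factor 2.\<close>

lemma fourth_power_exp_le:
  assumes "0 \<le> (y::real)"
  shows "y ^ 4 * exp (y / 4) \<le> 3456 * (exp y - 1)"
proof -
  have "(y / 12) ^ 3 \<le> (exp (y / 12)) ^ 3"
  proof (intro power_mono)
    show "y / 12 \<le> exp (y / 12)" using exp_ge_add_one_self[of "y / 12"] by linarith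
  qed (use assms in auto)
  also have "\<dots> = exp (y / 4)" by (simp add: exp_of_nat_mult[symmetric])
  finally have 1: "y ^ 3 \<le> 1728 * exp (y / 4)" by (simp add: power_divide)
  have "(y / 2) * exp (y / 2) \<le> (exp (y / 2) - 1) * (exp (y / 2) + 1)"
  proof (intro mult_mono)
    show "y / 2 \<le> exp (y / 2) - 1" using exp_ge_add_one_self[of "y / 2"] by linarith
  qed (use assms in auto)
  also have "\<dots> = exp y - 1" by (simp add: algebra_simps mult_exp_exp)
  finally have 2: "y * exp (y / 2) \<le> 2 * (exp y - 1)" by simp
  have "y ^ 4 * exp (y / 4) = y ^ 3 * (y * exp (y / 4))" by (simp add: power4_eq_xxxx power3_eq_cube)
  also have "\<dots> \<le> 1728 * exp (y / 4) * (y * exp (y / 4))" using 1 assms by (intro mult_right_mono) auto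
  also have "\<dots> = 1728 * (y * exp (y / 2))" by (simp add: mult_exp_exp)
  also have "\<dots> \<le> 1728 * (2 * (exp y - 1))" using 2 by simp
  finally show ?thesis by simp
qed

text \<open>Pointwise, Young's inequality separates the scaled difference p from the scaled size y;
  each part is then absorbed by \<open>Xi\<close>, whose integrals are at most 1.\<close>

lemma Hfun_lipschitz:
  assumes u: "LXi_le \<Omega> M u" and v: "LXi_le \<Omega> M v" and d: "LXi_le \<Omega> D (\<lambda>x. u x - v x)" and M: "M\<^sup>2 \<le> 1 / 32"
  shows "(\<lambda>x. Hfun (u x) - Hfun (v x)) \<in> L2 \<Omega>" "L2_norm \<Omega> (\<lambda>x. Hfun (u x) - Hfun (v x)) \<le> 200 * M\<^sup>2 * D"
proof -
  have [measurable]: "u \<in> borel_measurable (lebesgue_on \<Omega>)" "v \<in> borel_measurable (lebesgue_on \<Omega>)"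
    using u v by (auto simp: LXi_le_def)
  have pos: "M > 0" "D > 0" using u d by (auto simp: LXi_le_def)
  define K where "K = M ^ 4 * D\<^sup>2 * (9 / 2)"
  have K: "K \<ge> 0" using pos by (simp add: K_def)
  define c1 :: real where "c1 = 2"
  define c2 :: real where "c2 = 3456"
  have c: "c1 \<ge> 0" "c2 \<ge> 0" by (auto simp: c1_def c2_def)
  have pt: "(Hfun a - Hfun b)\<^sup>2 \<le> K * (c1 * Xi (\<bar>a - b\<bar> / D) + c2 * (Xi (\<bar>a\<bar> / M) + Xi (\<bar>b\<bar> / M)))" for a b
  proof -
    define m where "m = max \<bar>a\<bar> \<bar>b\<bar>"
    define p where "p = (\<bar>a - b\<bar> / D)\<^sup>2"
    define y where "y = (m / M)\<^sup>2"
    have y: "y \<ge> 0" "m\<^sup>2 = M\<^sup>2 * y" using pos by (auto simp: y_def power_divide)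
    \<comment> \<open>The origin of 1/32: squaring the pointwise bound gives exp (4 m^2), which is
      now at most exp (y / 8). Young's inequality squares once more, and exp (y / 4) is what
      \<open>fourth_power_exp_le\<close> admits.\<close>
    have "M\<^sup>2 * y \<le> 1 / 32 * y" using M y by (intro mult_right_mono)
    then have m4: "4 * m\<^sup>2 \<le> y / 8" using y by simp
    have "(Hfun a - Hfun b)\<^sup>2 \<le> (3 * \<bar>a - b\<bar> * m\<^sup>2 * exp (2 * m\<^sup>2))\<^sup>2"
      using Hfun_diff_le[of a m b] by (intro power2_le_iff_abs_le[THEN iffD2]) (auto simp: m_def)
    also have "\<dots> = 9 * \<bar>a - b\<bar>\<^sup>2 * (m\<^sup>2)\<^sup>2 * exp (4 * m\<^sup>2)"
      by (simp add: power_mult_distrib exp_of_nat_mult[symmetric])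
    also have "\<dots> \<le> 9 * \<bar>a - b\<bar>\<^sup>2 * (m\<^sup>2)\<^sup>2 * exp (y / 8)"
      using m4 by (intro mult_left_mono) auto
    also have "\<dots> = 9 * M ^ 4 * D\<^sup>2 * (p * (y\<^sup>2 * exp (y / 8)))"
      using pos unfolding y(2) p_def by (simp add: power_divide power2_eq_square power4_eq_xxxx)
    also have "\<dots> \<le> 9 * M ^ 4 * D\<^sup>2 * ((p\<^sup>2 + (y\<^sup>2 * exp (y / 8))\<^sup>2) / 2)"
      using sum_squares_bound[of p "y\<^sup>2 * exp (y / 8)"] pos by (intro mult_left_mono) auto
    also have "\<dots> = K * (p\<^sup>2 + y ^ 4 * exp (y / 4))"
      by (simp add: K_def power_mult_distrib exp_of_nat_mult[symmetric])
    also have "\<dots> \<le> K * (2 * (exp p - 1) + 3456 * (exp y - 1))"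
    proof (rule mult_left_mono[OF add_mono[OF _ fourth_power_exp_le[OF y(1)]] K])
      have "p \<ge> 0" by (simp add: p_def)
      then show "p\<^sup>2 \<le> 2 * (exp p - 1)" using exp_lower_Taylor_quadratic[of p] by simp
    qed
    also have "\<dots> \<le> K * (c1 * Xi (\<bar>a - b\<bar> / D) + c2 * (Xi (\<bar>a\<bar> / M) + Xi (\<bar>b\<bar> / M)))"
    proof (rule mult_left_mono[OF add_mono K])
      show "2 * (exp p - 1) \<le> c1 * Xi (\<bar>a - b\<bar> / D)" by (simp add: p_def Xi_def c1_def)
      have "exp y - 1 = Xi (m / M)" by (simp add: y_def Xi_def)
      also have "\<dots> \<le> Xi (\<bar>a\<bar> / M) + Xi (\<bar>b\<bar> / M)" using Xi_nonneg by (auto simp: m_def max_def)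
      finally show "3456 * (exp y - 1) \<le> c2 * (Xi (\<bar>a\<bar> / M) + Xi (\<bar>b\<bar> / M))" by (simp add: c2_def)
    qed
    finally show ?thesis .
  qed
  have "(\<integral>\<^sup>+x. ennreal ((Hfun (u x) - Hfun (v x))\<^sup>2) \<partial>lebesgue_on \<Omega>) \<le>
     (\<integral>\<^sup>+x. ennreal K * (ennreal c1 * ennreal (Xi (\<bar>u x - v x\<bar> / D)) + ennreal c2 * (ennreal (Xi (\<bar>u x\<bar> / M)) + ennreal (Xi (\<bar>v x\<bar> / M)))) \<partial>lebesgue_on \<Omega>)"
  proof (intro nn_integral_mono)
    fix x
    have "ennreal ((Hfun (u x) - Hfun (v x))\<^sup>2) \<le> ennreal (K * (c1 * Xi (\<bar>u x - v x\<bar> / D) + c2 * (Xi (\<bar>u x\<bar> / M) + Xi (\<bar>v x\<bar> / M))))"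
      by (intro ennreal_leI pt)
    also have "\<dots> = ennreal K * ennreal (c1 * Xi (\<bar>u x - v x\<bar> / D) + c2 * (Xi (\<bar>u x\<bar> / M) + Xi (\<bar>v x\<bar> / M)))"
      by (rule ennreal_mult'[OF K])
    also have "ennreal (c1 * Xi (\<bar>u x - v x\<bar> / D) + c2 * (Xi (\<bar>u x\<bar> / M) + Xi (\<bar>v x\<bar> / M))) = 
       ennreal (c1 * Xi (\<bar>u x - v x\<bar> / D)) + ennreal (c2 * (Xi (\<bar>u x\<bar> / M) + Xi (\<bar>v x\<bar> / M)))"
      using c Xi_nonneg by (intro ennreal_plus) (auto intro!: mult_nonneg_nonneg add_nonneg_nonneg)
    also have "\<dots> = ennreal c1 * ennreal (Xi (\<bar>u x - v x\<bar> / D)) + ennreal c2 * (ennreal (Xi (\<bar>u x\<bar> / M)) + ennreal (Xi (\<bar>v x\<bar> / M)))"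
      unfolding ennreal_plus[OF Xi_nonneg Xi_nonneg, symmetric] ennreal_mult'[OF c(1)] ennreal_mult'[OF c(2)] ..
    finally show "ennreal ((Hfun (u x) - Hfun (v x))\<^sup>2) \<le> ennreal K * (ennreal c1 * ennreal (Xi (\<bar>u x - v x\<bar> / D)) + ennreal c2 * (ennreal (Xi (\<bar>u x\<bar> / M)) + ennreal (Xi (\<bar>v x\<bar> / M))))" .
  qed
  also have "\<dots> = ennreal K * (ennreal c1 * (\<integral>\<^sup>+x. ennreal (Xi (\<bar>u x - v x\<bar> / D)) \<partial>lebesgue_on \<Omega>) +
     ennreal c2 * ((\<integral>\<^sup>+x. ennreal (Xi (\<bar>u x\<bar> / M)) \<partial>lebesgue_on \<Omega>) + (\<integral>\<^sup>+x. ennreal (Xi (\<bar>v x\<bar> / M)) \<partial>lebesgue_on \<Omega>)))"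
    by (simp add: nn_integral_cmult nn_integral_add)
  also have "\<dots> \<le> ennreal K * (ennreal c1 * 1 + ennreal c2 * (1 + 1))"
    by (intro mult_left_mono add_mono LXi_le_integral u v d) auto
  also have "\<dots> = ennreal (K * (c1 * 1 + c2 * (1 + 1)))"
  proof -
    have "(1 :: ennreal) + 1 = ennreal (1 + 1)" by simp
    moreover have "ennreal (c1 * 1 + c2 * (1 + 1)) = ennreal (c1 * 1) + ennreal (c2 * (1 + 1))"
      using c by (intro ennreal_plus) auto
    ultimately show ?thesis unfolding ennreal_mult'[OF K] ennreal_mult'[OF c(1)] ennreal_mult'[OF c(2)] by simp
  qed
  \<comment> \<open>9/2 * (2 + 2 * 3456) = 31113, which is below 200^2.\<close>
  also have "\<dots> \<le> ennreal ((200 * M\<^sup>2 * D)\<^sup>2)"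
    by (intro ennreal_leI) (simp add: K_def power_mult_distrib c1_def c2_def)
  finally have *: "(\<integral>\<^sup>+x. ennreal ((Hfun (u x) - Hfun (v x))\<^sup>2) \<partial>lebesgue_on \<Omega>) \<le> ennreal ((200 * M\<^sup>2 * D)\<^sup>2)" .
  have m: "(\<lambda>x. Hfun (u x) - Hfun (v x)) \<in> borel_measurable (lebesgue_on \<Omega>)" by measurable
  show "(\<lambda>x. Hfun (u x) - Hfun (v x)) \<in> L2 \<Omega>" "L2_norm \<Omega> (\<lambda>x. Hfun (u x) - Hfun (v x)) \<le> 200 * M\<^sup>2 * D"
    using L2_of_nn_integral_le[OF m *] pos by auto
qed

lemma Hfun_L2:
  assumes u: "LXi_le \<Omega> M u" and M: "M\<^sup>2 \<le> 1 / 32"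
  shows "(\<lambda>x. Hfun (u x)) \<in> L2 \<Omega>" "L2_norm \<Omega> (\<lambda>x. Hfun (u x)) \<le> 200 * M\<^sup>2 * M"
proof -
  have "LXi_le \<Omega> M (\<lambda>x. 0)" using LXi_le_pos[OF u] by (simp add: LXi_le_def Xi_def)
  from Hfun_lipschitz[OF u this _ M, of M] u
  show "(\<lambda>x. Hfun (u x)) \<in> L2 \<Omega>" "L2_norm \<Omega> (\<lambda>x. Hfun (u x)) \<le> 200 * M\<^sup>2 * M"
    by (auto simp: Hfun_def)
qed

section \<open>Bochner integrals in coordinates\<close>

context
  fixes \<Omega> :: "(real^2) set" and \<phi> :: "nat \<Rightarrow> real^2 \<Rightarrow> real"
  assumes basis: "complete_orthonormal \<Omega> \<phi>" and Omega: "\<Omega> \<in> lmeasurable"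
begin

text \<open>Supplies the explicit sets and coefficients demanded by \<open>has_L2_integral\<close>:
  level sets of the nonzero values, and functions having these values as coordinates.\<close>

lemma simple_function_L2_representation:
  assumes A: "A \<in> sets lebesgue" and s: "Bochner_Integration.simple_bochner_integrable (lebesgue_on A) (s :: real \<Rightarrow> ell2)"
  shows "\<exists>(m :: nat) B c. (\<forall>j<m. B j \<in> lmeasurable \<and> B j \<subseteq> A \<and> c j \<in> L2 \<Omega>) \<and>
    (\<forall>\<tau>\<in>A. L2_coord \<Omega> \<phi> (\<lambda>x. \<Sum>j<m. indicator (B j) \<tau> * c j x) = s \<tau>) \<and>
    L2_coord \<Omega> \<phi> (\<lambda>x. \<Sum>j<m. measure lebesgue (B j) * c j x) = Bochner_Integration.simple_bochner_integral (lebesgue_on A) s"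
proof -
  have sf: "simple_function (lebesgue_on A) s" and fin: "emeasure (lebesgue_on A) {y \<in> A. s y \<noteq> 0} \<noteq> \<infinity>"
    using s by (auto simp: Bochner_Integration.simple_bochner_integrable.simps)
  \<comment> \<open>The value 0 is left out because its level set may have infinite measure.\<close>
  define V where "V = s ` A - {0}"
  have "finite (s ` A)" using sf by (simp add: simple_function_def)
  then have "finite V" by (simp add: V_def)
  then obtain h where h: "bij_betw h {0..<card V} V" using ex_bij_betw_nat_finite by blast
  define m where "m = card V"
  define B where "B j = {\<tau> \<in> A. s \<tau> = h j}" for j
  have hV: "h j \<in> V" if "j < m" for j using bij_betwE[OF h] that by (auto simp: m_def)
  have Bset: "B j \<in> sets (lebesgue_on A)" for j
    using simple_functionD(2)[OF sf, of "{h j}"] by (simp add: B_def vimage_def Int_def conj_commute)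
  have Bleb: "B j \<in> sets lebesgue" for j
    using Bset[of j] A by (auto simp: sets_restrict_space_iff)
  have Blm: "B j \<in> lmeasurable" if "j < m" for j
  proof (rule fmeasurableI[OF Bleb])
    have "emeasure lebesgue (B j) = emeasure (lebesgue_on A) (B j)"
      using A by (subst emeasure_restrict_space) (auto simp: B_def)
    also have "\<dots> \<le> emeasure (lebesgue_on A) {y \<in> A. s y \<noteq> 0}"
    proof (rule emeasure_mono)
      show "B j \<subseteq> {y \<in> A. s y \<noteq> 0}" using hV[OF that] by (auto simp: B_def V_def)
      have "{y \<in> space (lebesgue_on A). s y \<noteq> 0} \<in> sets (lebesgue_on A)"
        using borel_measurable_simple_function[OF sf] by measurable
      then show "{y \<in> A. s y \<noteq> 0} \<in> sets (lebesgue_on A)" by simp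
    qed
    also have "\<dots> < \<infinity>" using fin by (simp add: top.not_eq_extremum)
    finally show "emeasure lebesgue (B j) < \<infinity>" .
  qed
  have reindex: "(\<Sum>j<m. f (h j)) = (\<Sum>y\<in>V. f y)" for f :: "ell2 \<Rightarrow> ell2"
    using sum.reindex_bij_betw[OF h, of f] by (simp add: m_def atLeast0LessThan)
  have c: "L2_coord \<Omega> \<phi> (\<lambda>x. \<Sum>j<m. a j * L2_of \<Omega> \<phi> (h j) x) = (\<Sum>j<m. a j *\<^sub>R h j)" for a
    by (simp add: L2_coord_sum[OF basis Omega] L2_coord_scale[OF basis Omega] L2_of_L2[OF basis Omega] L2_scale L2_coord_L2_of[OF basis Omega])
  have 1: "(\<Sum>j<m. indicator (B j) \<tau> *\<^sub>R h j) = s \<tau>" if "\<tau> \<in> A" for \<tau>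
  proof -
    have "(\<Sum>j<m. indicator (B j) \<tau> *\<^sub>R h j) = (\<Sum>j<m. (\<lambda>y. if y = s \<tau> then y else 0) (h j))"
      using that by (intro sum.cong) (auto simp: B_def indicator_def)
    also have "\<dots> = (\<Sum>y\<in>V. if y = s \<tau> then y else 0)" by (rule reindex)
    also have "\<dots> = s \<tau>" using \<open>finite V\<close> that by (auto simp: V_def)
    finally show ?thesis .
  qed
  have 2: "(\<Sum>j<m. measure lebesgue (B j) *\<^sub>R h j) = Bochner_Integration.simple_bochner_integral (lebesgue_on A) s"
  proof -
    have "(\<Sum>j<m. measure lebesgue (B j) *\<^sub>R h j) = (\<Sum>j<m. (\<lambda>y. measure (lebesgue_on A) {\<tau> \<in> A. s \<tau> = y} *\<^sub>R y) (h j))"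
      using A by (intro sum.cong) (auto simp: B_def measure_restrict_space)
    also have "\<dots> = (\<Sum>y\<in>V. measure (lebesgue_on A) {\<tau> \<in> A. s \<tau> = y} *\<^sub>R y)" by (rule reindex)
    also have "\<dots> = (\<Sum>y\<in>s ` A. measure (lebesgue_on A) {\<tau> \<in> A. s \<tau> = y} *\<^sub>R y)"
      unfolding V_def using \<open>finite (s ` A)\<close> by (intro sum.mono_neutral_left) auto
    finally show ?thesis by (simp add: simple_bochner_integral_def)
  qed
  show ?thesis
  proof (rule exI[of _ m], rule exI[of _ B], rule exI[of _ "\<lambda>j. L2_of \<Omega> \<phi> (h j)"], intro conjI ballI)
    show "\<forall>j<m. B j \<in> lmeasurable \<and> B j \<subseteq> A \<and> L2_of \<Omega> \<phi> (h j) \<in> L2 \<Omega>"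
      using Blm by (auto simp: B_def L2_of_L2[OF basis Omega])
    show "L2_coord \<Omega> \<phi> (\<lambda>x. \<Sum>j<m. indicator (B j) \<tau> * L2_of \<Omega> \<phi> (h j) x) = s \<tau>" if "\<tau> \<in> A" for \<tau>
      by (rule trans[OF c 1[OF that]])
    show "L2_coord \<Omega> \<phi> (\<lambda>x. \<Sum>j<m. measure lebesgue (B j) * L2_of \<Omega> \<phi> (h j) x) = Bochner_Integration.simple_bochner_integral (lebesgue_on A) s"
      by (rule trans[OF c 2])
  qed
qed

text \<open>Coordinates are an isometry, so the simple functions approximating \<open>G\<close>
  translate into approximants of \<open>F\<close> with the same errors.\<close>

lemma has_L2_integral_of_bochner:
  assumes A: "A \<in> sets lebesgue" and G: "has_bochner_integral (lebesgue_on A) G z"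
    and FG: "\<And>\<tau>. \<tau> \<in> A \<Longrightarrow> F \<tau> = L2_of \<Omega> \<phi> (G \<tau>)"
  shows "has_L2_integral \<Omega> F (L2_of \<Omega> \<phi> z) A"
proof -
  obtain s where s: "\<And>i. Bochner_Integration.simple_bochner_integrable (lebesgue_on A) (s i)"
    and lim: "(\<lambda>i. \<integral>\<^sup>+x. norm (G x - s i x) \<partial>lebesgue_on A) \<longlonglongrightarrow> 0"
    and lim_int: "(\<lambda>i. Bochner_Integration.simple_bochner_integral (lebesgue_on A) (s i)) \<longlonglongrightarrow> z"
    using G by (auto elim!: has_bochner_integral.cases)
  define P where "P i m B c \<longleftrightarrow> (\<forall>j<m. B j \<in> lmeasurable \<and> B j \<subseteq> A \<and> c j \<in> L2 \<Omega>) \<and>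
    (\<forall>\<tau>\<in>A. L2_coord \<Omega> \<phi> (\<lambda>x. \<Sum>j<m. indicator (B j) \<tau> * c j x) = s i \<tau>) \<and>
    L2_coord \<Omega> \<phi> (\<lambda>x. \<Sum>j<m. measure lebesgue (B j) * c j x) = Bochner_Integration.simple_bochner_integral (lebesgue_on A) (s i)" 
    for i and m :: nat and B c
  have "\<forall>i. \<exists>m B c. P i m B c"
    unfolding P_def by (intro allI simple_function_L2_representation A s)
  from choice[OF this] obtain m where "\<forall>i. \<exists>B c. P i (m i) B c" ..
  from choice[OF this] obtain B where "\<forall>i. \<exists>c. P i (m i) (B i) c" ..
  from choice[OF this] obtain c where "\<forall>i. P i (m i) (B i) (c i)" ..
  then have P: "\<And>i j. j < m i \<Longrightarrow> B i j \<in> lmeasurable \<and> B i j \<subseteq> A \<and> c i j \<in> L2 \<Omega>"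
    "\<And>i \<tau>. \<tau> \<in> A \<Longrightarrow> L2_coord \<Omega> \<phi> (\<lambda>x. \<Sum>j<m i. indicator (B i j) \<tau> * c i j x) = s i \<tau>"
    "\<And>i. L2_coord \<Omega> \<phi> (\<lambda>x. \<Sum>j<m i. measure lebesgue (B i j) * c i j x) = Bochner_Integration.simple_bochner_integral (lebesgue_on A) (s i)"
    unfolding P_def by auto
  have cL: "(\<lambda>x. \<Sum>j<m i. a j * c i j x) \<in> L2 \<Omega>" for i a
    using P(1) by (intro L2_sum L2_scale) auto
  have norm_eq: "L2_norm \<Omega> (\<lambda>x. F \<tau> x - (\<Sum>j<m i. indicator (B i j) \<tau> * c i j x)) = norm (G \<tau> - s i \<tau>)" if "\<tau> \<in> A" for i \<tau>
    unfolding FG[OF that] P(2)[OF that, symmetric]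
    by (subst norm_L2_coord[OF basis Omega, symmetric], intro L2_diff cL L2_of_L2[OF basis Omega])
      (simp only: L2_coord_diff[OF basis Omega] cL L2_of_L2[OF basis Omega] L2_coord_L2_of[OF basis Omega])
  have int: "integrable (lebesgue_on A) (\<lambda>\<tau>. norm (G \<tau> - s i \<tau>))" for i
    using G has_bochner_integral_simple_bochner_integrable[OF s[of i]]
    by (intro integrable_norm Bochner_Integration.integrable_diff) (auto intro: integrable.intros)
  have int': "integrable (lebesgue_on A) (\<lambda>\<tau>. L2_norm \<Omega> (\<lambda>x. F \<tau> x - (\<Sum>j<m i. indicator (B i j) \<tau> * c i j x)))" for i
    using int[of i] by (subst Bochner_Integration.integrable_cong[OF refl norm_eq]) auto
  have "(\<lambda>i. ennreal (LINT \<tau>|lebesgue_on A. norm (G \<tau> - s i \<tau>))) \<longlonglongrightarrow> ennreal 0"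
    using lim by (subst nn_integral_eq_integral[OF int, symmetric]) auto
  then have "(\<lambda>i. LINT \<tau>|lebesgue_on A. norm (G \<tau> - s i \<tau>)) \<longlonglongrightarrow> 0"
    by (subst (asm) tendsto_ennreal_iff) (auto intro!: always_eventually Bochner_Integration.integral_nonneg)
  moreover have "(LINT \<tau>|lebesgue_on A. L2_norm \<Omega> (\<lambda>x. F \<tau> x - (\<Sum>j<m i. indicator (B i j) \<tau> * c i j x))) = (LINT \<tau>|lebesgue_on A. norm (G \<tau> - s i \<tau>))" for i
    by (intro Bochner_Integration.integral_cong refl norm_eq) simp
  ultimately have l1: "(\<lambda>i. LINT \<tau>|lebesgue_on A. L2_norm \<Omega> (\<lambda>x. F \<tau> x - (\<Sum>j<m i. indicator (B i j) \<tau> * c i j x))) \<longlonglongrightarrow> 0"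
    by simp
  have "L2_norm \<Omega> (\<lambda>x. (\<Sum>j<m i. measure lebesgue (B i j) * c i j x) - L2_of \<Omega> \<phi> z x) = norm (Bochner_Integration.simple_bochner_integral (lebesgue_on A) (s i) - z)" for i
    by (simp add: norm_L2_coord[OF basis Omega, symmetric] L2_coord_diff[OF basis Omega] L2_diff cL
      L2_of_L2[OF basis Omega] L2_coord_L2_of[OF basis Omega] P(3))
  then have l2: "(\<lambda>i. L2_norm \<Omega> (\<lambda>x. (\<Sum>j<m i. measure lebesgue (B i j) * c i j x) - L2_of \<Omega> \<phi> z x)) \<longlonglongrightarrow> 0"
    using tendsto_norm_zero[OF LIM_zero[OF lim_int]] by simp
  have ae: "AE \<tau> in lebesgue_on A. F \<tau> \<in> L2 \<Omega>"
    by (rule AE_I2) (simp add: FG L2_of_L2[OF basis Omega])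
  show ?thesis unfolding has_L2_integral_def
    by (intro conjI ae L2_of_L2[OF basis Omega] exI[of _ m] exI[of _ B] exI[of _ c] allI impI int' l1 l2) (use P(1) in auto)
qed

text \<open>The converse translation, needed for a competitor whose integral J is merely given: it
  determines J up to a null set, whichever approximants define it.\<close>

lemma has_L2_integral_coord:
  assumes A: "A \<in> sets lebesgue" and F: "has_L2_integral \<Omega> F J A" and G: "integrable (lebesgue_on A) G"
    and FG: "AE \<tau> in lebesgue_on A. F \<tau> \<in> L2 \<Omega> \<longrightarrow> L2_coord \<Omega> \<phi> (F \<tau>) = G \<tau>"
  shows "L2_coord \<Omega> \<phi> J = (LINT \<tau>|lebesgue_on A. G \<tau>)"
proof -
  have aeF: "AE \<tau> in lebesgue_on A. F \<tau> \<in> L2 \<Omega>" and J: "J \<in> L2 \<Omega>"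
    using F unfolding has_L2_integral_def by auto
  define Q where "Q m B c \<longleftrightarrow> (\<forall>n. \<forall>j<m n. B n j \<in> lmeasurable \<and> B n j \<subseteq> A \<and> c n j \<in> L2 \<Omega>) \<and>
    (\<forall>n. integrable (lebesgue_on A) (\<lambda>\<tau>. L2_norm \<Omega> (\<lambda>x. F \<tau> x - (\<Sum>j<m n. indicator (B n j) \<tau> * c n j x)))) \<and>
    (\<lambda>n. LINT \<tau>|lebesgue_on A. L2_norm \<Omega> (\<lambda>x. F \<tau> x - (\<Sum>j<m n. indicator (B n j) \<tau> * c n j x))) \<longlonglongrightarrow> 0 \<and>
    (\<lambda>n. L2_norm \<Omega> (\<lambda>x. (\<Sum>j<m n. measure lebesgue (B n j) * c n j x) - J x)) \<longlonglongrightarrow> 0"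
    for m :: "nat \<Rightarrow> nat" and B c
  have "\<exists>m B c. Q m B c" using F unfolding has_L2_integral_def Q_def by (elim conjE)
  then obtain m B c where "Q m B c" by (elim exE)
  then have P: "\<And>i j. j < m i \<Longrightarrow> B i j \<in> lmeasurable \<and> B i j \<subseteq> A \<and> c i j \<in> L2 \<Omega>"
    and int: "\<And>i. integrable (lebesgue_on A) (\<lambda>\<tau>. L2_norm \<Omega> (\<lambda>x. F \<tau> x - (\<Sum>j<m i. indicator (B i j) \<tau> * c i j x)))"
    and l1: "(\<lambda>i. LINT \<tau>|lebesgue_on A. L2_norm \<Omega> (\<lambda>x. F \<tau> x - (\<Sum>j<m i. indicator (B i j) \<tau> * c i j x))) \<longlonglongrightarrow> 0"
    and l2: "(\<lambda>i. L2_norm \<Omega> (\<lambda>x. (\<Sum>j<m i. measure lebesgue (B i j) * c i j x) - J x)) \<longlonglongrightarrow> 0"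
    unfolding Q_def by blast+
  define s where "s i \<tau> = (\<Sum>j<m i. indicator (B i j) \<tau> *\<^sub>R L2_coord \<Omega> \<phi> (c i j))" for i and \<tau> :: real
  define I where "I i = (\<Sum>j<m i. measure lebesgue (B i j) *\<^sub>R L2_coord \<Omega> \<phi> (c i j))" for i
  have cL: "(\<lambda>x. \<Sum>j<m i. a j * c i j x) \<in> L2 \<Omega>" for i a
    using P by (intro L2_sum L2_scale) auto
  have coord_sum_c: "L2_coord \<Omega> \<phi> (\<lambda>x. \<Sum>j<m i. a j * c i j x) = (\<Sum>j<m i. a j *\<^sub>R L2_coord \<Omega> \<phi> (c i j))" for i a
  proof -
    have "L2_coord \<Omega> \<phi> (\<lambda>x. \<Sum>j<m i. a j * c i j x) = (\<Sum>j<m i. L2_coord \<Omega> \<phi> (\<lambda>x. a j * c i j x))"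
      by (rule L2_coord_sum[OF basis Omega]) (use P in \<open>auto intro: L2_scale\<close>)
    also have "\<dots> = (\<Sum>j<m i. a j *\<^sub>R L2_coord \<Omega> \<phi> (c i j))"
      using P by (intro sum.cong refl L2_coord_scale[OF basis Omega]) auto
    finally show ?thesis .
  qed
  have hs: "has_bochner_integral (lebesgue_on A) (s i) (I i)" for i
    unfolding s_def I_def
  proof (intro has_bochner_integral_sum)
    fix j assume j: "j \<in> {..<m i}"
    have B: "B i j \<in> lmeasurable" "B i j \<subseteq> A" using P j by auto
    have e: "emeasure (lebesgue_on A) (B i j) = emeasure lebesgue (B i j)"
      using A B by (intro emeasure_restrict_space) auto
    have "has_bochner_integral (lebesgue_on A) (\<lambda>\<tau>. indicator (B i j) \<tau> *\<^sub>R L2_coord \<Omega> \<phi> (c i j)) (measure (lebesgue_on A) (B i j) *\<^sub>R L2_coord \<Omega> \<phi> (c i j))"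
      using B A e fmeasurableD2[OF B(1)] by (intro has_bochner_integral_scaleR_left has_bochner_integral_real_indicator) 
        (auto simp: sets_restrict_space_iff fmeasurableD top.not_eq_extremum)
    then show "has_bochner_integral (lebesgue_on A) (\<lambda>\<tau>. indicator (B i j) \<tau> *\<^sub>R L2_coord \<Omega> \<phi> (c i j)) (measure lebesgue (B i j) *\<^sub>R L2_coord \<Omega> \<phi> (c i j))"
      by (simp add: measure_def e)
  qed
  \<comment> \<open>The error of the i-th approximating integral is bounded by the L^1 distance that
    tends to 0 by definition; hence \<open>I\<close> converges to the integral of \<open>G\<close>
    as well as to the coordinates of J.\<close>
  have le: "norm ((LINT \<tau>|lebesgue_on A. G \<tau>) - I i) \<le> (LINT \<tau>|lebesgue_on A. L2_norm \<Omega> (\<lambda>x. F \<tau> x - (\<Sum>j<m i. indicator (B i j) \<tau> * c i j x)))" for i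
  proof -
    have si: "integrable (lebesgue_on A) (s i)" using hs by (rule integrable.intros)
    have "(LINT \<tau>|lebesgue_on A. G \<tau>) - I i = (LINT \<tau>|lebesgue_on A. G \<tau> - s i \<tau>)"
      using G si by (simp add: has_bochner_integral_integral_eq[OF hs])
    also have "norm \<dots> \<le> (LINT \<tau>|lebesgue_on A. norm (G \<tau> - s i \<tau>))" by (rule integral_norm_bound)
    also have "\<dots> = (LINT \<tau>|lebesgue_on A. L2_norm \<Omega> (\<lambda>x. F \<tau> x - (\<Sum>j<m i. indicator (B i j) \<tau> * c i j x)))"
    proof (rule integral_cong_AE)
      show "(\<lambda>\<tau>. norm (G \<tau> - s i \<tau>)) \<in> borel_measurable (lebesgue_on A)" using G si by measurable
      show "(\<lambda>\<tau>. L2_norm \<Omega> (\<lambda>x. F \<tau> x - (\<Sum>j<m i. indicator (B i j) \<tau> * c i j x))) \<in> borel_measurable (lebesgue_on A)"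
        using int[of i] by (rule borel_measurable_integrable)
      show "AE \<tau> in lebesgue_on A. norm (G \<tau> - s i \<tau>) = L2_norm \<Omega> (\<lambda>x. F \<tau> x - (\<Sum>j<m i. indicator (B i j) \<tau> * c i j x))"
        using FG aeF
      proof eventually_elim
        case (elim \<tau>)
        then have FL: "F \<tau> \<in> L2 \<Omega>" "G \<tau> = L2_coord \<Omega> \<phi> (F \<tau>)" by auto
        show ?case unfolding s_def FL(2) coord_sum_c[symmetric] L2_coord_diff[OF basis Omega FL(1) cL, symmetric]
          by (intro norm_L2_coord[OF basis Omega] L2_diff FL cL)
      qed
    qed
    finally show ?thesis .
  qed
  have "(\<lambda>i. norm ((LINT \<tau>|lebesgue_on A. G \<tau>) - I i)) \<longlonglongrightarrow> 0"
    by (rule Lim_null_comparison[OF _ l1]) (use le in auto)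
  then have "(\<lambda>i. I i - (LINT \<tau>|lebesgue_on A. G \<tau>)) \<longlonglongrightarrow> 0"
    by (subst (asm) norm_minus_commute) (simp only: tendsto_norm_zero_iff)
  then have 1: "I \<longlonglongrightarrow> (LINT \<tau>|lebesgue_on A. G \<tau>)" by (rule LIM_zero_cancel)
  have "L2_norm \<Omega> (\<lambda>x. (\<Sum>j<m i. measure lebesgue (B i j) * c i j x) - J x) = norm (I i - L2_coord \<Omega> \<phi> J)" for i
    by (simp add: norm_L2_coord[OF basis Omega, symmetric] L2_coord_diff[OF basis Omega] L2_diff cL J coord_sum_c I_def)
  then have "(\<lambda>i. I i - L2_coord \<Omega> \<phi> J) \<longlonglongrightarrow> 0" using l2 by (simp only: tendsto_norm_zero_iff)
  then have 2: "I \<longlonglongrightarrow> L2_coord \<Omega> \<phi> J" by (rule LIM_zero_cancel)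
  show ?thesis by (rule LIMSEQ_unique[OF 2 1])
qed

end

section \<open>The solution operators in coordinates\<close>

text \<open>The eigenvalues of (1 - \<Delta>)^(-1) (-\<Delta>), which is what remains after
  inverting the operator under the time derivative.\<close>

definition lam :: "(nat \<Rightarrow> real) \<Rightarrow> nat \<Rightarrow> real" where
  "lam \<theta> k = \<theta> k / (1 + \<theta> k)"

definition S_mult :: "real \<Rightarrow> (nat \<Rightarrow> real) \<Rightarrow> real \<Rightarrow> nat \<Rightarrow> real" where
  "S_mult \<alpha> \<theta> t k = mittag_leffler \<alpha> 1 (- \<theta> k * t powr \<alpha> / (1 + \<theta> k))"

definition R_mult :: "real \<Rightarrow> (nat \<Rightarrow> real) \<Rightarrow> real \<Rightarrow> nat \<Rightarrow> real" where
  "R_mult \<alpha> \<theta> t k = t powr (\<alpha> - 1) / (1 + \<theta> k) * mittag_leffler \<alpha> \<alpha> (- \<theta> k * t powr \<alpha> / (1 + \<theta> k))"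

text \<open>\<open>D1_mult\<close> turns coordinates that are isometric to the energy norm into \<open>L\<^sup>2\<close> coordinates.\<close>

definition D1_mult :: "(nat \<Rightarrow> real) \<Rightarrow> nat \<Rightarrow> real" where
  "D1_mult \<theta> k = 1 / sqrt (\<theta> k)"

text \<open>Maps L^2 coordinates of the source to energy coordinates of the solution, hence the
  additional \<open>sqrt (\<theta> k)\<close>.\<close>

definition Q_mult :: "real \<Rightarrow> (nat \<Rightarrow> real) \<Rightarrow> real \<Rightarrow> nat \<Rightarrow> real" where
  "Q_mult \<alpha> \<theta> t k = sqrt (\<theta> k) * R_mult \<alpha> \<theta> t k"

text \<open>Written in the elapsed time s = t - \<tau>, so that the singular kernel stays fixed
  while t varies and dominated convergence gives continuity. For t <= 0 the value is 0.\<close>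

definition duhamel :: "real \<Rightarrow> (nat \<Rightarrow> real) \<Rightarrow> (real \<Rightarrow> ell2) \<Rightarrow> real \<Rightarrow> ell2" where
  "duhamel \<alpha> \<theta> y t = (LINT s|lborel. indicator {0<..t} s *\<^sub>R diag (Q_mult \<alpha> \<theta> s) (y (t - s)))"

lemma S_op_eq:
  assumes "complete_orthonormal \<Omega> \<phi>" "\<Omega> \<in> lmeasurable" "w \<in> L2 \<Omega>" "\<And>k. \<bar>S_mult \<alpha> \<theta> t k\<bar> \<le> B"
  shows "S_op \<Omega> \<theta> \<phi> \<alpha> t w = L2_of \<Omega> \<phi> (diag (S_mult \<alpha> \<theta> t) (L2_coord \<Omega> \<phi> w))"
  unfolding S_op_def L2_of_def coord_diag[OF assms(4)] coord_L2_coord[OF assms(1-3)] S_mult_def ..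

lemma R_op_eq:
  assumes "complete_orthonormal \<Omega> \<phi>" "\<Omega> \<in> lmeasurable" "w \<in> L2 \<Omega>" "\<And>k. \<bar>R_mult \<alpha> \<theta> t k\<bar> \<le> B"
  shows "R_op \<Omega> \<theta> \<phi> \<alpha> t w = L2_of \<Omega> \<phi> (diag (R_mult \<alpha> \<theta> t) (L2_coord \<Omega> \<phi> w))"
  unfolding R_op_def L2_of_def coord_diag[OF assms(4)] coord_L2_coord[OF assms(1-3)] R_mult_def ..

context
  fixes \<alpha> :: real and \<theta> :: "nat \<Rightarrow> real"
  assumes alpha: "0 < \<alpha>" "\<alpha> < 1" and theta_pos: "\<And>k. 0 < \<theta> k" and theta_mono: "mono \<theta>"
begin

lemma lam_bounds: "0 < lam \<theta> k" "lam \<theta> 0 \<le> lam \<theta> k"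
proof -
  show "0 < lam \<theta> k" using theta_pos[of k] by (simp add: lam_def)
  have "\<theta> 0 \<le> \<theta> k" using theta_mono by (simp add: monoD)
  then show "lam \<theta> 0 \<le> lam \<theta> k"
    using theta_pos[of k] theta_pos[of 0] by (simp add: lam_def field_simps)
qed

lemma lam_arg: "- \<theta> k * x / (1 + \<theta> k) = - lam \<theta> k * x"
  by (simp add: lam_def)

lemma S_mult_bounds: "0 \<le> t \<Longrightarrow> \<bar>S_mult \<alpha> \<theta> t k\<bar> \<le> 1"
  using mittag_leffler_bounds[OF alpha lam_bounds(1)] by (simp only: S_mult_def lam_arg abs_of_nonneg)

lemma R_mult_eq: "R_mult \<alpha> \<theta> t k = ml_ker \<alpha> (lam \<theta> k) \<alpha> t / (1 + \<theta> k)"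
  unfolding R_mult_def lam_arg ml_ker_def by simp

lemma ml_ker_lam_bounds:
  assumes "0 < t"
  shows "0 < ml_ker \<alpha> (lam \<theta> k) \<alpha> t" "ml_ker \<alpha> (lam \<theta> k) \<alpha> t \<le> ml_ker \<alpha> (lam \<theta> 0) \<alpha> t"
  using ml_ker_pos[OF alpha(1) _ lam_bounds(1) assms] alpha
    ml_ker_antimono[OF alpha(1) _ lam_bounds(1) lam_bounds(2) assms] by auto

lemma R_mult_bound:
  assumes "0 < t"
  shows "\<bar>R_mult \<alpha> \<theta> t k\<bar> \<le> ml_ker \<alpha> (lam \<theta> 0) \<alpha> t"
proof -
  have "\<bar>R_mult \<alpha> \<theta> t k\<bar> = ml_ker \<alpha> (lam \<theta> k) \<alpha> t / (1 + \<theta> k)"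
    using ml_ker_lam_bounds(1)[OF assms, of k] theta_pos[of k] by (simp add: R_mult_eq)
  also have "\<dots> \<le> ml_ker \<alpha> (lam \<theta> k) \<alpha> t / 1"
    using ml_ker_lam_bounds(1)[OF assms, of k] theta_pos[of k] by (intro divide_left_mono) auto
  finally show ?thesis using ml_ker_lam_bounds(2)[OF assms, of k] by simp
qed

text \<open>At the singularity \<open>powr\<close> has the default value 0, also for a negative
  exponent; this fixes the integrand at the end point \<tau> = t.\<close>

lemma R_mult_0: "R_mult \<alpha> \<theta> 0 k = 0"
  by (simp add: R_mult_def)

text \<open>The gain from L^2 to the energy space: \<open>sqrt (\<theta> k)\<close> is compensated
  by the factor 1 / (1 + \<open>\<theta> k\<close>) that stems from the term with the time
  derivative of the Laplacian.\<close>

lemma Q_mult_bound: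
  assumes "0 < t"
  shows "\<bar>Q_mult \<alpha> \<theta> t k\<bar> \<le> ml_ker \<alpha> (lam \<theta> 0) \<alpha> t"
proof -
  have "sqrt (\<theta> k) \<le> 1 + \<theta> k"
    using theta_pos[of k] by (intro real_le_lsqrt) (auto simp: power2_eq_square algebra_simps intro!: add_nonneg_nonneg)
  then have s: "sqrt (\<theta> k) / (1 + \<theta> k) \<le> 1" using theta_pos[of k] by simp
  have "\<bar>Q_mult \<alpha> \<theta> t k\<bar> = sqrt (\<theta> k) / (1 + \<theta> k) * ml_ker \<alpha> (lam \<theta> k) \<alpha> t"
    using ml_ker_lam_bounds(1)[OF assms, of k] theta_pos[of k] by (simp add: Q_mult_def R_mult_eq abs_mult)
  also have "\<dots> \<le> 1 * ml_ker \<alpha> (lam \<theta> k) \<alpha> t"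
    using ml_ker_lam_bounds(1)[OF assms, of k] by (intro mult_right_mono s) auto
  finally show ?thesis using ml_ker_lam_bounds(2)[OF assms, of k] by simp
qed

lemma coord_diag_Q_mult:
  assumes "0 < t"
  shows "coord (diag (Q_mult \<alpha> \<theta> t) x) k = Q_mult \<alpha> \<theta> t k * coord x k"
  using Q_mult_bound[OF assms] by (rule coord_diag)

lemma D1_mult_bound: "\<bar>D1_mult \<theta> k\<bar> \<le> 1 / sqrt (\<theta> 0)"
proof -
  have "\<theta> 0 \<le> \<theta> k" using theta_mono by (simp add: monoD)
  then show ?thesis using theta_pos[of 0] theta_pos[of k] by (simp add: D1_mult_def frac_le)
qed

lemma D1_mult_Q_mult: "D1_mult \<theta> k * Q_mult \<alpha> \<theta> t k = R_mult \<alpha> \<theta> t k"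
  using theta_pos[of k] by (simp add: D1_mult_def Q_mult_def)

lemma kernel_integral:
  shows "integrable lborel (\<lambda>s. indicator {0<..t} s * ml_ker \<alpha> (lam \<theta> 0) \<alpha> s)"
    and "(LINT s|lborel. indicator {0<..t} s * ml_ker \<alpha> (lam \<theta> 0) \<alpha> s) \<le> 1 / lam \<theta> 0"
proof -
  have "integrable lborel (\<lambda>s. indicator {0<..t} s * ml_ker \<alpha> (lam \<theta> 0) \<alpha> s) \<and>
    (LINT s|lborel. indicator {0<..t} s * ml_ker \<alpha> (lam \<theta> 0) \<alpha> s) \<le> 1 / lam \<theta> 0"
  proof (cases "t > 0")
    case True
    note [measurable] = borel_measurable_ml_ker[OF alpha(1) alpha(1)]
    have "has_bochner_integral lborel (\<lambda>s. indicator {0<..<t} s * ml_ker \<alpha> (lam \<theta> 0) \<alpha> s)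
           ((1 - mittag_leffler \<alpha> 1 (- lam \<theta> 0 * t powr \<alpha>)) / lam \<theta> 0)"
      by (rule ml_ker_integral[OF alpha(1) lam_bounds(1) True])
    moreover have "AE s in lborel. (indicator {0<..<t} s * ml_ker \<alpha> (lam \<theta> 0) \<alpha> s :: real) = indicator {0<..t} s * ml_ker \<alpha> (lam \<theta> 0) \<alpha> s"
      using AE_lborel_singleton[of t] by eventually_elim (auto simp: indicator_def)
    ultimately have "has_bochner_integral lborel (\<lambda>s. indicator {0<..t} s * ml_ker \<alpha> (lam \<theta> 0) \<alpha> s)
           ((1 - mittag_leffler \<alpha> 1 (- lam \<theta> 0 * t powr \<alpha>)) / lam \<theta> 0)"
      by (subst has_bochner_integral_cong_AE[symmetric]) auto
    moreover have "(1 - mittag_leffler \<alpha> 1 (- lam \<theta> 0 * t powr \<alpha>)) / lam \<theta> 0 \<le> 1 / lam \<theta> 0"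
      using mittag_leffler_bounds(1)[OF alpha lam_bounds(1)[of 0], of t] True lam_bounds(1)[of 0] by (intro divide_right_mono) auto
    ultimately show ?thesis by (simp add: has_bochner_integral_iff)
  next
    case False
    then have "{0<..t} = {}" by auto
    then show ?thesis using lam_bounds(1)[of 0] by simp
  qed
  then show "integrable lborel (\<lambda>s. indicator {0<..t} s * ml_ker \<alpha> (lam \<theta> 0) \<alpha> s)"
    and "(LINT s|lborel. indicator {0<..t} s * ml_ker \<alpha> (lam \<theta> 0) \<alpha> s) \<le> 1 / lam \<theta> 0" by auto
qed

section \<open>The Duhamel operator in energy coordinates\<close>

lemma duhamel_integrand_measurable:
  assumes [measurable]: "y \<in> borel_measurable borel"
  shows "(\<lambda>s. indicator {0<..t} s *\<^sub>R diag (Q_mult \<alpha> \<theta> s) (y (t - s))) \<in> borel_measurable lborel"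
proof (rule borel_measurable_ell2I)
  fix k
  note [measurable] = borel_measurable_ml_ker[OF alpha(1) alpha(1)]
  have [measurable]: "(\<lambda>x. coord x k) \<in> borel_measurable borel"
    by (intro borel_measurable_continuous_onI linear_continuous_on bounded_linear_coord)
  have "coord (indicator {0<..t} s *\<^sub>R diag (Q_mult \<alpha> \<theta> s) (y (t - s))) k =
     indicator {0<..t} s * (sqrt (\<theta> k) * (ml_ker \<alpha> (lam \<theta> k) \<alpha> s / (1 + \<theta> k)) * coord (y (t - s)) k)" for s
    using coord_diag_Q_mult[of s "y (t - s)" k] by (simp add: indicator_def Q_mult_def R_mult_eq)
  then show "(\<lambda>s. coord (indicator {0<..t} s *\<^sub>R diag (Q_mult \<alpha> \<theta> s) (y (t - s))) k) \<in> borel_measurable lborel"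
    by simp
qed

lemma duhamel_integrand_bound:
  assumes "\<And>s. 0 \<le> s \<Longrightarrow> s \<le> t \<Longrightarrow> norm (y s) \<le> B"
  shows "norm (indicator {0<..t} s *\<^sub>R diag (Q_mult \<alpha> \<theta> s) (y (t - s))) \<le> B * (indicator {0<..t} s * ml_ker \<alpha> (lam \<theta> 0) \<alpha> s)"
proof (cases "0 < s \<and> s \<le> t")
  case True
  have "norm (diag (Q_mult \<alpha> \<theta> s) (y (t - s))) \<le> ml_ker \<alpha> (lam \<theta> 0) \<alpha> s * norm (y (t - s))"
    using True by (intro norm_diag_le Q_mult_bound) auto
  also have "\<dots> \<le> ml_ker \<alpha> (lam \<theta> 0) \<alpha> s * B"
    using True ml_ker_lam_bounds(1)[of s 0] by (intro mult_left_mono assms) auto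
  finally show ?thesis using True by (simp add: mult.commute)
qed auto

lemma duhamel_integrable:
  assumes "y \<in> borel_measurable borel" "\<And>s. 0 \<le> s \<Longrightarrow> s \<le> t \<Longrightarrow> norm (y s) \<le> B"
  shows "integrable lborel (\<lambda>s. indicator {0<..t} s *\<^sub>R diag (Q_mult \<alpha> \<theta> s) (y (t - s)))"
proof (rule Bochner_Integration.integrable_bound)
  show "integrable lborel (\<lambda>s. B * (indicator {0<..t} s * ml_ker \<alpha> (lam \<theta> 0) \<alpha> s))"
    by (intro integrable_mult_right kernel_integral)
  show "AE s in lborel. norm (indicator {0<..t} s *\<^sub>R diag (Q_mult \<alpha> \<theta> s) (y (t - s))) \<le> norm (B * (indicator {0<..t} s * ml_ker \<alpha> (lam \<theta> 0) \<alpha> s))"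
    using order_trans[OF duhamel_integrand_bound[of t y B] abs_ge_self] assms(2) by (intro AE_I2) simp
qed (rule duhamel_integrand_measurable[OF assms(1)])

lemma norm_duhamel_le:
  assumes "y \<in> borel_measurable borel" "\<And>s. 0 \<le> s \<Longrightarrow> s \<le> t \<Longrightarrow> norm (y s) \<le> B" "0 \<le> B"
  shows "norm (duhamel \<alpha> \<theta> y t) \<le> B / lam \<theta> 0"
proof -
  have "norm (duhamel \<alpha> \<theta> y t) \<le> (LINT s|lborel. norm (indicator {0<..t} s *\<^sub>R diag (Q_mult \<alpha> \<theta> s) (y (t - s))))"
    unfolding duhamel_def by (rule integral_norm_bound)
  also have "\<dots> \<le> (LINT s|lborel. B * (indicator {0<..t} s * ml_ker \<alpha> (lam \<theta> 0) \<alpha> s))"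
  proof (rule integral_mono)
    show "integrable lborel (\<lambda>s. norm (indicator {0<..t} s *\<^sub>R diag (Q_mult \<alpha> \<theta> s) (y (t - s))))"
      by (intro integrable_norm duhamel_integrable[OF assms(1,2)])
    show "integrable lborel (\<lambda>s. B * (indicator {0<..t} s * ml_ker \<alpha> (lam \<theta> 0) \<alpha> s))"
      by (intro integrable_mult_right kernel_integral)
    show "norm (indicator {0<..t} s *\<^sub>R diag (Q_mult \<alpha> \<theta> s) (y (t - s))) \<le> B * (indicator {0<..t} s * ml_ker \<alpha> (lam \<theta> 0) \<alpha> s)" for s
      by (rule duhamel_integrand_bound[OF assms(2)])
  qed
  also have "\<dots> = B * (LINT s|lborel. indicator {0<..t} s * ml_ker \<alpha> (lam \<theta> 0) \<alpha> s)"
    by (rule integral_mult_right_zero)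
  also have "\<dots> \<le> B * (1 / lam \<theta> 0)" by (intro mult_left_mono kernel_integral assms)
  finally show ?thesis by simp
qed

lemma duhamel_diff:
  assumes y: "y \<in> borel_measurable borel" "\<And>s. 0 \<le> s \<Longrightarrow> s \<le> t \<Longrightarrow> norm (y s) \<le> B"
    and z: "z \<in> borel_measurable borel" "\<And>s. 0 \<le> s \<Longrightarrow> s \<le> t \<Longrightarrow> norm (z s) \<le> B"
  shows "duhamel \<alpha> \<theta> y t - duhamel \<alpha> \<theta> z t = duhamel \<alpha> \<theta> (\<lambda>s. y s - z s) t"
proof -
  have "duhamel \<alpha> \<theta> y t - duhamel \<alpha> \<theta> z t = (LINT s|lborel. indicator {0<..t} s *\<^sub>R diag (Q_mult \<alpha> \<theta> s) (y (t - s)) - indicator {0<..t} s *\<^sub>R diag (Q_mult \<alpha> \<theta> s) (z (t - s)))"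
    unfolding duhamel_def by (intro Bochner_Integration.integral_diff[symmetric] duhamel_integrable[OF y] duhamel_integrable[OF z])
  also have "\<dots> = duhamel \<alpha> \<theta> (\<lambda>s. y s - z s) t"
    unfolding duhamel_def
  proof (intro Bochner_Integration.integral_cong refl)
    fix s
    show "indicator {0<..t} s *\<^sub>R diag (Q_mult \<alpha> \<theta> s) (y (t - s)) - indicator {0<..t} s *\<^sub>R diag (Q_mult \<alpha> \<theta> s) (z (t - s)) =
      indicator {0<..t} s *\<^sub>R diag (Q_mult \<alpha> \<theta> s) (y (t - s) - z (t - s))"
      using linear_diff[OF bounded_linear.linear[OF bounded_linear_diag[OF Q_mult_bound, of s]]]
      by (simp add: indicator_def)
  qed
  finally show ?thesis .
qed

text \<open>Dominated convergence along a sequence of times: the kernel on (0, T] is a majorant for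
  all times below T, and the indicators converge except at s = t.\<close>

lemma continuous_duhamel:
  assumes y: "continuous_on UNIV y" and B: "\<And>s. norm (y s) \<le> B"
  shows "continuous_on UNIV (duhamel \<alpha> \<theta> y)"
proof (rule continuous_at_imp_continuous_on, rule ballI, unfold continuous_at_sequentially, intro allI impI)
  fix t :: real and u :: "nat \<Rightarrow> real" assume u: "u \<longlonglongrightarrow> t"
  have ym: "y \<in> borel_measurable borel" by (rule borel_measurable_continuous_onI[OF y])
  obtain T where T: "\<And>n. u n \<le> T" using convergent_imp_Bseq[of u] u by (metis Bseq_iff convergentI abs_le_D1 real_norm_def)
  have B0: "0 \<le> B" using B[of 0] norm_ge_zero order_trans by blast
  show "((duhamel \<alpha> \<theta> y) \<circ> u) \<longlonglongrightarrow> duhamel \<alpha> \<theta> y t"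
    unfolding duhamel_def comp_def
  proof (rule integral_dominated_convergence)
    show "integrable lborel (\<lambda>s. B * (indicator {0<..T} s * ml_ker \<alpha> (lam \<theta> 0) \<alpha> s))"
      by (intro integrable_mult_right kernel_integral)
    show "AE s in lborel. norm (indicator {0<..u n} s *\<^sub>R diag (Q_mult \<alpha> \<theta> s) (y (u n - s))) \<le> B * (indicator {0<..T} s * ml_ker \<alpha> (lam \<theta> 0) \<alpha> s)" for n
    proof (rule AE_I2)
      fix s
      have "norm (indicator {0<..u n} s *\<^sub>R diag (Q_mult \<alpha> \<theta> s) (y (u n - s))) \<le> B * (indicator {0<..u n} s * ml_ker \<alpha> (lam \<theta> 0) \<alpha> s)"
        by (rule duhamel_integrand_bound[OF B])
      also have "\<dots> \<le> B * (indicator {0<..T} s * ml_ker \<alpha> (lam \<theta> 0) \<alpha> s)"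
        using T[of n] B0 ml_ker_lam_bounds(1)[of s 0] by (intro mult_left_mono) (auto simp: indicator_def)
      finally show "norm (indicator {0<..u n} s *\<^sub>R diag (Q_mult \<alpha> \<theta> s) (y (u n - s))) \<le> B * (indicator {0<..T} s * ml_ker \<alpha> (lam \<theta> 0) \<alpha> s)" .
    qed
    show "AE s in lborel. (\<lambda>n. indicator {0<..u n} s *\<^sub>R diag (Q_mult \<alpha> \<theta> s) (y (u n - s))) \<longlonglongrightarrow> indicator {0<..t} s *\<^sub>R diag (Q_mult \<alpha> \<theta> s) (y (t - s))"
      using AE_lborel_singleton[of t]
    proof eventually_elim
      case (elim s)
      have "\<forall>\<^sub>F n in sequentially. indicator {0<..u n} s = (indicator {0<..t} s :: real)"
      proof (cases "s < t")
        case True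
        from order_tendstoD(1)[OF u True] show ?thesis by eventually_elim (use True in \<open>auto simp: indicator_def\<close>)
      next
        case False
        then have "t < s" using elim by simp
        from order_tendstoD(2)[OF u this] show ?thesis by eventually_elim (use \<open>t < s\<close> in \<open>auto simp: indicator_def\<close>)
      qed
      then have 1: "(\<lambda>n. indicator {0<..u n} s :: real) \<longlonglongrightarrow> indicator {0<..t} s" by (rule tendsto_eventually)
      show ?case
      proof (cases "0 < s")
        case True
        have "(\<lambda>n. y (u n - s)) \<longlonglongrightarrow> y (t - s)"
          using y by (intro continuous_on_tendsto_compose[OF y] tendsto_intros u) auto
        then have "(\<lambda>n. diag (Q_mult \<alpha> \<theta> s) (y (u n - s))) \<longlonglongrightarrow> diag (Q_mult \<alpha> \<theta> s) (y (t - s))"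
          by (rule bounded_linear.tendsto[OF bounded_linear_diag[OF Q_mult_bound[OF True]]])
        then show ?thesis by (intro tendsto_scaleR 1)
      qed auto
    qed
  qed (intro duhamel_integrand_measurable ym)+
qed

text \<open>Freezing the orbit at negative times by \<open>max 0 t\<close> allows the fixed point to
  be sought among bounded continuous functions on the whole line.\<close>

lemma continuous_S_mult: "continuous_on UNIV (\<lambda>t. diag (S_mult \<alpha> \<theta> (max 0 t)) x)"
proof (rule continuous_on_ell2I)
  have b: "\<bar>S_mult \<alpha> \<theta> (max 0 t) k\<bar> \<le> 1" for t k by (rule S_mult_bounds) simp
  note c = coord_diag[OF b]
  show "continuous_on UNIV (\<lambda>t. coord (diag (S_mult \<alpha> \<theta> (max 0 t)) x) k)" for k
    unfolding c S_mult_def lam_arg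
    by (intro continuous_intros continuous_on_compose2[OF continuous_on_mittag_leffler_powr[OF alpha(1), of 1 "lam \<theta> k"]]) auto
  show "\<bar>coord (diag (S_mult \<alpha> \<theta> (max 0 t)) x) k\<bar> \<le> \<bar>coord x k\<bar>" for t k
    unfolding c abs_mult using mult_right_mono[OF b abs_ge_zero, of t k "coord x k"] by simp
qed

text \<open>The substitution \<tau> = t - s and the change from energy to L^2 coordinates bring
  \<open>duhamel\<close> into the form that occurs in \<open>mild_solution\<close>.\<close>

lemma duhamel_bochner:
  assumes y: "y \<in> borel_measurable borel" "\<And>s. 0 \<le> s \<Longrightarrow> s \<le> t \<Longrightarrow> norm (y s) \<le> B"
  shows "has_bochner_integral (lebesgue_on {0..t}) (\<lambda>\<tau>. diag (R_mult \<alpha> \<theta> (t - \<tau>)) (y \<tau>)) (diag (D1_mult \<theta>) (duhamel \<alpha> \<theta> y t))"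
proof -
  define f where "f s = indicator {0<..t} s *\<^sub>R diag (Q_mult \<alpha> \<theta> s) (y (t - s))" for s
  have f: "has_bochner_integral lborel f (duhamel \<alpha> \<theta> y t)"
    using duhamel_integrable[OF y] by (simp add: has_bochner_integral_iff duhamel_def f_def[abs_def])
  have "has_bochner_integral lborel (\<lambda>s. diag (D1_mult \<theta>) (f s)) (diag (D1_mult \<theta>) (duhamel \<alpha> \<theta> y t))"
    by (rule has_bochner_integral_bounded_linear[OF bounded_linear_diag[OF D1_mult_bound] f])
  then have 1: "has_bochner_integral lborel (\<lambda>\<tau>. diag (D1_mult \<theta>) (f (t + (- 1) * \<tau>))) (diag (D1_mult \<theta>) (duhamel \<alpha> \<theta> y t))"
    by (subst (asm) lborel_has_bochner_integral_real_affine_iff[of "-1" _ _ t]) auto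
  have "diag (D1_mult \<theta>) (f (t + (- 1) * \<tau>)) = indicator {0..t} \<tau> *\<^sub>R diag (R_mult \<alpha> \<theta> (t - \<tau>)) (y \<tau>)" for \<tau>
  proof (rule ell2_eqI)
    fix k
    show "coord (diag (D1_mult \<theta>) (f (t + (- 1) * \<tau>))) k = coord (indicator {0..t} \<tau> *\<^sub>R diag (R_mult \<alpha> \<theta> (t - \<tau>)) (y \<tau>)) k"
    proof (cases "0 \<le> \<tau> \<and> \<tau> < t")
      case True
      then show ?thesis
        using coord_diag[OF Q_mult_bound, of "t - \<tau>"] coord_diag[OF R_mult_bound, of "t - \<tau>"] D1_mult_Q_mult[of k "t - \<tau>"]
        by (simp add: coord_diag[OF D1_mult_bound] f_def mult.assoc[symmetric])
    next
      case False
      \<comment> \<open>The end point \<tau> = t: the left side excludes s = 0 by its indicator, the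
        right side vanishes by the default value of \<open>powr\<close>.\<close>
      have "diag (R_mult \<alpha> \<theta> 0) (y \<tau>) = 0"
        by (rule ell2_eqI) (simp add: coord_diag[of _ 0] R_mult_0)
      moreover have "f (t - \<tau>) = 0" using False by (auto simp: f_def indicator_def)
      ultimately show ?thesis using False by (cases "\<tau> = t") (auto simp: coord_diag[OF D1_mult_bound])
    qed
  qed
  with 1 have 2: "has_bochner_integral lborel (\<lambda>\<tau>. indicator {0..t} \<tau> *\<^sub>R diag (R_mult \<alpha> \<theta> (t - \<tau>)) (y \<tau>)) (diag (D1_mult \<theta>) (duhamel \<alpha> \<theta> y t))"
    by simp
  then have "has_bochner_integral lebesgue (\<lambda>\<tau>. indicator {0..t} \<tau> *\<^sub>R diag (R_mult \<alpha> \<theta> (t - \<tau>)) (y \<tau>)) (diag (D1_mult \<theta>) (duhamel \<alpha> \<theta> y t))"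
    using integrable_completion[OF borel_measurable_has_bochner_integral[OF 2]]
      integral_completion[OF borel_measurable_has_bochner_integral[OF 2]]
    by (simp add: has_bochner_integral_iff)
  then show ?thesis by (subst has_bochner_integral_restrict_space) auto
qed

end

section \<open>Existence and uniqueness of mild solutions\<close>

definition D1_of :: "(real^2) set \<Rightarrow> (nat \<Rightarrow> real) \<Rightarrow> (nat \<Rightarrow> real^2 \<Rightarrow> real) \<Rightarrow> ell2 \<Rightarrow> real^2 \<Rightarrow> real" where
  "D1_of \<Omega> \<theta> \<phi> x = L2_of \<Omega> \<phi> (diag (D1_mult \<theta>) x)"

text \<open>The Nemytskii operator of the nonlinearity, from energy coordinates to L^2
  coordinates.\<close>

definition Nem :: "(real^2) set \<Rightarrow> (nat \<Rightarrow> real) \<Rightarrow> (nat \<Rightarrow> real^2 \<Rightarrow> real) \<Rightarrow> ell2 \<Rightarrow> ell2" where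
  "Nem \<Omega> \<theta> \<phi> x = L2_coord \<Omega> \<phi> (\<lambda>z. Hfun (D1_of \<Omega> \<theta> \<phi> x z))"

context
  fixes \<alpha> :: real and \<Omega> :: "(real^2) set" and \<theta> :: "nat \<Rightarrow> real" and \<phi> :: "nat \<Rightarrow> real^2 \<Rightarrow> real"
  assumes alpha: "0 < \<alpha>" "\<alpha> < 1" and dom: "bounded_domain \<Omega>" and eig: "Dirichlet_eigensystem \<Omega> \<theta> \<phi>"
begin

lemma sys: "complete_orthonormal \<Omega> \<phi>" "\<Omega> \<in> lmeasurable"
  using eig bounded_domain_lmeasurable[OF dom] by (auto simp: Dirichlet_eigensystem_def)

lemma theta: "\<And>k. 0 < \<theta> k" "mono \<theta>"
  using eig by (auto simp: Dirichlet_eigensystem_def)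

lemmas coord_D1_mult = coord_diag[OF D1_mult_bound[OF alpha theta]]
lemmas D1_mult_linear = bounded_linear.linear[OF bounded_linear_diag[OF D1_mult_bound[OF alpha theta]]]

lemma D1_of_L2: "D1_of \<Omega> \<theta> \<phi> x \<in> L2 \<Omega>"
  unfolding D1_of_def by (rule L2_of_L2[OF sys])

lemma D1_of_diff: "AE z in lebesgue_on \<Omega>. D1_of \<Omega> \<theta> \<phi> (x - y) z = D1_of \<Omega> \<theta> \<phi> x z - D1_of \<Omega> \<theta> \<phi> y z"
  unfolding D1_of_def linear_diff[OF D1_mult_linear] by (rule L2_of_diff[OF sys])

lemma D1_of_D1: "D1_of \<Omega> \<theta> \<phi> x \<in> D1 \<Omega> \<theta> \<phi>" "D1_norm \<Omega> \<theta> \<phi> (D1_of \<Omega> \<theta> \<phi> x) = norm x"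
proof -
  have "L2_inner \<Omega> (D1_of \<Omega> \<theta> \<phi> x) (\<phi> k) = D1_mult \<theta> k * coord x k" for k
    unfolding coord_L2_coord[OF sys D1_of_L2, symmetric] unfolding D1_of_def L2_coord_L2_of[OF sys] by (rule coord_D1_mult)
  then have *: "\<theta> k * (L2_inner \<Omega> (D1_of \<Omega> \<theta> \<phi> x) (\<phi> k))\<^sup>2 = (coord x k)\<^sup>2" for k
    using theta(1)[of k] by (simp add: D1_mult_def power_mult_distrib power_divide)
  show "D1_of \<Omega> \<theta> \<phi> x \<in> D1 \<Omega> \<theta> \<phi>" unfolding D1_def using D1_of_L2 by (simp add: * summable_coord_sq)
  show "D1_norm \<Omega> \<theta> \<phi> (D1_of \<Omega> \<theta> \<phi> x) = norm x" unfolding D1_norm_def * norm_ell2_sq[symmetric] by simp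
qed

lemma smallness_constants:
  obtains C M where "C > 0" "M > 0" "M\<^sup>2 \<le> 1 / 32" "200 * M\<^sup>2 * C / lam \<theta> 0 \<le> 1 / 4"
    "\<forall>x \<kappa>. C * norm x < \<kappa> \<longrightarrow> LXi_le \<Omega> \<kappa> (D1_of \<Omega> \<theta> \<phi> x)"
proof -
  obtain C where C: "C > 0" "\<And>w \<kappa>. w \<in> D1 \<Omega> \<theta> \<phi> \<Longrightarrow> C * D1_norm \<Omega> \<theta> \<phi> w < \<kappa> \<Longrightarrow> LXi_le \<Omega> \<kappa> w"
    by (rule D1_embedding[OF dom eig]) blast
  have l: "lam \<theta> 0 > 0" by (rule lam_bounds[OF alpha theta])
  \<comment> \<open>1/32 is the bound in \<open>Hfun_lipschitz\<close>, and 800 = 4 * 200 turns its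
    Lipschitz constant, times the embedding constant and the norm of the Duhamel operator, into at
    most 1/4.\<close>
  define M where "M = sqrt (min (1 / 32) (lam \<theta> 0 / (800 * C)))"
  have p: "0 < min (1 / 32) (lam \<theta> 0 / (800 * C))" using C(1) l by simp
  then have M: "M > 0" "M\<^sup>2 = min (1 / 32) (lam \<theta> 0 / (800 * C))" by (auto simp: M_def)
  have "M\<^sup>2 \<le> lam \<theta> 0 / (800 * C)" using M by simp
  then have "200 * M\<^sup>2 * C / lam \<theta> 0 \<le> 1 / 4" using C(1) l by (simp add: field_simps)
  moreover have "LXi_le \<Omega> \<kappa> (D1_of \<Omega> \<theta> \<phi> x)" if "C * norm x < \<kappa>" for x \<kappa>
    using C(2)[OF D1_of_D1(1)[of x]] that by (simp add: D1_of_D1(2))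
  ultimately show ?thesis using that[of C M] C(1) M by simp
qed

section \<open>The fixed point in energy coordinates\<close>

context
  fixes C M :: real
  assumes C: "C > 0" and M: "M > 0" "M\<^sup>2 \<le> 1 / 32" and CM: "200 * M\<^sup>2 * C / lam \<theta> 0 \<le> 1 / 4"
    and embed_all: "\<forall>x \<kappa>. C * norm x < \<kappa> \<longrightarrow> LXi_le \<Omega> \<kappa> (D1_of \<Omega> \<theta> \<phi> x)"
begin

lemma embed: "C * norm x < \<kappa> \<Longrightarrow> LXi_le \<Omega> \<kappa> (D1_of \<Omega> \<theta> \<phi> x)"
  using embed_all by blast

lemma D1_of_diff_LXi_le:
  assumes "C * norm (x - y) < \<kappa>"
  shows "LXi_le \<Omega> \<kappa> (\<lambda>z. D1_of \<Omega> \<theta> \<phi> x z - D1_of \<Omega> \<theta> \<phi> y z)"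
proof (rule LXi_le_AE_cong[OF embed[OF assms]])
  show "AE z in lebesgue_on \<Omega>. D1_of \<Omega> \<theta> \<phi> x z - D1_of \<Omega> \<theta> \<phi> y z = D1_of \<Omega> \<theta> \<phi> (x - y) z"
    using D1_of_diff[of x y] by eventually_elim simp
  show "(\<lambda>z. D1_of \<Omega> \<theta> \<phi> x z - D1_of \<Omega> \<theta> \<phi> y z) \<in> borel_measurable (lebesgue_on \<Omega>)"
    by (intro L2_measurable L2_diff D1_of_L2)
qed

lemma Hfun_D1_of_L2: "C * norm x < M \<Longrightarrow> (\<lambda>z. Hfun (D1_of \<Omega> \<theta> \<phi> x z)) \<in> L2 \<Omega>"
  by (rule Hfun_L2[OF embed M(2)])

lemma Nem_lipschitz:
  assumes "C * norm x < M" "C * norm y < M"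
  shows "norm (Nem \<Omega> \<theta> \<phi> x - Nem \<Omega> \<theta> \<phi> y) \<le> 200 * M\<^sup>2 * C * norm (x - y)"
proof (rule field_le_epsilon)
  fix e :: real assume "0 < e"
  \<comment> \<open>The embedding asks for a strict inequality; the excess is chosen to cost exactly
    e after multiplication by the Lipschitz constant.\<close>
  define D where "D = C * norm (x - y) + e / (200 * M\<^sup>2)"
  have "C * norm (x - y) < D" using \<open>0 < e\<close> M by (simp add: D_def)
  have "norm (Nem \<Omega> \<theta> \<phi> x - Nem \<Omega> \<theta> \<phi> y) = L2_norm \<Omega> (\<lambda>z. Hfun (D1_of \<Omega> \<theta> \<phi> x z) - Hfun (D1_of \<Omega> \<theta> \<phi> y z))"
    unfolding Nem_def L2_coord_diff[OF sys Hfun_D1_of_L2[OF assms(1)] Hfun_D1_of_L2[OF assms(2)], symmetric]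
    by (intro norm_L2_coord[OF sys] L2_diff Hfun_D1_of_L2 assms)
  also have "\<dots> \<le> 200 * M\<^sup>2 * D"
    by (rule Hfun_lipschitz[OF embed embed D1_of_diff_LXi_le M(2)]) fact+
  also have "\<dots> = 200 * M\<^sup>2 * C * norm (x - y) + e" using M by (simp add: D_def field_simps)
  finally show "norm (Nem \<Omega> \<theta> \<phi> x - Nem \<Omega> \<theta> \<phi> y) \<le> 200 * M\<^sup>2 * C * norm (x - y) + e" .
qed

lemma Nem_zero: "Nem \<Omega> \<theta> \<phi> 0 = 0"
proof -
  have "AE z in lebesgue_on \<Omega>. D1_of \<Omega> \<theta> \<phi> 0 z = 0" using D1_of_diff[of 0 0] by simp
  then have "AE z in lebesgue_on \<Omega>. Hfun (D1_of \<Omega> \<theta> \<phi> 0 z) = 0" by eventually_elim (simp add: Hfun_def)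
  then have "L2_norm \<Omega> (\<lambda>z. Hfun (D1_of \<Omega> \<theta> \<phi> 0 z)) = 0"
    using L2_norm_zero_iff[OF Hfun_D1_of_L2[of 0]] M(1) by simp
  then show ?thesis using norm_L2_coord[OF sys Hfun_D1_of_L2[of 0]] M(1) by (simp add: Nem_def)
qed

lemma Nem_bound: "C * norm x < M \<Longrightarrow> norm (Nem \<Omega> \<theta> \<phi> x) \<le> 200 * M\<^sup>2 * C * norm x"
  using Nem_lipschitz[of x 0] M(1) by (simp add: Nem_zero)

text \<open>On this ball the L^\<Xi> size is below M / 3. The factor 3 lost in
  \<open>LXi_le_diff\<close> can then be afforded when a perturbation of size M / 3 is added in the
  uniqueness proof.\<close>

definition "\<rho> = M / (6 * C)"

lemma rho: "\<rho> > 0" "C * \<rho> = M / 6"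
  using C M by (auto simp: \<rho>_def)

lemma rho_small: "norm x \<le> \<rho> \<Longrightarrow> C * norm x < M / 3"
  using mult_left_mono[of "norm x" \<rho> C] rho(2) C M(1) by linarith

lemma continuous_Nem:
  assumes "continuous_on S x" "\<And>t. norm (x t) \<le> \<rho>"
  shows "continuous_on S (\<lambda>t. Nem \<Omega> \<theta> \<phi> (x t))"
proof (rule continuous_on_compose2[OF lipschitz_on_continuous_on assms(1)])
  show "(200 * M\<^sup>2 * C)-lipschitz_on (cball 0 \<rho>) (Nem \<Omega> \<theta> \<phi>)"
  proof (rule lipschitz_onI)
    fix x y :: ell2 assume "x \<in> cball 0 \<rho>" "y \<in> cball 0 \<rho>"
    then show "dist (Nem \<Omega> \<theta> \<phi> x) (Nem \<Omega> \<theta> \<phi> y) \<le> 200 * M\<^sup>2 * C * dist x y"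
      unfolding dist_norm using rho_small[of x] rho_small[of y] M by (intro Nem_lipschitz) auto
  qed (use C in simp)
  show "x ` S \<subseteq> cball 0 \<rho>" using assms(2) by auto
qed

text \<open>The bounds for the Duhamel operator do not depend on time, so a single fixed point on
  the whole line serves every final time.\<close>

lemma mild_coordinates_exist:
  assumes x0: "norm x0 \<le> \<rho> / 2"
  obtains x where "continuous_on UNIV x" "\<And>t. norm (x t) \<le> \<rho>"
    "\<And>t. x t = diag (S_mult \<alpha> \<theta> (max 0 t)) x0 + duhamel \<alpha> \<theta> (\<lambda>\<tau>. Nem \<Omega> \<theta> \<phi> (x \<tau>)) t"
proof -
  define X where "X = (cball 0 \<rho> :: (real \<Rightarrow>\<^sub>C ell2) set)"
  define \<Phi> where "\<Phi> x t = diag (S_mult \<alpha> \<theta> (max 0 t)) x0 + duhamel \<alpha> \<theta> (\<lambda>\<tau>. Nem \<Omega> \<theta> \<phi> (apply_bcontfun x \<tau>)) t" for x t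
  have lam: "lam \<theta> 0 > 0" by (rule lam_bounds[OF alpha theta])
  have small: "norm (apply_bcontfun x t) \<le> \<rho>" if "x \<in> X" for x t
    using norm_bounded[of x t] that by (auto simp: X_def)
  have cN: "continuous_on UNIV (\<lambda>\<tau>. Nem \<Omega> \<theta> \<phi> (apply_bcontfun x \<tau>))" if "x \<in> X" for x
    by (intro continuous_Nem small that) auto
  have mN: "(\<lambda>\<tau>. Nem \<Omega> \<theta> \<phi> (apply_bcontfun x \<tau>)) \<in> borel_measurable borel" if "x \<in> X" for x
    by (intro borel_measurable_continuous_onI cN that)
  have bN: "norm (Nem \<Omega> \<theta> \<phi> (apply_bcontfun x t)) \<le> 200 * M\<^sup>2 * C * \<rho>" if "x \<in> X" for x t
  proof -
    have "norm (Nem \<Omega> \<theta> \<phi> (apply_bcontfun x t)) \<le> 200 * M\<^sup>2 * C * norm (apply_bcontfun x t)"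
      using rho_small[OF small[OF that, of t]] M(1) by (intro Nem_bound) linarith
    also have "\<dots> \<le> 200 * M\<^sup>2 * C * \<rho>" using C by (intro mult_left_mono small that) auto
    finally show ?thesis .
  qed
  \<comment> \<open>At most \<rho> / 2 comes from the datum and at most \<rho> / 4 from the
    nonlinearity.\<close>
  have b\<Phi>: "norm (\<Phi> x t) \<le> \<rho>" if "x \<in> X" for x t
  proof -
    have "norm (diag (S_mult \<alpha> \<theta> (max 0 t)) x0) \<le> 1 * norm x0"
      by (intro norm_diag_le S_mult_bounds[OF alpha theta]) simp
    moreover have "norm (duhamel \<alpha> \<theta> (\<lambda>\<tau>. Nem \<Omega> \<theta> \<phi> (apply_bcontfun x \<tau>)) t) \<le> 200 * M\<^sup>2 * C * \<rho> / lam \<theta> 0"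
      using C rho by (intro norm_duhamel_le[OF alpha theta] mN bN that) auto
    moreover have "200 * M\<^sup>2 * C * \<rho> / lam \<theta> 0 \<le> 1 / 4 * \<rho>"
      using mult_right_mono[OF CM, of \<rho>] rho(1) by simp
    ultimately show ?thesis
      using x0 rho norm_triangle_ineq[of "diag (S_mult \<alpha> \<theta> (max 0 t)) x0" "duhamel \<alpha> \<theta> (\<lambda>\<tau>. Nem \<Omega> \<theta> \<phi> (apply_bcontfun x \<tau>)) t"]
      unfolding \<Phi>_def by linarith
  qed
  have c\<Phi>: "continuous_on UNIV (\<Phi> x)" if "x \<in> X" for x
    unfolding \<Phi>_def
    by (intro continuous_intros continuous_S_mult[OF alpha theta] continuous_duhamel[OF alpha theta cN[OF that] bN[OF that]])
  have b: "\<Phi> x \<in> bcontfun" if "x \<in> X" for x by (rule bcontfun_normI[OF c\<Phi>[OF that] b\<Phi>[OF that]])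
  have app: "apply_bcontfun (Bcontfun (\<Phi> x)) = \<Phi> x" if "x \<in> X" for x
    by (rule Bcontfun_inverse[OF b[OF that]])
  have "\<exists>!x\<in>X. Bcontfun (\<Phi> x) = x"
  proof (rule Banach_fix)
    show "complete X" unfolding X_def complete_eq_closed by (rule closed_cball)
    show "X \<noteq> {}" using rho by (auto simp: X_def)
    show "(\<lambda>x. Bcontfun (\<Phi> x)) ` X \<subseteq> X"
    proof safe
      fix x assume x: "x \<in> X"
      have "norm (Bcontfun (\<Phi> x)) \<le> \<rho>" by (rule norm_bound) (simp add: app[OF x] b\<Phi>[OF x])
      then show "Bcontfun (\<Phi> x) \<in> X" by (simp add: X_def)
    qed
    fix x y assume x: "x \<in> X" and y: "y \<in> X"
    show "dist (Bcontfun (\<Phi> x)) (Bcontfun (\<Phi> y)) \<le> 1 / 4 * dist x y"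
    proof (rule dist_bound)
      fix t
      have d: "norm (Nem \<Omega> \<theta> \<phi> (apply_bcontfun x s) - Nem \<Omega> \<theta> \<phi> (apply_bcontfun y s)) \<le> 200 * M\<^sup>2 * C * dist x y" for s
      proof -
        have "norm (Nem \<Omega> \<theta> \<phi> (apply_bcontfun x s) - Nem \<Omega> \<theta> \<phi> (apply_bcontfun y s)) \<le> 200 * M\<^sup>2 * C * norm (apply_bcontfun x s - apply_bcontfun y s)"
          using rho_small[OF small[OF x, of s]] rho_small[OF small[OF y, of s]] M by (intro Nem_lipschitz) auto
        also have "\<dots> \<le> 200 * M\<^sup>2 * C * dist x y"
          using C dist_bounded[of x s y] by (intro mult_left_mono) (auto simp: dist_norm)
        finally show ?thesis .
      qed
      have "dist (apply_bcontfun (Bcontfun (\<Phi> x)) t) (apply_bcontfun (Bcontfun (\<Phi> y)) t) = norm (duhamel \<alpha> \<theta> (\<lambda>\<tau>. Nem \<Omega> \<theta> \<phi> (apply_bcontfun x \<tau>)) t - duhamel \<alpha> \<theta> (\<lambda>\<tau>. Nem \<Omega> \<theta> \<phi> (apply_bcontfun y \<tau>)) t)"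
        unfolding app[OF x] app[OF y] dist_norm \<Phi>_def by simp
      also have "\<dots> = norm (duhamel \<alpha> \<theta> (\<lambda>\<tau>. Nem \<Omega> \<theta> \<phi> (apply_bcontfun x \<tau>) - Nem \<Omega> \<theta> \<phi> (apply_bcontfun y \<tau>)) t)"
        by (subst duhamel_diff[OF alpha theta mN[OF x] bN[OF x] mN[OF y] bN[OF y]]) simp
      also have "\<dots> \<le> 200 * M\<^sup>2 * C * dist x y / lam \<theta> 0"
        using C by (intro norm_duhamel_le[OF alpha theta] d borel_measurable_diff mN x y) auto
      also have "\<dots> \<le> 1 / 4 * dist x y" using mult_right_mono[OF CM, of "dist x y"] by simp
      finally show "dist (apply_bcontfun (Bcontfun (\<Phi> x)) t) (apply_bcontfun (Bcontfun (\<Phi> y)) t) \<le> 1 / 4 * dist x y" .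
    qed
  qed auto
  then obtain x where x: "x \<in> X" "Bcontfun (\<Phi> x) = x" by blast
  have fixed: "apply_bcontfun x t = \<Phi> x t" for t using app[OF x(1)] x(2) by simp
  show ?thesis
  proof (rule that)
    show "continuous_on UNIV (apply_bcontfun x)" by (intro continuous_on_apply_bcontfun continuous_on_id)
  qed (fact small[OF x(1)], fact fixed[unfolded \<Phi>_def])
qed

section \<open>The mild solution given by the fixed point\<close>

context
  fixes u0 :: "real^2 \<Rightarrow> real" and x0 :: ell2 and x :: "real \<Rightarrow> ell2"
  assumes u0: "u0 \<in> L2 \<Omega>" "L2_coord \<Omega> \<phi> u0 = diag (D1_mult \<theta>) x0"
    and x: "continuous_on UNIV x" "\<And>t. norm (x t) \<le> \<rho>"
      "\<And>t. x t = diag (S_mult \<alpha> \<theta> (max 0 t)) x0 + duhamel \<alpha> \<theta> (\<lambda>\<tau>. Nem \<Omega> \<theta> \<phi> (x \<tau>)) t"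
begin

abbreviation "u t \<equiv> D1_of \<Omega> \<theta> \<phi> (x t)"

lemma x_small: "C * norm (x t) < M / 3"
  by (rule rho_small[OF x(2)])

lemma x_small': "C * norm (x t) < M"
  using x_small[of t] M by simp

lemma Nem_x: "(\<lambda>\<tau>. Nem \<Omega> \<theta> \<phi> (x \<tau>)) \<in> borel_measurable borel" "norm (Nem \<Omega> \<theta> \<phi> (x t)) \<le> 200 * M\<^sup>2 * M"
proof -
  show "(\<lambda>\<tau>. Nem \<Omega> \<theta> \<phi> (x \<tau>)) \<in> borel_measurable borel"
    by (intro borel_measurable_continuous_onI continuous_Nem x)
  show "norm (Nem \<Omega> \<theta> \<phi> (x t)) \<le> 200 * M\<^sup>2 * M"
    unfolding Nem_def using Hfun_L2[OF embed[OF x_small'] M(2)] by (simp add: norm_L2_coord[OF sys])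
qed

lemma S_op_coord:
  assumes "0 \<le> t"
  shows "S_op \<Omega> \<theta> \<phi> \<alpha> t u0 = L2_of \<Omega> \<phi> (diag (D1_mult \<theta>) (diag (S_mult \<alpha> \<theta> t) x0))"
proof -
  have b: "\<bar>S_mult \<alpha> \<theta> t k\<bar> \<le> 1" for k by (rule S_mult_bounds[OF alpha theta assms])
  have "diag (S_mult \<alpha> \<theta> t) (L2_coord \<Omega> \<phi> u0) = diag (D1_mult \<theta>) (diag (S_mult \<alpha> \<theta> t) x0)"
    by (rule ell2_eqI) (simp add: coord_diag[OF b] u0(2) coord_D1_mult)
  then show ?thesis by (simp add: S_op_eq[OF sys u0(1) b])
qed

lemma u_eq:
  assumes "0 \<le> t"
  shows "AE z in lebesgue_on \<Omega>. u t z = S_op \<Omega> \<theta> \<phi> \<alpha> t u0 z + D1_of \<Omega> \<theta> \<phi> (duhamel \<alpha> \<theta> (\<lambda>\<tau>. Nem \<Omega> \<theta> \<phi> (x \<tau>)) t) z"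
proof -
  have "x t = diag (S_mult \<alpha> \<theta> t) x0 + duhamel \<alpha> \<theta> (\<lambda>\<tau>. Nem \<Omega> \<theta> \<phi> (x \<tau>)) t"
    using x(3)[of t] assms by simp
  then have "diag (D1_mult \<theta>) (x t) = diag (D1_mult \<theta>) (diag (S_mult \<alpha> \<theta> t) x0) + diag (D1_mult \<theta>) (duhamel \<alpha> \<theta> (\<lambda>\<tau>. Nem \<Omega> \<theta> \<phi> (x \<tau>)) t)"
    using linear_add[OF D1_mult_linear] by simp
  then show ?thesis
    unfolding S_op_coord[OF assms] D1_of_def by (simp only: L2_of_add[OF sys])
qed

lemma R_mult_bounded: "0 \<le> t \<Longrightarrow> \<exists>B. \<forall>k. \<bar>R_mult \<alpha> \<theta> t k\<bar> \<le> B"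
  using R_mult_bound[OF alpha theta, of t] by (cases "t = 0") (auto simp: R_mult_0[OF alpha theta])

lemma u_C_LXi: "u \<in> C_LXi I \<Omega>"
  unfolding C_LXi_def
proof (intro CollectI conjI ballI)
  fix t
  show "u t \<in> LXi \<Omega>" by (rule LXi_le_imp_LXi[OF embed[OF x_small]])
  have le: "LXi_norm \<Omega> (\<lambda>z. u s z - u t z) \<le> C * norm (x s - x t)" for s
    by (rule field_le_epsilon) (intro LXi_norm_le D1_of_diff_LXi_le, simp)
  have nn: "0 \<le> LXi_norm \<Omega> (\<lambda>z. u s z - u t z)" for s
    by (intro LXi_norm_nonneg LXi_diff LXi_le_imp_LXi[OF embed[OF x_small]])
  have "(x \<longlongrightarrow> x t) (at t within I)"
    using x(1) by (auto simp: continuous_on_eq_continuous_at isCont_def intro: tendsto_within_subset[of _ _ _ UNIV])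
  from tendsto_mult_right_zero[OF tendsto_norm_zero[OF LIM_zero[OF this]], of C]
  show "((\<lambda>s. LXi_norm \<Omega> (\<lambda>z. u s z - u t z)) \<longlongrightarrow> 0) (at t within I)"
    by (rule Lim_null_comparison[rotated]) (use le nn in \<open>auto intro!: always_eventually\<close>)
qed

lemma u_mild: "mild_solution \<Omega> \<theta> \<phi> \<alpha> Hfun u0 T u"
  unfolding mild_solution_def
proof (intro conjI ballI)
  show "AE \<tau> in lebesgue_on {0..T}. Hfun \<circ> u \<tau> \<in> L2 \<Omega>"
    using Hfun_D1_of_L2[OF x_small'] by (simp add: comp_def)
  fix t assume "t \<in> {0..T}"
  then have t: "0 \<le> t" by simp
  have "has_L2_integral \<Omega> (\<lambda>\<tau>. R_op \<Omega> \<theta> \<phi> \<alpha> (t - \<tau>) (Hfun \<circ> u \<tau>)) (L2_of \<Omega> \<phi> (diag (D1_mult \<theta>) (duhamel \<alpha> \<theta> (\<lambda>\<tau>. Nem \<Omega> \<theta> \<phi> (x \<tau>)) t))) {0..t}"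
  proof (rule has_L2_integral_of_bochner[OF sys])
    show "has_bochner_integral (lebesgue_on {0..t}) (\<lambda>\<tau>. diag (R_mult \<alpha> \<theta> (t - \<tau>)) (Nem \<Omega> \<theta> \<phi> (x \<tau>))) (diag (D1_mult \<theta>) (duhamel \<alpha> \<theta> (\<lambda>\<tau>. Nem \<Omega> \<theta> \<phi> (x \<tau>)) t))"
      by (rule duhamel_bochner[OF alpha theta Nem_x])
    fix \<tau> assume "\<tau> \<in> {0..t}"
    then obtain B where "\<And>k. \<bar>R_mult \<alpha> \<theta> (t - \<tau>) k\<bar> \<le> B" using R_mult_bounded[of "t - \<tau>"] by auto
    then show "R_op \<Omega> \<theta> \<phi> \<alpha> (t - \<tau>) (Hfun \<circ> u \<tau>) = L2_of \<Omega> \<phi> (diag (R_mult \<alpha> \<theta> (t - \<tau>)) (Nem \<Omega> \<theta> \<phi> (x \<tau>)))"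
      using R_op_eq[OF sys, of "Hfun \<circ> u \<tau>" \<alpha> \<theta> "t - \<tau>" B] Hfun_D1_of_L2[OF x_small'] by (simp add: Nem_def comp_def)
  qed simp
  then show "\<exists>J. has_L2_integral \<Omega> (\<lambda>\<tau>. R_op \<Omega> \<theta> \<phi> \<alpha> (t - \<tau>) (Hfun \<circ> u \<tau>)) J {0..t} \<and>
      (AE z in lebesgue_on \<Omega>. u t z = S_op \<Omega> \<theta> \<phi> \<alpha> t u0 z + J z)"
    using u_eq[OF t] unfolding D1_of_def by blast
qed

section \<open>Comparison with a competing mild solution\<close>

context
  fixes T :: real and v :: "real \<Rightarrow> real^2 \<Rightarrow> real"
  assumes v: "v \<in> C_LXi {0..T} \<Omega>" "mild_solution \<Omega> \<theta> \<phi> \<alpha> Hfun u0 T v"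
begin

lemma v_LXi: "t \<in> {0..T} \<Longrightarrow> v t \<in> LXi \<Omega>"
  using v(1) by (simp add: C_LXi_def)

lemma v_measurable: "t \<in> {0..T} \<Longrightarrow> v t \<in> borel_measurable (lebesgue_on \<Omega>)"
  using v_LXi by (simp add: LXi_def)

lemma v_diff_LXi_le:
  assumes "t \<in> {0..T}" "e > 0"
  shows "\<exists>\<eta>>0. \<forall>s\<in>{0..T}. \<bar>s - t\<bar> < \<eta> \<longrightarrow> LXi_le \<Omega> e (\<lambda>z. v s z - v t z)"
proof -
  have "((\<lambda>s. LXi_norm \<Omega> (\<lambda>z. v s z - v t z)) \<longlongrightarrow> 0) (at t within {0..T})"
    using v(1) assms(1) by (simp add: C_LXi_def)
  from order_tendstoD(2)[OF this assms(2)]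
  obtain \<eta> where \<eta>: "\<eta> > 0" "\<And>s. s \<in> {0..T} \<Longrightarrow> s \<noteq> t \<Longrightarrow> dist s t < \<eta> \<Longrightarrow> LXi_norm \<Omega> (\<lambda>z. v s z - v t z) < e"
    unfolding eventually_at by blast
  have "LXi_le \<Omega> e (\<lambda>z. v s z - v t z)" if "s \<in> {0..T}" "\<bar>s - t\<bar> < \<eta>" for s
  proof (cases "s = t")
    case True then show ?thesis using assms by (simp add: LXi_le_def Xi_def)
  next
    case False
    then show ?thesis using \<eta>(2)[of s] that assms(1)
      by (intro LXi_le_of_norm_less LXi_diff v_LXi) (auto simp: dist_real_def)
  qed
  then show ?thesis using \<eta>(1) by blast
qed

text \<open>
  Where \<open>v\<close> is small, \<open>H \<circ> v\<close> is continuous into \<open>L\<^sup>2\<close>, so that its Duhamel integral is a Bochner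
  integral and every bound on \<open>v - u\<close> can be halved.
\<close>

lemma v_eq_u_where_small:
  assumes t: "t \<le> T" and small: "\<And>s. 0 \<le> s \<Longrightarrow> s \<le> t \<Longrightarrow> LXi_le \<Omega> M (v s)" and s: "0 \<le> s" "s \<le> t"
  shows "AE z in lebesgue_on \<Omega>. v s z = u s z"
proof -
  define y where "y s = L2_coord \<Omega> \<phi> (\<lambda>z. Hfun (v s z))" for s
  \<comment> \<open>Cutting off outside [0, t], where nothing is known about the size of
    \<open>v\<close>, makes the source bounded and measurable on the whole line.\<close>
  define Y where "Y s = indicator {0..t} s *\<^sub>R y s" for s
  have HvL: "(\<lambda>z. Hfun (v s z)) \<in> L2 \<Omega>" if "0 \<le> s" "s \<le> t" for s
    by (rule Hfun_L2[OF small[OF that] M(2)])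
  have y_diff: "norm (y s - y r) \<le> 200 * M\<^sup>2 * D" if "0 \<le> s" "s \<le> t" "0 \<le> r" "r \<le> t" "LXi_le \<Omega> D (\<lambda>z. v s z - v r z)" for s r D
    unfolding y_def L2_coord_diff[OF sys HvL[OF that(1,2)] HvL[OF that(3,4)], symmetric]
      norm_L2_coord[OF sys L2_diff[OF HvL[OF that(1,2)] HvL[OF that(3,4)]]]
    by (rule Hfun_lipschitz[OF small[OF that(1,2)] small[OF that(3,4)] that(5) M(2)])
  have "continuous_on {0..t} y"
  proof (unfold continuous_on_iff, intro ballI allI impI)
    fix r e :: real assume r: "r \<in> {0..t}" and "0 < e"
    define D where "D = e / (400 * M\<^sup>2)"
    have D: "0 < D" "200 * M\<^sup>2 * D < e" using \<open>0 < e\<close> M by (auto simp: D_def)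
    obtain \<eta> where \<eta>: "\<eta> > 0" "\<And>s. s \<in> {0..T} \<Longrightarrow> \<bar>s - r\<bar> < \<eta> \<Longrightarrow> LXi_le \<Omega> D (\<lambda>z. v s z - v r z)"
      using v_diff_LXi_le[of r D] r t D by auto
    have "dist (y s) (y r) < e" if "s \<in> {0..t}" "dist s r < \<eta>" for s
      using y_diff[of s r D] \<eta>(2)[of s] that r t D by (auto simp: dist_norm)
    then show "\<exists>d>0. \<forall>s\<in>{0..t}. dist s r < d \<longrightarrow> dist (y s) (y r) < e" using \<eta>(1) by blast
  qed
  then have Ym: "Y \<in> borel_measurable borel"
    unfolding Y_def[abs_def] by (intro borel_measurable_continuous_on_indicator) auto
  have Yb: "norm (Y s) \<le> 200 * M\<^sup>2 * M" for s
    using Hfun_L2(2)[OF small M(2), of s] HvL[of s] M by (auto simp: Y_def y_def indicator_def norm_L2_coord[OF sys])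
  define d where "d s = duhamel \<alpha> \<theta> (\<lambda>\<tau>. Y \<tau> - Nem \<Omega> \<theta> \<phi> (x \<tau>)) s" for s
  \<comment> \<open>Both functions satisfy the mild equation with the same datum, so the terms with
    \<open>S_op\<close> cancel; the integral J belonging to \<open>v\<close> is identified through
    its coordinates.\<close>
  have vu: "AE z in lebesgue_on \<Omega>. v s z - u s z = D1_of \<Omega> \<theta> \<phi> (d s) z" if s: "0 \<le> s" "s \<le> t" for s
  proof -
    obtain J where J: "has_L2_integral \<Omega> (\<lambda>\<tau>. R_op \<Omega> \<theta> \<phi> \<alpha> (s - \<tau>) (Hfun \<circ> v \<tau>)) J {0..s}"
      "AE z in lebesgue_on \<Omega>. v s z = S_op \<Omega> \<theta> \<phi> \<alpha> s u0 z + J z"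
      using v(2) s t unfolding mild_solution_def by force
    have JL: "J \<in> L2 \<Omega>" using J(1) by (simp add: has_L2_integral_def)
    have bi: "has_bochner_integral (lebesgue_on {0..s}) (\<lambda>\<tau>. diag (R_mult \<alpha> \<theta> (s - \<tau>)) (Y \<tau>)) (diag (D1_mult \<theta>) (duhamel \<alpha> \<theta> Y s))"
      by (rule duhamel_bochner[OF alpha theta Ym Yb])
    have "L2_coord \<Omega> \<phi> J = (LINT \<tau>|lebesgue_on {0..s}. diag (R_mult \<alpha> \<theta> (s - \<tau>)) (Y \<tau>))"
    proof (rule has_L2_integral_coord[OF sys _ J(1)])
      show "integrable (lebesgue_on {0..s}) (\<lambda>\<tau>. diag (R_mult \<alpha> \<theta> (s - \<tau>)) (Y \<tau>))" using bi by (rule integrable.intros)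
      have "L2_coord \<Omega> \<phi> (R_op \<Omega> \<theta> \<phi> \<alpha> (s - \<tau>) (Hfun \<circ> v \<tau>)) = diag (R_mult \<alpha> \<theta> (s - \<tau>)) (Y \<tau>)" if \<tau>: "\<tau> \<in> {0..s}" for \<tau>
      proof -
        obtain B where "\<And>k. \<bar>R_mult \<alpha> \<theta> (s - \<tau>) k\<bar> \<le> B" using R_mult_bounded[of "s - \<tau>"] \<tau> by auto
        then have "R_op \<Omega> \<theta> \<phi> \<alpha> (s - \<tau>) (Hfun \<circ> v \<tau>) = L2_of \<Omega> \<phi> (diag (R_mult \<alpha> \<theta> (s - \<tau>)) (L2_coord \<Omega> \<phi> (Hfun \<circ> v \<tau>)))"
          using HvL[of \<tau>] \<tau> s by (intro R_op_eq[OF sys]) (auto simp: comp_def)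
        moreover have "Y \<tau> = L2_coord \<Omega> \<phi> (Hfun \<circ> v \<tau>)" using \<tau> s by (simp add: Y_def y_def comp_def)
        ultimately show ?thesis by (simp add: L2_coord_L2_of[OF sys])
      qed
      then show "AE \<tau> in lebesgue_on {0..s}. R_op \<Omega> \<theta> \<phi> \<alpha> (s - \<tau>) (Hfun \<circ> v \<tau>) \<in> L2 \<Omega> \<longrightarrow>
          L2_coord \<Omega> \<phi> (R_op \<Omega> \<theta> \<phi> \<alpha> (s - \<tau>) (Hfun \<circ> v \<tau>)) = diag (R_mult \<alpha> \<theta> (s - \<tau>)) (Y \<tau>)"
        by (intro AE_I2) simp
    qed simp
    then have "L2_coord \<Omega> \<phi> J = diag (D1_mult \<theta>) (duhamel \<alpha> \<theta> Y s)"
      using has_bochner_integral_integral_eq[OF bi] by simp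
    then have "AE z in lebesgue_on \<Omega>. J z = D1_of \<Omega> \<theta> \<phi> (duhamel \<alpha> \<theta> Y s) z"
      unfolding D1_of_def by (intro L2_of_unique[OF sys] JL)
    moreover have "d s = duhamel \<alpha> \<theta> Y s - duhamel \<alpha> \<theta> (\<lambda>\<tau>. Nem \<Omega> \<theta> \<phi> (x \<tau>)) s"
      unfolding d_def by (rule duhamel_diff[OF alpha theta Ym Yb Nem_x, symmetric])
    ultimately show ?thesis
      using J(2) u_eq[OF s(1)] D1_of_diff[of "duhamel \<alpha> \<theta> Y s" "duhamel \<alpha> \<theta> (\<lambda>\<tau>. Nem \<Omega> \<theta> \<phi> (x \<tau>)) s"]
      by (auto elim!: eventually_elim2)
  qed
  have um: "u s \<in> borel_measurable (lebesgue_on \<Omega>)" for s by (rule L2_measurable[OF D1_of_L2])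
  \<comment> \<open>All earlier times enter the Duhamel integral, so the bound is assumed and
    improved on the whole of [0, t] at once.\<close>
  have halve: "LXi_le \<Omega> (D / 2) (\<lambda>z. v s z - u s z)"
    if D: "\<And>s. 0 \<le> s \<Longrightarrow> s \<le> t \<Longrightarrow> LXi_le \<Omega> D (\<lambda>z. v s z - u s z)" and s: "0 \<le> s" "s \<le> t" for D s
  proof -
    have D0: "0 < D" by (rule LXi_le_pos[OF D[OF s]])
    have "norm (Y \<tau> - Nem \<Omega> \<theta> \<phi> (x \<tau>)) \<le> 200 * M\<^sup>2 * D" if \<tau>: "0 \<le> \<tau>" "\<tau> \<le> s" for \<tau>
    proof -
      have \<tau>t: "0 \<le> \<tau>" "\<tau> \<le> t" using \<tau> s by auto
      have "Y \<tau> - Nem \<Omega> \<theta> \<phi> (x \<tau>) = L2_coord \<Omega> \<phi> (\<lambda>z. Hfun (v \<tau> z) - Hfun (u \<tau> z))"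
        using \<tau>t by (simp add: Y_def y_def Nem_def L2_coord_diff[OF sys HvL[OF \<tau>t] Hfun_D1_of_L2[OF x_small']])
      then have "norm (Y \<tau> - Nem \<Omega> \<theta> \<phi> (x \<tau>)) = L2_norm \<Omega> (\<lambda>z. Hfun (v \<tau> z) - Hfun (u \<tau> z))"
        by (simp add: norm_L2_coord[OF sys L2_diff[OF HvL[OF \<tau>t] Hfun_D1_of_L2[OF x_small']]])
      also have "\<dots> \<le> 200 * M\<^sup>2 * D"
        by (rule Hfun_lipschitz[OF small[OF \<tau>t] embed[OF x_small'] D[OF \<tau>t] M(2)])
      finally show ?thesis .
    qed
    then have "norm (d s) \<le> 200 * M\<^sup>2 * D / lam \<theta> 0"
      unfolding d_def using D0 by (intro norm_duhamel_le[OF alpha theta] borel_measurable_diff Ym Nem_x) auto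
    then have "C * norm (d s) \<le> C * (200 * M\<^sup>2 * D / lam \<theta> 0)" using C by (intro mult_left_mono) auto
    also have "\<dots> = 200 * M\<^sup>2 * C / lam \<theta> 0 * D" by simp
    also have "\<dots> \<le> 1 / 4 * D" using CM D0 by (intro mult_right_mono) auto
    \<comment> \<open>The contraction factor is 1/4 rather than 1/2 so that this inequality,
      required by \<open>embed\<close>, is strict.\<close>
    also have "\<dots> < D / 2" using D0 by simp
    finally have "LXi_le \<Omega> (D / 2) (D1_of \<Omega> \<theta> \<phi> (d s))" by (rule embed)
    then show ?thesis
      by (rule LXi_le_AE_cong[OF _ vu[OF s]]) (use s t in \<open>auto intro!: borel_measurable_diff v_measurable um\<close>)
  qed
  \<comment> \<open>The start of the iteration is \<open>LXi_le_diff\<close> for two functions of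
    size M.\<close>
  have pow: "LXi_le \<Omega> (3 * M / 2 ^ n) (\<lambda>z. v s z - u s z)" if "0 \<le> s" "s \<le> t" for n s
    using that
  proof (induction n arbitrary: s)
    case 0
    show ?case using LXi_le_diff[OF small[OF 0] embed[OF x_small']] by simp
  next
    case (Suc n)
    show ?case using halve[OF Suc.IH Suc.prems] by (simp add: mult.commute)
  qed
  have "LXi_le \<Omega> \<kappa> (\<lambda>z. v s z - u s z)" if "0 < \<kappa>" for \<kappa>
  proof -
    obtain n where "3 * M / \<kappa> < 2 ^ n" using real_arch_pow[of 2 "3 * M / \<kappa>"] by auto
    then have "3 * M / 2 ^ n \<le> \<kappa>" using that by (simp add: field_simps)
    then show ?thesis by (rule LXi_le_mono[OF pow[OF s]])
  qed
  then have "AE z in lebesgue_on \<Omega>. v s z - u s z = 0" by (rule LXi_le_zero)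
  then show ?thesis by eventually_elim simp
qed

text \<open>The integral runs over the null set {0} and vanishes, before anything is known about the
  size of \<open>v\<close>. This starts the continuation in time.\<close>

lemma v_eq_u_0:
  assumes "0 \<le> T"
  shows "AE z in lebesgue_on \<Omega>. v 0 z = u 0 z"
proof -
  obtain J where J: "has_L2_integral \<Omega> (\<lambda>\<tau>. R_op \<Omega> \<theta> \<phi> \<alpha> (0 - \<tau>) (Hfun \<circ> v \<tau>)) J {0..0}"
    "AE z in lebesgue_on \<Omega>. v 0 z = S_op \<Omega> \<theta> \<phi> \<alpha> 0 u0 z + J z"
    using v(2) assms unfolding mild_solution_def by force
  have JL: "J \<in> L2 \<Omega>" using J(1) by (simp add: has_L2_integral_def)
  have "{0..0::real} \<in> null_sets lebesgue" by simp
  then have ae: "AE \<tau> in lebesgue. \<tau> \<notin> {0..0::real}" by (rule AE_not_in)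
  have ae0: "AE \<tau> in lebesgue_on {0..0::real}. P \<tau>" for P
    by (subst AE_restrict_space_iff) (simp, rule eventually_mono[OF ae], simp)
  have "L2_coord \<Omega> \<phi> J = (LINT \<tau>|lebesgue_on {0..0::real}. 0)"
  proof (rule has_L2_integral_coord[OF sys _ J(1)])
    show "{0..0::real} \<in> sets lebesgue" by simp
    show "integrable (lebesgue_on {0..0::real}) (\<lambda>_. 0 :: ell2)" by simp
  qed (rule ae0)
  then have "L2_coord \<Omega> \<phi> J = diag (D1_mult \<theta>) 0" by (simp add: linear_0[OF D1_mult_linear])
  then have J0: "AE z in lebesgue_on \<Omega>. J z = D1_of \<Omega> \<theta> \<phi> 0 z"
    unfolding D1_of_def by (intro L2_of_unique[OF sys] JL)
  have "AE z in lebesgue_on \<Omega>. u 0 z = S_op \<Omega> \<theta> \<phi> \<alpha> 0 u0 z + D1_of \<Omega> \<theta> \<phi> 0 z"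
    using u_eq[of 0] by (simp add: duhamel_def)
  with J(2) J0 show ?thesis by eventually_elim simp
qed

lemma v_eq_u:
  assumes "t \<in> {0..T}"
  shows "AE z in lebesgue_on \<Omega>. v t z = u t z"
proof -
  have T: "0 \<le> T" using assms by simp
  define A where "A = {t \<in> {0..T}. \<forall>s\<in>{0..t}. AE z in lebesgue_on \<Omega>. v s z = u s z}"
  define r where "r = Sup A"
  have A0: "0 \<in> A" using v_eq_u_0[OF T] T by (simp add: A_def)
  have bdd: "bdd_above A" by (auto simp: A_def bdd_above_def)
  have "r \<le> T" unfolding r_def using A0 by (intro cSup_least) (auto simp: A_def)
  moreover have "0 \<le> r" unfolding r_def by (rule cSup_upper[OF A0 bdd])
  ultimately have r: "0 \<le> r" "r \<le> T" by auto
  have before: "AE z in lebesgue_on \<Omega>. v s z = u s z" if s: "0 \<le> s" "s < r" for s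
  proof -
    obtain a where "a \<in> A" "s < a" using less_cSup_iff[OF _ bdd, of s] A0 s(2) unfolding r_def by blast
    then show ?thesis using s by (simp add: A_def)
  qed
  have um: "u s \<in> borel_measurable (lebesgue_on \<Omega>)" for s by (rule L2_measurable[OF D1_of_L2])
  \<comment> \<open>Agreement before r extends to r because both functions are continuous into
    L^\<Xi>. The case r = 0 has no earlier times and is \<open>v_eq_u_0\<close>.\<close>
  have at_r: "AE z in lebesgue_on \<Omega>. v r z = u r z"
  proof (cases "r = 0")
    case True then show ?thesis using v_eq_u_0[OF T] by simp
  next
    case False
    have "LXi_le \<Omega> \<kappa> (\<lambda>z. v r z - u r z)" if "0 < \<kappa>" for \<kappa>
    proof -
      define e where "e = \<kappa> / 3"
      have e: "0 < e" "3 * e = \<kappa>" using that by (auto simp: e_def)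
      obtain \<eta>1 where \<eta>1: "\<eta>1 > 0" "\<And>s. s \<in> {0..T} \<Longrightarrow> \<bar>s - r\<bar> < \<eta>1 \<Longrightarrow> LXi_le \<Omega> e (\<lambda>z. v s z - v r z)"
        using v_diff_LXi_le[of r e] r e by auto
      have "\<forall>\<^sub>F s in at_left r. C * norm (x s - x r) < e"
      proof (rule order_tendstoD(2)[OF _ e(1)])
        have "(x \<longlongrightarrow> x r) (at_left r)"
          using x(1) by (auto simp: continuous_on_eq_continuous_at isCont_def intro: tendsto_within_subset[of _ _ _ UNIV])
        from tendsto_mult_right_zero[OF tendsto_norm_zero[OF LIM_zero[OF this]], of C]
        show "((\<lambda>s. C * norm (x s - x r)) \<longlongrightarrow> 0) (at_left r)" .
      qed
      moreover have "\<forall>\<^sub>F s in at_left r. s \<in> {max 0 (r - \<eta>1)<..<r}"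
        using r False \<eta>1(1) by (intro eventually_at_left_real) auto
      ultimately have "\<forall>\<^sub>F s in at_left r. C * norm (x s - x r) < e \<and> s \<in> {max 0 (r - \<eta>1)<..<r}" by (rule eventually_conj)
      from eventually_happens'[OF trivial_limit_at_left_real this]
      obtain s where s: "C * norm (x s - x r) < e" "0 \<le> s" "s < r" "r - \<eta>1 < s" by auto
      \<comment> \<open>At a time s before r both functions agree, so the difference at r is the
        difference of their two increments, each of size at most e = \<kappa> / 3.\<close>
      have "LXi_le \<Omega> (3 * e) (\<lambda>z. (u s z - u r z) - (v s z - v r z))"
        using s r \<eta>1(2)[of s] by (intro LXi_le_diff D1_of_diff_LXi_le) auto
      moreover have "AE z in lebesgue_on \<Omega>. v r z - u r z = (u s z - u r z) - (v s z - v r z)"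
        using before[OF s(2,3)] by eventually_elim simp
      ultimately show ?thesis unfolding e(2)
        by (rule LXi_le_AE_cong) (use r in \<open>auto intro!: borel_measurable_diff v_measurable um\<close>)
    qed
    then have "AE z in lebesgue_on \<Omega>. v r z - u r z = 0" by (rule LXi_le_zero)
    then show ?thesis by eventually_elim simp
  qed
  have small_of_eq: "LXi_le \<Omega> (M / 3) (v s)" if "AE z in lebesgue_on \<Omega>. v s z = u s z" "s \<in> {0..T}" for s
    by (rule LXi_le_AE_cong[OF embed[OF x_small] that(1) v_measurable[OF that(2)]])
  have "r = T"
  proof (rule ccontr)
    assume "r \<noteq> T"
    then have "r < T" using r by simp
    obtain \<eta> where \<eta>: "\<eta> > 0" "\<And>s. s \<in> {0..T} \<Longrightarrow> \<bar>s - r\<bar> < \<eta> \<Longrightarrow> LXi_le \<Omega> (M / 3) (\<lambda>z. v s z - v r z)"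
      using v_diff_LXi_le[of r "M / 3"] r M by auto
    \<comment> \<open>A time strictly beyond r, still within T and within the range in which
      \<open>v\<close> has moved by at most M / 3.\<close>
    define q where "q = min T (r + \<eta> / 2)"
    have q: "r < q" "q \<le> T" "q - r < \<eta>" using \<open>r < T\<close> \<eta>(1) by (auto simp: q_def)
    \<comment> \<open>The negative sign lets the rule for differences act as one for sums: v s = (v
      s - v r) - (- v r).\<close>
    have minus_r: "LXi_le \<Omega> (M / 3) (\<lambda>z. - v r z)"
      using small_of_eq[OF at_r] r by (simp add: LXi_le_def)
    have "LXi_le \<Omega> M (v s)" if "0 \<le> s" "s \<le> q" for s
    proof (cases "s < r")
      case True
      then have "LXi_le \<Omega> (M / 3) (v s)" using that r by (intro small_of_eq before) auto
      then show ?thesis by (rule LXi_le_mono) (use M in simp)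
    next
      case False
      then have "LXi_le \<Omega> (M / 3) (\<lambda>z. v s z - v r z)" using that q by (intro \<eta>(2)) auto
      from LXi_le_diff[OF this minus_r] show ?thesis by simp
    qed
    then have "\<forall>s\<in>{0..q}. AE z in lebesgue_on \<Omega>. v s z = u s z"
      using v_eq_u_where_small[OF q(2)] by auto
    then have "q \<in> A" using q r by (simp add: A_def)
    then have "q \<le> r" unfolding r_def using bdd by (rule cSup_upper)
    then show False using q by simp
  qed
  then show ?thesis using before[of t] at_r assms by (cases "t = T") auto
qed

end

end

end

end

theorem theorem4p6:
  fixes \<alpha> :: real and \<Omega> :: "(real^2) set"
    and \<theta> :: "nat \<Rightarrow> real" and \<phi> :: "nat \<Rightarrow> real^2 \<Rightarrow> real" and H :: "real \<Rightarrow> real"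
  assumes "\<alpha> \<in> {0<..<1}"
    and "bounded_domain \<Omega>" and "Ck_boundary 2 \<Omega>"
    and "Dirichlet_eigensystem \<Omega> \<theta> \<phi>"
    and "H = (\<lambda>z. z ^ 3 * exp (z\<^sup>2))"
  shows "\<exists>\<delta>>0. \<forall>T>0. \<forall>u0 \<in> D1 \<Omega> \<theta> \<phi>. D1_norm \<Omega> \<theta> \<phi> u0 \<le> \<delta> \<longrightarrow>
           (\<exists>u \<in> C_LXi {0..T} \<Omega>. mild_solution \<Omega> \<theta> \<phi> \<alpha> H u0 T u \<and>
              (\<forall>v \<in> C_LXi {0..T} \<Omega>. mild_solution \<Omega> \<theta> \<phi> \<alpha> H u0 T v \<longrightarrow>
                 (\<forall>t\<in>{0..T}. AE x in lebesgue_on \<Omega>. v t x = u t x)))"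
proof -
  have alpha: "0 < \<alpha>" "\<alpha> < 1" using assms(1) by auto
  note dom = assms(2) and eig = assms(4)
  note sys = sys[OF alpha dom eig] and theta = theta[OF alpha dom eig]
  have H: "H = Hfun" by (simp add: assms(5) Hfun_def[abs_def])
  obtain C M where CM: "C > 0" "M > 0" "M\<^sup>2 \<le> 1 / 32" "200 * M\<^sup>2 * C / lam \<theta> 0 \<le> 1 / 4"
    "\<forall>x \<kappa>. C * norm x < \<kappa> \<longrightarrow> LXi_le \<Omega> \<kappa> (D1_of \<Omega> \<theta> \<phi> x)"
    by (rule smallness_constants[OF alpha dom eig]) blast
  note facts = alpha dom eig CM
  \<comment> \<open>It depends on C and M only, so it is fixed before T and the datum. Half of the
    radius leaves room for the Duhamel term.\<close>
  define \<delta> where "\<delta> = \<rho> C M / 2"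
  show ?thesis
  proof (intro exI[of _ \<delta>] conjI allI impI ballI)
    show "\<delta> > 0" using rho(1)[OF facts] by (simp add: \<delta>_def)
    fix T :: real and u0 assume "T > 0" and u0: "u0 \<in> D1 \<Omega> \<theta> \<phi>" "D1_norm \<Omega> \<theta> \<phi> u0 \<le> \<delta>"
    \<comment> \<open>Energy coordinates of the datum: their \<open>ell2\<close> norm is the D1
      norm, and \<open>D1_mult\<close> turns them into L^2 coordinates.\<close>
    define x0 where "x0 = Abs_ell2 (\<lambda>k. sqrt (\<theta> k) * L2_inner \<Omega> u0 (\<phi> k))"
    have u0L: "u0 \<in> L2 \<Omega>" and u0s: "summable (\<lambda>k. \<theta> k * (L2_inner \<Omega> u0 (\<phi> k))\<^sup>2)" using u0(1) by (auto simp: D1_def)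
    have sq: "(sqrt (\<theta> k) * L2_inner \<Omega> u0 (\<phi> k))\<^sup>2 = \<theta> k * (L2_inner \<Omega> u0 (\<phi> k))\<^sup>2" for k
      using theta(1)[of k] by (simp add: power_mult_distrib)
    have x0: "coord x0 k = sqrt (\<theta> k) * L2_inner \<Omega> u0 (\<phi> k)" for k
      unfolding x0_def by (rule coord_Abs) (simp only: sq u0s)
    have "norm x0 = D1_norm \<Omega> \<theta> \<phi> u0"
      unfolding D1_norm_def sq[symmetric] x0[symmetric] norm_ell2_sq[symmetric] by simp
    then have nx0: "norm x0 \<le> \<rho> C M / 2" using u0(2) by (simp add: \<delta>_def)
    have cx0: "L2_coord \<Omega> \<phi> u0 = diag (D1_mult \<theta>) x0"
      by (rule ell2_eqI) (use theta(1) in \<open>simp add: coord_L2_coord[OF sys u0L] coord_D1_mult[OF alpha dom eig] x0 D1_mult_def less_imp_neq[THEN not_sym]\<close>)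
    obtain x where x: "continuous_on UNIV x" "\<And>t. norm (x t) \<le> \<rho> C M"
      "\<And>t. x t = diag (S_mult \<alpha> \<theta> (max 0 t)) x0 + duhamel \<alpha> \<theta> (\<lambda>\<tau>. Nem \<Omega> \<theta> \<phi> (x \<tau>)) t"
      by (rule mild_coordinates_exist[OF facts nx0]) (rule that, assumption+)
    show "\<exists>u \<in> C_LXi {0..T} \<Omega>. mild_solution \<Omega> \<theta> \<phi> \<alpha> H u0 T u \<and>
              (\<forall>v \<in> C_LXi {0..T} \<Omega>. mild_solution \<Omega> \<theta> \<phi> \<alpha> H u0 T v \<longrightarrow>
                 (\<forall>t\<in>{0..T}. AE x in lebesgue_on \<Omega>. v t x = u t x))"
      unfolding H
      using u_C_LXi[OF facts u0L cx0 x] u_mild[OF facts u0L cx0 x] v_eq_u[OF facts u0L cx0 x]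
      by (intro bexI[of _ "\<lambda>t. D1_of \<Omega> \<theta> \<phi> (x t)"] conjI ballI impI) auto
  qed
qed

end
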